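(* Let $b\ge2$ and $l\ge0$ be integers, $\varkappa>0$, $Q(t)=e^{-2\varkappa t}$, and let $q\in C^1(\mathbb R_+)$ satisfy, with some constants $c,C>0$, $$cQ(t)\le q(t)\le CQ(t),\qquad |q'(t)|\le CQ(t),\qquad\forall t\in\mathbb R_+ .$$ Let $I$ be a compact interval with $I\subset\overline{\mathfrak l_0}$ (if $l=0$) or $I\subset\overline{\mathfrak l_l}\setminus\{(\pi l)^2\}$ (if $l\ge1$), let $\lambda_1,\lambda_2\in I$ with $\lambda_1<\lambda_2$, and let $g_0>e$ be a constant. Then there is a constant $C'$, independent of $g$ and uniform in $\lambda_1,\lambda_2\in I$, such that $$\widetilde N(\lambda_1,\lambda_2;\mathbf A_{-gq})\le C'(\ln g)^2,\qquad g\ge g_0 .$$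
   Context: Half-line operators: for a bounded real measurable $V$ on $\mathbb R_+$, $A_V$ is the self-adjoint operator in $L^2(\mathbb R_+)$ acting as $-y''+Vy$ on each interval $(n-1,n)$, $n\in\mathbb N$, on functions with $y\in\mathsf H^2(n-1,n)$ for all $n$, $\sum_n\int_{n-1}^n(|y''|^2+|y|^2)dt<\infty$, $y(0)=0$, and $y(n+)=b^{1/2}y(n-)$, $y'(n+)=b^{-1/2}y'(n-)$ for all $n\in\mathbb N$. $N(\lambda_1,\lambda_2;A_V)$ is the total multiplicity of the eigenvalues of $A_V$ in the open interval $(\lambda_1,\lambda_2)$. $\mathbf A_V$ denotes the Schrödinger operator $-\boldsymbol\Delta+V(|x|)$ on the homogeneous rooted metric tree with branching number $b$; it enters the claim only through the notation $\widetilde N(\lambda_1,\lambda_2;\mathbf A_V):=\sum_{k\ge0}N(\lambda_1,\lambda_2;A_{V_k})$, $V_k(t)=V(t+k)$. Gaps: $R=\frac{b^{1/2}+b^{-1/2}}2$, $\theta=\arccos(1/R)$, $\mathfrak l_0=(-\infty,\theta^2)$, $\mathfrak l_l=((\pi l-\theta)^2,(\pi l+\theta)^2)$ for $l\ge1$. *)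

theory Defs
  imports "HOL-Analysis.Analysis"
begin

text \<open>The one-dimensional Sobolev space \<open>H\<^sup>2(p, r)\<close> on a bounded interval, in its usual
  description for ordinary differential operators: \<open>y\<close> is the \<open>C\<^sup>1\<close> representative, \<open>y1 = y'\<close>
  is absolutely continuous (the indefinite integral of \<open>y2\<close>), and \<open>y2 = y''\<close> is in \<open>L\<^sup>2(p, r)\<close>.
  In particular \<open>y\<close> and \<open>y1\<close> have one-sided limits at \<open>p\<close> and \<open>r\<close>.\<close>

definition H2_on :: "real \<Rightarrow> real \<Rightarrow> (real \<Rightarrow> complex) \<Rightarrow> (real \<Rightarrow> complex) \<Rightarrow> (real \<Rightarrow> complex) \<Rightarrow> bool"
  where "H2_on p r y y1 y2 \<longleftrightarrow>
    (\<forall>t\<in>{p<..<r}. (y has_vector_derivative y1 t) (at t)) \<and>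
    set_borel_measurable lborel {p<..<r} y2 \<and>
    set_integrable lborel {p<..<r} (\<lambda>t. (norm (y2 t))\<^sup>2) \<and>
    (\<forall>s t. p < s \<longrightarrow> s \<le> t \<longrightarrow> t < r \<longrightarrow> y1 t - y1 s = (LINT x:{s..t}|lborel. y2 x))"

text \<open>The graph of \<open>A\<^sub>V\<close>: \<open>y\<close> lies in the domain and \<open>A\<^sub>V y = f\<close> as elements of
  \<open>L\<^sup>2(0, \<infinity>)\<close>.  Elements of the domain are represented by functions that are \<open>C\<^sup>1\<close> on every
  \<open>(n, n + 1)\<close>; their values at the integers and on the negative half-line play no role, so
  \<open>y(0)\<close> is read as \<open>y(0+)\<close>.  The intervals are indexed from \<open>0\<close>: \<open>(n, n + 1)\<close> with
  \<open>n \<ge> 0\<close> instead of \<open>(n - 1, n)\<close> with \<open>n \<ge> 1\<close>.\<close>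

definition A_graph :: "nat \<Rightarrow> (real \<Rightarrow> real) \<Rightarrow> (real \<Rightarrow> complex) \<Rightarrow> (real \<Rightarrow> complex) \<Rightarrow> bool"
  where "A_graph b V y f \<longleftrightarrow> (\<exists>y1 y2.
    (\<forall>n::nat. H2_on (real n) (real n + 1) y y1 y2) \<and>
    (\<Sum>n::nat. \<integral>\<^sup>+t\<in>{real n<..<real n + 1}. ennreal ((norm (y2 t))\<^sup>2 + (norm (y t))\<^sup>2) \<partial>lborel) < \<infinity> \<and>
    Lim (at_right 0) y = 0 \<and>
    (\<forall>n::nat. n \<ge> 1 \<longrightarrow>
      Lim (at_right (real n)) y = of_real (sqrt (real b)) * Lim (at_left (real n)) y \<and>
      Lim (at_right (real n)) y1 = of_real (1 / sqrt (real b)) * Lim (at_left (real n)) y1) \<and>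
    (AE t in lborel. 0 < t \<longrightarrow> f t = - y2 t + of_real (V t) * y t))"

text \<open>The multiplicity of a real number \<open>\<lambda>\<close> as an eigenvalue of \<open>A\<^sub>V\<close>: the (possibly infinite)
  complex dimension of \<open>ker (A\<^sub>V - \<lambda>)\<close> in \<open>L\<^sup>2(0, \<infinity>)\<close>, that is, the supremum of the sizes of
  families of eigenfunctions that are linearly independent modulo null functions.
  It is \<open>0\<close> if \<open>\<lambda>\<close> is not an eigenvalue.\<close>

definition eigen_mult :: "nat \<Rightarrow> (real \<Rightarrow> real) \<Rightarrow> real \<Rightarrow> ennreal"
  where "eigen_mult b V lam =
    (SUP m\<in>{m::nat. \<exists>u::nat \<Rightarrow> real \<Rightarrow> complex.
        (\<forall>i<m. A_graph b V (u i) (\<lambda>t. of_real lam * u i t)) \<and>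
        (\<forall>c::nat \<Rightarrow> complex.
          (AE t in lborel. 0 < t \<longrightarrow> (\<Sum>i<m. c i * u i t) = 0) \<longrightarrow> (\<forall>i<m. c i = 0))}.
      of_nat m)"

definition eigen_count :: "nat \<Rightarrow> (real \<Rightarrow> real) \<Rightarrow> real \<Rightarrow> real \<Rightarrow> ennreal"
  where "eigen_count b V l1 l2 = (\<Sum>\<^sub>\<infinity>lam\<in>{l1<..<l2}. eigen_mult b V lam)"

definition tree_count :: "nat \<Rightarrow> (real \<Rightarrow> real) \<Rightarrow> real \<Rightarrow> real \<Rightarrow> ennreal"
  where "tree_count b V l1 l2 = (\<Sum>k::nat. eigen_count b (\<lambda>t. V (t + real k)) l1 l2)"

definition tree_R :: "nat \<Rightarrow> real"
  where "tree_R b = (sqrt (real b) + 1 / sqrt (real b)) / 2"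

definition tree_theta :: "nat \<Rightarrow> real"
  where "tree_theta b = arccos (1 / tree_R b)"

definition gap :: "nat \<Rightarrow> nat \<Rightarrow> real set"
  where "gap b l =
    (if l = 0 then {..<(tree_theta b)\<^sup>2}
     else {(pi * real l - tree_theta b)\<^sup>2<..<(pi * real l + tree_theta b)\<^sup>2})"

end

theory Submission
  imports Defs
begin

text \<open>If \<open>u\<close> is a sum of eigenfunctions with eigenvalues in \<open>(\<alpha>, \<gamma>)\<close>, then
  \<open>\<langle>(A - \<alpha>) u, (A - \<gamma>) u\<rangle> < 0\<close> unless \<open>u = 0\<close>. Hence the number of eigenvalues in \<open>(\<alpha>, \<gamma>)\<close> is at most the
  number of linear conditions on \<open>u\<close> that force this form to be nonnegative. Let \<open>\<gamma> - \<alpha>\<close> be small.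
  On a unit cell where \<open>g q\<close> is not small, \<open>u = u' = 0\<close> at the left end suffices: since \<open>\<bar>q'\<bar> \<le> (C/c) q\<close>,
  the energy estimate \<open>\<parallel>u\<parallel> \<le> const \<parallel>(A - \<alpha>) u\<parallel>\<close> is uniform in \<open>g\<close>. On the tail, where \<open>g q\<close> is
  small, \<open>u = 0\<close> at the left end suffices: one expands around \<open>\<beta> = \<alpha>\<close> if \<open>l \<ge> 1\<close> and \<open>I\<close> lies to the left of
  \<open>(\<pi> l)\<^sup>2\<close>, around \<open>\<beta> = \<gamma>\<close> otherwise, and in a closed gap the form \<open>\<langle>(A - \<beta>) u, u\<rangle>\<close> reduces, up to
  \<open>O(\<parallel>(A - \<beta>) u\<parallel>\<^sup>2)\<close>, to a discrete Dirichlet form of definite sign, which also dominates the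
  exponentially small potential. For \<open>V\<^sub>k\<close> this costs at most \<open>3 (M - k)\<close> conditions with
  \<open>M = O(ln g)\<close>, and the sum over \<open>k\<close> is \<open>O((ln g)\<^sup>2)\<close>.\<close>

section \<open>Estimates on a unit cell\<close>

text \<open>A closed gap may reach the edge of a band, where the unperturbed operator has no bounded
  inverse. Only definiteness of the vertex form survives there, and a Hardy inequality has to
  replace a spectral gap. With \<open>f = (A - \<beta>) u\<close> the form becomes
  \<open>||f||^2 + (\<gamma> - \<alpha>) <f, u>\<close> for \<open>\<beta> = \<gamma>\<close> and
  \<open>||f||^2 - (\<gamma> - \<alpha>) <f, u>\<close> for \<open>\<beta> = \<alpha>\<close>: the
  choice of \<beta> adapts the sign of the cross term to that of the vertex form, and errors of
  order \<open>||f||^2\<close> are harmless once \<gamma> - \<alpha> is small. How small does not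
  depend on \<open>g\<close>, so a fixed number of short intervals covers \<open>(l1, l2)\<close>.
  The point \<open>(\<pi> l)^2\<close> is excluded because the Dirichlet problem on a cell is
  singular there, and the reduction to vertex values divides by \<open>s 1\<close>. The conditions
  in the head are renewed in every cell, since a single Gronwall estimate across O(ln g) cells would
  lose a power of \<open>g\<close> and force the intervals to shrink with \<open>g\<close>. Sums
  over the half-line are truncated at a vertex \<open>N\<close>; the boundary terms vanish in the
  limit.\<close>

definition cell_ode :: "(real \<Rightarrow> real) \<Rightarrow> (real \<Rightarrow> real) \<Rightarrow> (real \<Rightarrow> real) \<Rightarrow> bool"
  where "cell_ode u u1 u2 \<longleftrightarrow> continuous_on {0..1} u \<and> continuous_on {0..1} u1 \<and>
    (\<forall>t\<in>{0<..<1}. (u has_real_derivative u1 t) (at t) \<and> (u1 has_real_derivative u2 t) (at t))"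

text \<open>Cauchy-Schwarz against the constant 1: the integral of \<open>(f - m)^2\<close> is
  nonnegative, \<open>m\<close> being the mean value of \<open>f\<close>.\<close>

lemma integral_power2_le:
  fixes f :: "real \<Rightarrow> real"
  assumes "a \<le> b" "continuous_on {a..b} f"
  shows "(integral {a..b} f)\<^sup>2 \<le> (b - a) * integral {a..b} (\<lambda>t. (f t)\<^sup>2)"
proof (cases "a = b")
  case False
  with assms have ab: "b - a > 0" by simp
  define m where "m = integral {a..b} f / (b - a)"
  have i: "f integrable_on {a..b}" "(\<lambda>t. (f t)\<^sup>2) integrable_on {a..b}"
    by (intro integrable_continuous_real continuous_intros assms)+
  have "0 \<le> integral {a..b} (\<lambda>t. (f t - m)\<^sup>2)"
    by (intro integral_nonneg integrable_continuous_real continuous_intros assms) auto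
  also have "integral {a..b} (\<lambda>t. (f t - m)\<^sup>2) =
      integral {a..b} (\<lambda>t. (f t)\<^sup>2 - (2 * m) * f t + m\<^sup>2)"
    by (simp add: power2_diff algebra_simps)
  also have "\<dots> = integral {a..b} (\<lambda>t. (f t)\<^sup>2) - 2 * m * integral {a..b} f + m\<^sup>2 * (b - a)"
    using i assms(1)
    by (subst integral_add; (subst integral_diff)?) (auto intro!: integrable_diff integrable_on_mult_right)
  finally have "0 \<le> integral {a..b} (\<lambda>t. (f t)\<^sup>2) - 2 * m * integral {a..b} f + m\<^sup>2 * (b - a)" .
  then have "0 \<le> (b - a) * (integral {a..b} (\<lambda>t. (f t)\<^sup>2) - 2 * m * integral {a..b} f + m\<^sup>2 * (b - a))"
    using ab by (metis less_imp_le mult_nonneg_nonneg)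
  also have "\<dots> = (b - a) * integral {a..b} (\<lambda>t. (f t)\<^sup>2) - (integral {a..b} f)\<^sup>2"
  proof -
    have "m * (b - a) = integral {a..b} f" using ab by (simp add: m_def)
    then show ?thesis by (simp add: algebra_simps power2_eq_square flip: \<open>m * (b - a) = integral {a..b} f\<close>)
  qed
  finally show ?thesis by simp
qed simp

lemma integral_mono_continuous:
  fixes f g :: "real \<Rightarrow> real"
  assumes "continuous_on {a..b} f" "continuous_on {a..b} g" "\<And>t. t \<in> {a..b} \<Longrightarrow> f t \<le> g t"
  shows "integral {a..b} f \<le> integral {a..b} g"
  by (intro integral_le integrable_continuous_real assms)

lemma has_integral_unit_cell:
  assumes "0 \<le> x" "x \<le> 1" "continuous_on {0..1} f"
    and "\<And>t. 0 < t \<Longrightarrow> t < 1 \<Longrightarrow> (f has_real_derivative f' t) (at t)"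
  shows "(f' has_integral (f x - f 0)) {0..x}"
  using assms
  by (intro fundamental_theorem_of_calculus_interior)
     (auto intro: continuous_on_subset simp flip: has_real_derivative_iff_has_vector_derivative)

text \<open>The expression \<open>u \<phi>1 - u1 \<phi>\<close> has derivative
  \<open>F \<phi>\<close>. A solution \<phi> that vanishes at one end leaves only one boundary
  derivative of \<open>u\<close>; the variable upper end \<open>x\<close> yields variation of
  constants.\<close>

lemma green_cell:
  assumes u: "cell_ode u u1 (\<lambda>t. - \<beta> * u t - F t)"
    and \<phi>: "\<And>t. (\<phi> has_real_derivative \<phi>1 t) (at t)" "\<And>t. (\<phi>1 has_real_derivative - \<beta> * \<phi> t) (at t)"
    and x: "0 \<le> x" "x \<le> 1"
  shows "((\<lambda>t. F t * \<phi> t) has_integral (u x * \<phi>1 x - u1 x * \<phi> x - u 0 * \<phi>1 0 + u1 0 * \<phi> 0)) {0..x}"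
proof -
  have c\<phi>: "continuous_on A \<phi>" "continuous_on A \<phi>1" for A
    using \<phi> by (meson DERIV_isCont continuous_at_imp_continuous_on)+
  have "((\<lambda>t. F t * \<phi> t) has_integral ((u x * \<phi>1 x - u1 x * \<phi> x) - (u 0 * \<phi>1 0 - u1 0 * \<phi> 0))) {0..x}"
  proof (rule has_integral_unit_cell[OF x])
    show "continuous_on {0..1} (\<lambda>t. u t * \<phi>1 t - u1 t * \<phi> t)"
      using u by (intro continuous_intros c\<phi>) (auto simp: cell_ode_def)
    fix t :: real assume t: "0 < t" "t < 1"
    then have "(u has_real_derivative u1 t) (at t)"
      "(u1 has_real_derivative (- \<beta> * u t - F t)) (at t)"
      using u by (auto simp: cell_ode_def)
    then show "((\<lambda>t. u t * \<phi>1 t - u1 t * \<phi> t) has_real_derivative F t * \<phi> t) (at t)"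
      by (auto intro!: derivative_eq_intros \<phi> simp: algebra_simps)
  qed
  then show ?thesis by (simp add: algebra_simps)
qed

text \<open>Gronwall for the energy \<open>u'\<^sup>2 + (p + 1) u\<^sup>2\<close>. Only the logarithmic derivative of \<open>p\<close> enters
  the constant, so the bound is uniform in the coupling.\<close>

lemma energy_cell:
  assumes u: "cell_ode u u1 (\<lambda>t. (- p t - \<beta>) * u t - f t)"
    and p: "continuous_on {0..1} p" "\<And>t. 0 < t \<Longrightarrow> t < 1 \<Longrightarrow> (p has_real_derivative p' t) (at t)"
      "\<And>t. 0 \<le> t \<Longrightarrow> t \<le> 1 \<Longrightarrow> 0 \<le> p t" "\<And>t. 0 < t \<Longrightarrow> t < 1 \<Longrightarrow> \<bar>p' t\<bar> \<le> K * p t"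
    and f: "continuous_on {0..1} f"
    and B: "\<bar>\<beta>\<bar> \<le> B" and K: "0 \<le> K"
    and z: "u 0 = 0" "u1 0 = 0"
  shows "integral {0..1} (\<lambda>t. (u t)\<^sup>2) \<le> exp (2 + B + K) * integral {0..1} (\<lambda>t. (f t)\<^sup>2)"
proof -
  \<comment> \<open>In the derivative of the energy, \<open>1 + B\<close> pays for
    \<open>2 (1 - \<beta>) u u'\<close>, another 1 for \<open>2 u' f\<close>, and \<open>K\<close>
    for \<open>p'\<close>.\<close>
  define L where "L = 2 + B + K"
  have L: "L > 0" using B K by (simp add: L_def)
  define E where "E t = (u1 t)\<^sup>2 + (p t + 1) * (u t)\<^sup>2" for t
  define E' where "E' t = 2 * u1 t * ((- p t - \<beta>) * u t - f t) + p' t * (u t)\<^sup>2 + (p t + 1) * (2 * u t * u1 t)" for t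
  have cu: "continuous_on {0..1} u" "continuous_on {0..1} u1" using u by (auto simp: cell_ode_def)
  have If: "(\<lambda>t. (f t)\<^sup>2) integrable_on {0..1}"
    by (intro integrable_continuous_real continuous_intros f)
  have bound: "E' t - L * E t \<le> (f t)\<^sup>2" if t: "0 < t" "t < 1" for t
  proof -
    \<comment> \<open>The terms in \<open>p u u'\<close> cancel. This is why the energy carries the
      weight \<open>p + 1\<close>, and why only \<open>p'\<close> is left to be bounded.\<close>
    have "E' t = 2 * (1 - \<beta>) * (u1 t * u t) - 2 * u1 t * f t + p' t * (u t)\<^sup>2"
      by (simp add: E'_def algebra_simps)
    moreover have "2 * (1 - \<beta>) * (u1 t * u t) \<le> (1 + B) * ((u1 t)\<^sup>2 + (u t)\<^sup>2)"
    proof -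
      have "2 * (1 - \<beta>) * (u1 t * u t) \<le> \<bar>1 - \<beta>\<bar> * (2 * \<bar>u1 t * u t\<bar>)"
      proof -
        have "2 * ((1 - \<beta>) * (u1 t * u t)) \<le> 2 * (\<bar>1 - \<beta>\<bar> * \<bar>u1 t * u t\<bar>)"
          using abs_ge_self[of "(1 - \<beta>) * (u1 t * u t)"] unfolding abs_mult by linarith
        then show ?thesis by (simp add: algebra_simps)
      qed
      also have "\<dots> \<le> (1 + B) * ((u1 t)\<^sup>2 + (u t)\<^sup>2)"
      proof (rule mult_mono)
        show "2 * \<bar>u1 t * u t\<bar> \<le> (u1 t)\<^sup>2 + (u t)\<^sup>2"
          using sum_squares_bound[of "\<bar>u1 t\<bar>" "\<bar>u t\<bar>"] by (simp add: abs_mult)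
      qed (use B in auto)
      finally show ?thesis .
    qed
    moreover have "- 2 * u1 t * f t \<le> (u1 t)\<^sup>2 + (f t)\<^sup>2"
      using sum_squares_bound[of "- u1 t" "f t"] by simp
    moreover have "p' t * (u t)\<^sup>2 \<le> K * p t * (u t)\<^sup>2"
      using p(4)[OF t] by (intro mult_right_mono) auto
    moreover have "L * E t = (1 + B) * ((u1 t)\<^sup>2 + (u t)\<^sup>2) + (u1 t)\<^sup>2 + K * p t * (u t)\<^sup>2
       + K * (u1 t)\<^sup>2 + (1 + K) * (u t)\<^sup>2 + (2 + B) * p t * (u t)\<^sup>2"
      by (simp add: L_def E_def algebra_simps)
    moreover have "0 \<le> K * (u1 t)\<^sup>2" "0 \<le> (1 + K) * (u t)\<^sup>2" "0 \<le> (2 + B) * p t * (u t)\<^sup>2"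
      using K B p(3)[of t] t by auto
    ultimately show ?thesis by linarith
  qed
  have Ebound: "E x \<le> exp L * integral {0..1} (\<lambda>t. (f t)\<^sup>2)" if x: "0 \<le> x" "x \<le> 1" for x
  proof -
    have "((\<lambda>t. (E' t - L * E t) * exp (- L * t)) has_integral (E x * exp (- L * x) - E 0 * exp (- L * 0))) {0..x}"
    proof (rule has_integral_unit_cell[OF x])
      show "continuous_on {0..1} (\<lambda>t. E t * exp (- L * t))"
        unfolding E_def by (intro continuous_intros cu p)
      fix t :: real assume t: "0 < t" "t < 1"
      then have "(u has_real_derivative u1 t) (at t)"
        "(u1 has_real_derivative ((- p t - \<beta>) * u t - f t)) (at t)"
        using u by (auto simp: cell_ode_def)
      then show "((\<lambda>t. E t * exp (- L * t)) has_real_derivative (E' t - L * E t) * exp (- L * t)) (at t)"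
        unfolding E_def E'_def using p(2)[OF t]
        by (auto intro!: derivative_eq_intros simp: algebra_simps)
    qed
    moreover have "E 0 = 0" using z by (simp add: E_def)
    ultimately have h: "((\<lambda>t. (E' t - L * E t) * exp (- L * t)) has_integral (E x * exp (- L * x))) {0..x}"
      by simp
    have If': "(\<lambda>t. (f t)\<^sup>2) integrable_on {0..x}"
      by (rule integrable_on_subinterval[OF If]) (use x in auto)
    \<comment> \<open>The differential inequality is known only inside the cell, so the integrand is
      reset at the end points.\<close>
    have "((\<lambda>t. if t \<in> {0,x} then 0 else (E' t - L * E t) * exp (- L * t)) has_integral (E x * exp (- L * x))) {0..x}"
      by (rule has_integral_spike_finite[OF _ _ h, of "{0,x}"]) auto
    then have "E x * exp (- L * x) \<le> integral {0..x} (\<lambda>t. (f t)\<^sup>2)"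
    proof (rule has_integral_le)
      show "((\<lambda>t. (f t)\<^sup>2) has_integral integral {0..x} (\<lambda>t. (f t)\<^sup>2)) {0..x}"
        using If' by (rule integrable_integral)
      fix t assume t: "t \<in> {0..x}"
      show "(if t \<in> {0,x} then 0 else (E' t - L * E t) * exp (- L * t)) \<le> (f t)\<^sup>2"
      proof (cases "t \<in> {0,x}")
        case False
        then have t': "0 < t" "t < 1" using t x by auto
        have "(E' t - L * E t) * exp (- L * t) \<le> (f t)\<^sup>2 * exp (- L * t)"
          using bound[OF t'] by (intro mult_right_mono) auto
        also have "\<dots> \<le> (f t)\<^sup>2 * 1"
          using L t' by (intro mult_left_mono) (auto simp: mult_nonneg_nonneg)
        finally show ?thesis using False by simp
      qed auto
    qed
    also have "\<dots> \<le> integral {0..1} (\<lambda>t. (f t)\<^sup>2)"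
      by (rule integral_subset_le) (use x If If' in auto)
    finally have "E x * exp (- L * x) * exp (L * x) \<le> integral {0..1} (\<lambda>t. (f t)\<^sup>2) * exp (L * x)"
      by (intro mult_right_mono) auto
    then have "E x \<le> integral {0..1} (\<lambda>t. (f t)\<^sup>2) * exp (L * x)"
      by (simp add: mult.assoc flip: exp_add)
    also have "\<dots> \<le> integral {0..1} (\<lambda>t. (f t)\<^sup>2) * exp L"
      using x L by (intro mult_left_mono integral_nonneg If) auto
    finally show ?thesis by (simp add: mult.commute)
  qed
  have "integral {0..1} (\<lambda>t. (u t)\<^sup>2) \<le> integral {0..1} (\<lambda>t::real. exp L * integral {0..1} (\<lambda>t. (f t)\<^sup>2))"
  proof (rule integral_mono_continuous)
    fix t :: real assume t: "t \<in> {0..1}"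
    have "(u t)\<^sup>2 \<le> E t" using p(3)[of t] t by (simp add: E_def algebra_simps)
    also have "\<dots> \<le> exp L * integral {0..1} (\<lambda>t. (f t)\<^sup>2)" using Ebound t by simp
    finally show "(u t)\<^sup>2 \<le> exp L * integral {0..1} (\<lambda>t. (f t)\<^sup>2)" .
  qed (intro continuous_intros cu)+
  then show ?thesis by (simp add: L_def)
qed

lemma integral_mult_power2_le:
  fixes F \<phi> :: "real \<Rightarrow> real"
  assumes F: "continuous_on {0..1} F" and \<phi>: "continuous_on {0..1} \<phi>"
    and le: "\<And>t. t \<in> {0..x} \<Longrightarrow> \<bar>\<phi> t\<bar> \<le> M" and x: "0 \<le> x" "x \<le> 1"
  shows "(integral {0..x} (\<lambda>t. F t * \<phi> t))\<^sup>2 \<le> M\<^sup>2 * integral {0..1} (\<lambda>t. (F t)\<^sup>2)"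
proof -
  have F': "continuous_on {0..x} F" and \<phi>': "continuous_on {0..x} \<phi>"
    using continuous_on_subset[OF F] continuous_on_subset[OF \<phi>] x by auto
  have "(integral {0..x} (\<lambda>t. F t * \<phi> t))\<^sup>2 \<le> (x - 0) * integral {0..x} (\<lambda>t. (F t * \<phi> t)\<^sup>2)"
    by (rule integral_power2_le) (intro continuous_intros F' \<phi>' x)+
  also have "\<dots> \<le> 1 * integral {0..x} (\<lambda>t. (F t * \<phi> t)\<^sup>2)"
    using x by (intro mult_right_mono integral_nonneg integrable_continuous_real continuous_intros F' \<phi>') auto
  also have "integral {0..x} (\<lambda>t. (F t * \<phi> t)\<^sup>2) \<le> integral {0..x} (\<lambda>t. M\<^sup>2 * (F t)\<^sup>2)"
  proof (rule integral_mono_continuous)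
    fix t assume t: "t \<in> {0..x}"
    have "(\<phi> t)\<^sup>2 \<le> M\<^sup>2"
      using le[OF t] by (subst abs_le_square_iff[symmetric]) linarith
    then show "(F t * \<phi> t)\<^sup>2 \<le> M\<^sup>2 * (F t)\<^sup>2"
      unfolding power_mult_distrib by (subst mult.commute) (intro mult_right_mono, auto)
  qed (intro continuous_intros F' \<phi>')+
  also have "\<dots> = M\<^sup>2 * integral {0..x} (\<lambda>t. (F t)\<^sup>2)" by simp
  also have "\<dots> \<le> M\<^sup>2 * integral {0..1} (\<lambda>t. (F t)\<^sup>2)"
    using x by (intro mult_left_mono integral_subset_le integrable_continuous_real continuous_intros F F') auto
  finally show ?thesis by simp
qed

text \<open>With \<open>F = f - P u\<close>, split \<open>u\<close> into the solution of \<open>-h'' = \<beta> h\<close> with the boundary values of \<open>u\<close>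
  and a remainder \<open>v\<close> vanishing at \<open>0\<close> and \<open>1\<close>, which is \<open>O(\<parallel>F\<parallel>)\<close>. The first part contributes
  boundary terms only.\<close>

lemma tail_cell:
  assumes u: "cell_ode u u1 (\<lambda>t. (P t - \<beta>) * u t - f t)"
    and P: "continuous_on {0..1} P" "\<And>t. t \<in> {0..1} \<Longrightarrow> \<bar>P t\<bar> \<le> \<epsilon>"
    and f: "continuous_on {0..1} f"
    and s: "\<And>t. (s has_real_derivative c t) (at t)" "s 0 = 0"
    and c: "\<And>t. (c has_real_derivative - \<beta> * s t) (at t)" "c 0 = 1"
    and S: "\<And>t. t \<in> {0..1} \<Longrightarrow> \<bar>s t\<bar> \<le> S" "\<And>t. t \<in> {0..1} \<Longrightarrow> \<bar>c t\<bar> \<le> S"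
    and m: "m > 0" "m \<le> \<bar>s 1\<bar>"
    and \<sigma>: "\<bar>\<sigma>\<bar> = 1"
    and K1: "K1 = 8 * S^4 * (S\<^sup>2 / m\<^sup>2 + 1)"
    and K2: "K2 = 3 * (4 * S^4 / m\<^sup>2 + S\<^sup>2 / m\<^sup>2 + K1)"
    and K3: "K3 = (1 + K1) / 2"
    and \<epsilon>: "\<epsilon> \<le> 1" "4 * K2 * \<epsilon> \<le> 1"
  shows "\<sigma> * integral {0..1} (\<lambda>t. f t * u t) \<ge>
    \<sigma> * ((u 0 * u1 0 - u 1 * u1 1) + (c 1 * ((u 0)\<^sup>2 + (u 1)\<^sup>2) - 2 * u 0 * u 1) / s 1)
     - (2 * K3 + (2 * K3 + 1) * (4 * K2)) * integral {0..1} (\<lambda>t. (f t)\<^sup>2)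
     - (2 * K3 + 1) * (2 * K2) * \<epsilon> * ((u 0)\<^sup>2 + (u 1)\<^sup>2)"
proof -
  define F where "F t = f t - P t * u t" for t
  have cu: "continuous_on {0..1} u" "continuous_on {0..1} u1" using u by (auto simp: cell_ode_def)
  have cs: "continuous_on A s" "continuous_on A c" for A
    using s(1) c(1) by (meson DERIV_isCont continuous_at_imp_continuous_on)+
  have cF: "continuous_on {0..1} F" unfolding F_def by (intro continuous_intros f P cu)
  have uF: "cell_ode u u1 (\<lambda>t. - \<beta> * u t - F t)"
    using u by (simp add: F_def algebra_simps)
  have S0: "S \<ge> 1" using S(2)[of 0] c(2) by simp
  have s1: "s 1 \<noteq> 0" using m by auto
  have \<epsilon>0: "0 \<le> \<epsilon>" using P(2)[of 0] by simp
  \<comment> \<open>Conservation of the Wronskian of \<open>c\<close> and \<open>s\<close>; it makes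
    the derivatives of the kernels below equal to -1 at their zeros.\<close>
  have wr: "(c t)\<^sup>2 + \<beta> * (s t)\<^sup>2 = 1" for t
  proof -
    have "((\<lambda>t. (c t)\<^sup>2 + \<beta> * (s t)\<^sup>2) has_real_derivative 0) (at t)" for t
      by (auto intro!: derivative_eq_intros s c)
    then have "(c t)\<^sup>2 + \<beta> * (s t)\<^sup>2 = (c 0)\<^sup>2 + \<beta> * (s 0)\<^sup>2"
      using DERIV_isconst_all[of "\<lambda>t. (c t)\<^sup>2 + \<beta> * (s t)\<^sup>2"] by blast
    then show ?thesis using s c by simp
  qed
  \<comment> \<open>The solution with value \<open>s 1\<close> at 0 and value 0 at 1, the mirror
    image of \<open>s\<close>. Testing with \<open>s\<close> and with \<psi> expresses
    \<open>u1 1\<close> and \<open>u1 0\<close> by the end values of \<open>u\<close> and integrals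
    of \<open>F\<close>.\<close>
  define \<psi> where "\<psi> t = s 1 * c t - c 1 * s t" for t
  define A where "A = integral {0..1} (\<lambda>t. F t * s t)"
  define B where "B = integral {0..1} (\<lambda>t. F t * \<psi> t)"
  define IF where "IF = integral {0..1} (\<lambda>t. (F t)\<^sup>2)"
  define If where "If = integral {0..1} (\<lambda>t. (f t)\<^sup>2)"
  define Iu where "Iu = integral {0..1} (\<lambda>t. (u t)\<^sup>2)"
  define X where "X = (u 0)\<^sup>2 + (u 1)\<^sup>2"
  have A: "A = u 1 * c 1 - u1 1 * s 1 - u 0"
    unfolding A_def using green_cell[OF uF s(1) c(1), of 1] s c by (auto dest: integral_unique)
  have c\<psi>: "continuous_on A \<psi>" for A
    unfolding \<psi>_def by (intro continuous_intros cs)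
  have B: "B = - u 1 + c 1 * u 0 + s 1 * u1 0"
  proof -
    have "((\<lambda>t. F t * \<psi> t) has_integral
       (u 1 * (- \<beta> * s 1 * s 1 - c 1 * c 1) - u1 1 * \<psi> 1 - u 0 * (- \<beta> * s 1 * s 0 - c 1 * c 0) + u1 0 * \<psi> 0)) {0..1}"
    proof (rule green_cell[OF uF])
      show "(\<psi> has_real_derivative - \<beta> * s 1 * s t - c 1 * c t) (at t)" for t
        unfolding \<psi>_def by (auto intro!: derivative_eq_intros s c)
      show "((\<lambda>t. - \<beta> * s 1 * s t - c 1 * c t) has_real_derivative - \<beta> * \<psi> t) (at t)" for t
        unfolding \<psi>_def by (auto intro!: derivative_eq_intros s c simp: algebra_simps)
    qed auto
    moreover have "- \<beta> * s 1 * s 1 - c 1 * c 1 = - 1"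
      using wr[of 1] by (simp add: power2_eq_square)
    ultimately show ?thesis
      unfolding B_def using s c by (auto dest!: integral_unique simp: \<psi>_def)
  qed
  define v where "v t = u t - (u 0 * \<psi> t + u 1 * s t) / s 1" for t
  have cv: "continuous_on {0..1} v"
    unfolding v_def using s1 by (intro continuous_intros cs c\<psi> cu) auto
  have ker: "\<bar>s x * c t - c x * s t\<bar> \<le> 2 * S\<^sup>2" if "x \<in> {0..1}" "t \<in> {0..1}" for x t
  proof -
    have "\<bar>s x * c t - c x * s t\<bar> \<le> \<bar>s x * c t\<bar> + \<bar>c x * s t\<bar>" by simp
    also have "\<dots> \<le> S * S + S * S"
      unfolding abs_mult using S that S0 by (intro add_mono mult_mono) auto
    finally show ?thesis by (simp add: power2_eq_square)
  qed
  have IF0: "IF \<ge> 0" "If \<ge> 0" "Iu \<ge> 0"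
    unfolding IF_def If_def Iu_def
    by (intro integral_nonneg integrable_continuous_real continuous_intros cF f cu, simp)+
  have B2: "B\<^sup>2 \<le> 4 * S^4 * IF"
  proof -
    have "B\<^sup>2 \<le> (2 * S\<^sup>2)\<^sup>2 * IF"
      unfolding B_def IF_def
      by (rule integral_mult_power2_le[OF cF c\<psi>]) (use ker[of 1] in \<open>auto simp: \<psi>_def\<close>)
    then show ?thesis by (simp add: power_mult_distrib)
  qed
  have v2: "(v x)\<^sup>2 \<le> K1 * IF" if x: "x \<in> {0..1}" for x
  proof -
    \<comment> \<open>Variation of constants: the kernel vanishes at \<open>t = x\<close>, so
      \<open>u1 x\<close> does not enter. Then \<open>v x = s x / s 1 * B - J\<close> is controlled
      by \<open>F\<close> alone, and the two squares give the two summands of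
      \<open>K1\<close>.\<close>
    define J where "J = integral {0..x} (\<lambda>t. F t * (s x * c t - c x * s t))"
    have "((\<lambda>t. F t * (s x * c t - c x * s t)) has_integral
       (u x * (- \<beta> * s x * s x - c x * c x) - u1 x * (s x * c x - c x * s x)
         - u 0 * (- \<beta> * s x * s 0 - c x * c 0) + u1 0 * (s x * c 0 - c x * s 0))) {0..x}"
    proof (rule green_cell[OF uF])
      show "((\<lambda>t. s x * c t - c x * s t) has_real_derivative - \<beta> * s x * s t - c x * c t) (at t)" for t
        by (auto intro!: derivative_eq_intros s c)
      show "((\<lambda>t. - \<beta> * s x * s t - c x * c t) has_real_derivative - \<beta> * (s x * c t - c x * s t)) (at t)" for t
        by (auto intro!: derivative_eq_intros s c simp: algebra_simps)
    qed (use x in auto)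
    moreover have "- \<beta> * s x * s x - c x * c x = - 1"
      using wr[of x] by (simp add: power2_eq_square)
    ultimately have J: "J = - u x + u 0 * c x + u1 0 * s x"
      unfolding J_def using s c by (auto dest!: integral_unique)
    have v: "v x = s x / s 1 * B - J"
      unfolding v_def \<psi>_def B J using s1 by (simp add: field_simps)
    have "(v x)\<^sup>2 \<le> 2 * (s x / s 1 * B)\<^sup>2 + 2 * J\<^sup>2"
      unfolding v using sum_squares_bound[of "s x / s 1 * B" "- J"] by (simp add: power2_diff)
    also have "(s x / s 1 * B)\<^sup>2 \<le> (S\<^sup>2 / m\<^sup>2) * (4 * S^4 * IF)"
    proof -
      have "(s x / s 1)\<^sup>2 \<le> S\<^sup>2 / m\<^sup>2"
        unfolding power_divide
        using S(1)[OF x] m S0 by (intro frac_le) (auto simp flip: abs_le_square_iff)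
      then show ?thesis
        unfolding power_mult_distrib using B2 by (intro mult_mono) auto
    qed
    also have "J\<^sup>2 \<le> 4 * S^4 * IF"
    proof -
      have "J\<^sup>2 \<le> (2 * S\<^sup>2)\<^sup>2 * IF"
        unfolding J_def IF_def
        by (rule integral_mult_power2_le[OF cF]) (use x ker[of x] in \<open>auto intro!: continuous_intros cs\<close>)
      then show ?thesis by (simp add: power_mult_distrib)
    qed
    finally show ?thesis by (simp add: K1 algebra_simps)
  qed
  have K: "K1 \<ge> 0" "K2 \<ge> 0" "K3 \<ge> 0" by (simp_all add: K1 K2 K3)
  have Iu1: "Iu \<le> K2 * (X + IF)"
  proof -
    have "Iu \<le> integral {0..1} (\<lambda>t::real. K2 * (X + IF))"
      unfolding Iu_def
    proof (rule integral_mono_continuous)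
      fix t :: real assume t: "t \<in> {0..1}"
      \<comment> \<open>Squaring a sum of three terms costs the factor 3 in
        \<open>K2\<close>.\<close>
      define p where "p = u 0 * \<psi> t / s 1"
      define q where "q = u 1 * s t / s 1"
      have "u t = p + q + v t" by (simp add: p_def q_def v_def add_divide_distrib)
      then have "(u t)\<^sup>2 = (p + q + v t)\<^sup>2" by simp
      also have "\<dots> \<le> 3 * (p\<^sup>2 + q\<^sup>2 + (v t)\<^sup>2)"
        using sum_squares_bound[of p q] sum_squares_bound[of p "v t"] sum_squares_bound[of q "v t"]
        by (simp add: power2_eq_square algebra_simps)
      also have "p\<^sup>2 \<le> X * (4 * S^4 / m\<^sup>2)"
      proof -
        have "(\<psi> t)\<^sup>2 \<le> (2 * S\<^sup>2)\<^sup>2"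
          using ker[of 1 t] t S0 unfolding \<psi>_def by (subst abs_le_square_iff[symmetric]) auto
        moreover have "m\<^sup>2 \<le> (s 1)\<^sup>2" using m by (subst abs_le_square_iff[symmetric]) auto
        ultimately have "(\<psi> t / s 1)\<^sup>2 \<le> 4 * S^4 / m\<^sup>2"
          unfolding power_divide using m S0 by (intro frac_le) (auto simp: power_mult_distrib)
        then show ?thesis
          unfolding p_def times_divide_eq_right[symmetric] power_mult_distrib X_def
          by (intro mult_mono) auto
      qed
      also have "q\<^sup>2 \<le> X * (S\<^sup>2 / m\<^sup>2)"
      proof -
        have "(s t)\<^sup>2 \<le> S\<^sup>2" using S(1)[OF t] S0 by (subst abs_le_square_iff[symmetric]) auto
        moreover have "m\<^sup>2 \<le> (s 1)\<^sup>2" using m by (subst abs_le_square_iff[symmetric]) auto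
        ultimately have "(s t / s 1)\<^sup>2 \<le> S\<^sup>2 / m\<^sup>2"
          unfolding power_divide using m S0 by (intro frac_le) auto
        then show ?thesis
          unfolding q_def times_divide_eq_right[symmetric] power_mult_distrib X_def
          by (intro mult_mono) auto
      qed
      also note v2[OF t]
      also have "3 * (X * (4 * S ^ 4 / m\<^sup>2) + X * (S\<^sup>2 / m\<^sup>2) + K1 * IF) \<le> K2 * (X + IF)"
      proof -
        have "0 \<le> K1 * X" "0 \<le> (4 * S ^ 4 / m\<^sup>2 + S\<^sup>2 / m\<^sup>2) * IF"
          using IF0 K by (auto simp: X_def)
        moreover have "3 * (X * \<alpha> + X * \<gamma> + K1 * IF) \<le> 3 * (\<alpha> + \<gamma> + K1) * (X + IF)"
          if "0 \<le> K1 * X" "0 \<le> (\<alpha> + \<gamma>) * IF" for \<alpha> \<gamma>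
          using that by (simp add: algebra_simps)
        ultimately show ?thesis unfolding K2 by blast
      qed
      finally show "(u t)\<^sup>2 \<le> K2 * (X + IF)" by simp
    qed (intro continuous_intros cu)+
    then show ?thesis by simp
  qed
  have IF1: "IF \<le> 2 * If + 2 * \<epsilon> * Iu"
  proof -
    have "IF \<le> integral {0..1} (\<lambda>t. 2 * (f t)\<^sup>2 + (2 * \<epsilon>) * (u t)\<^sup>2)"
      unfolding IF_def
    proof (rule integral_mono_continuous)
      fix t :: real assume t: "t \<in> {0..1}"
      have "(F t)\<^sup>2 \<le> 2 * (f t)\<^sup>2 + 2 * (P t * u t)\<^sup>2"
        unfolding F_def using sum_squares_bound[of "f t" "- (P t * u t)"] by (simp add: power2_diff)
      also have "(P t * u t)\<^sup>2 \<le> \<epsilon> * (u t)\<^sup>2"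
        unfolding power_mult_distrib
      proof (rule mult_right_mono)
        have "(P t)\<^sup>2 \<le> \<epsilon>\<^sup>2" using P(2)[OF t] \<epsilon>0 by (subst abs_le_square_iff[symmetric]) auto
        also have "\<dots> \<le> \<epsilon>" using \<epsilon>0 \<epsilon> by (simp add: power2_eq_square mult_left_le)
        finally show "(P t)\<^sup>2 \<le> \<epsilon>" .
      qed auto
      finally show "(F t)\<^sup>2 \<le> 2 * (f t)\<^sup>2 + 2 * \<epsilon> * (u t)\<^sup>2" by simp
    qed (intro continuous_intros f cu cF)+
    also have "\<dots> = 2 * If + (2 * \<epsilon>) * Iu"
      unfolding If_def Iu_def
      by (subst integral_add) (auto intro!: integrable_continuous_real continuous_intros f cu)
    finally show ?thesis by simp
  qed
  \<comment> \<open>The bounds for \<open>Iu\<close> and \<open>IF\<close> refer to each other;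
    \<open>4 * K2 * \<epsilon> \<le> 1\<close> makes the feedback at most \<open>Iu / 2\<close>,
    which is absorbed.\<close>
  have Iu2: "Iu \<le> 2 * K2 * X + 4 * K2 * If"
  proof -
    have "K2 * IF \<le> K2 * (2 * If + 2 * \<epsilon> * Iu)" using IF1 K by (intro mult_left_mono) auto
    moreover have "(4 * K2 * \<epsilon>) * Iu \<le> 1 * Iu" using \<epsilon> IF0 by (intro mult_right_mono) auto
    ultimately show ?thesis using Iu1 by (simp add: algebra_simps)
  qed
  have IFu: "integral {0..1} (\<lambda>t. F t * u t) = (u 0 * B + u 1 * A) / s 1 + integral {0..1} (\<lambda>t. F t * v t)"
  proof -
    have "integral {0..1} (\<lambda>t. F t * u t) =
       integral {0..1} (\<lambda>t. (u 0 / s 1) * (F t * \<psi> t) + (u 1 / s 1) * (F t * s t) + F t * v t)"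
      using s1 by (intro integral_cong) (simp add: v_def field_simps)
    also have "\<dots> = (u 0 / s 1) * B + (u 1 / s 1) * A + integral {0..1} (\<lambda>t. F t * v t)"
      unfolding A_def B_def
      by (subst integral_add integral_add; (subst integral_add)?;
          (auto intro!: integrable_continuous_real continuous_intros cF c\<psi> cs cv simp: s1)?)
    finally show ?thesis by (simp add: add_divide_distrib)
  qed
  have Fv: "\<bar>integral {0..1} (\<lambda>t. F t * v t)\<bar> \<le> K3 * IF"
  proof -
    have "norm (integral {0..1} (\<lambda>t. F t * v t)) \<le> integral {0..1} (\<lambda>t. (1/2) * (F t)\<^sup>2 + (1/2) * K1 * IF)"
    proof (rule integral_norm_bound_integral)
      fix t :: real assume t: "t \<in> {0..1}"
      have "2 * \<bar>F t\<bar> * \<bar>v t\<bar> \<le> (F t)\<^sup>2 + (v t)\<^sup>2" using sum_squares_bound[of "\<bar>F t\<bar>" "\<bar>v t\<bar>"] by simp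
      then show "norm (F t * v t) \<le> (1/2) * (F t)\<^sup>2 + (1/2) * K1 * IF"
        using v2[OF t] by (simp add: abs_mult)
    qed (intro integrable_continuous_real continuous_intros cF cv)+
    also have "\<dots> = (1/2) * IF + (1/2) * K1 * IF"
      unfolding IF_def
      by (subst integral_add) (auto intro!: integrable_continuous_real continuous_intros cF)
    finally show ?thesis by (simp add: K3 algebra_simps add_divide_distrib)
  qed
  have Pu: "\<bar>integral {0..1} (\<lambda>t. P t * (u t)\<^sup>2)\<bar> \<le> \<epsilon> * Iu"
  proof -
    have "norm (integral {0..1} (\<lambda>t. P t * (u t)\<^sup>2)) \<le> integral {0..1} (\<lambda>t. \<epsilon> * (u t)\<^sup>2)"
      using P by (intro integral_norm_bound_integral integrable_continuous_real continuous_intros cu)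
        (auto simp: abs_mult intro!: mult_right_mono)
    then show ?thesis by (simp add: Iu_def)
  qed
  have fu: "integral {0..1} (\<lambda>t. f t * u t) = integral {0..1} (\<lambda>t. F t * u t) + integral {0..1} (\<lambda>t. P t * (u t)\<^sup>2)"
    by (subst integral_add[symmetric])
       (auto intro!: integrable_continuous_real continuous_intros cF cu P f integral_cong
         simp: F_def power2_eq_square algebra_simps)
  \<comment> \<open>\<open>A\<close> and \<open>B\<close> trade integrals for boundary data. The
    part in \<open>u u1\<close> will telescope across the vertices; the rest, divided by
    \<open>s 1\<close>, is the quadratic form in the two end values that decides the sign.\<close>
  have main: "u 0 * B + u 1 * A = s 1 * (u 0 * u1 0 - u 1 * u1 1) + (c 1 * X - 2 * u 0 * u 1)"
    unfolding A B X_def by (simp add: power2_eq_square algebra_simps)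
  have main': "(u 0 * B + u 1 * A) / s 1 = (u 0 * u1 0 - u 1 * u1 1) + (c 1 * X - 2 * u 0 * u 1) / s 1"
    unfolding main using s1 by (simp add: add_divide_distrib)
  define r where "r = integral {0..1} (\<lambda>t. F t * v t) + integral {0..1} (\<lambda>t. P t * (u t)\<^sup>2)"
  have "\<bar>r\<bar> \<le> K3 * IF + \<epsilon> * Iu" unfolding r_def using Fv Pu by linarith
  also have "K3 * IF \<le> K3 * (2 * If + 2 * \<epsilon> * Iu)" using IF1 K by (intro mult_left_mono) auto
  finally have "\<bar>r\<bar> \<le> 2 * K3 * If + (2 * K3 + 1) * \<epsilon> * Iu" by (simp add: algebra_simps)
  also have "(2 * K3 + 1) * \<epsilon> * Iu \<le> (2 * K3 + 1) * \<epsilon> * (2 * K2 * X + 4 * K2 * If)"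
    using Iu2 K \<epsilon>0 by (intro mult_left_mono) auto
  also have "\<dots> = (2 * K3 + 1) * (2 * K2) * \<epsilon> * X + (2 * K3 + 1) * (4 * K2) * If * \<epsilon>"
    by (simp add: algebra_simps)
  also have "(2 * K3 + 1) * (4 * K2) * If * \<epsilon> \<le> (2 * K3 + 1) * (4 * K2) * If * 1"
    using \<epsilon> K IF0 by (intro mult_left_mono) auto
  finally have r: "\<bar>r\<bar> \<le> 2 * K3 * If + ((2 * K3 + 1) * (2 * K2) * \<epsilon> * X + (2 * K3 + 1) * (4 * K2) * If)"
    by simp
  have "\<bar>\<sigma> * r\<bar> = \<bar>r\<bar>" using \<sigma> by (simp add: abs_mult)
  moreover have "\<sigma> * integral {0..1} (\<lambda>t. f t * u t) =
     \<sigma> * ((u 0 * u1 0 - u 1 * u1 1) + (c 1 * X - 2 * u 0 * u 1) / s 1) + \<sigma> * r"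
    unfolding fu IFu main' r_def by (simp add: algebra_simps)
  ultimately show ?thesis
    using r unfolding X_def[symmetric] If_def[symmetric] by (simp add: algebra_simps)
qed

section \<open>The tail\<close>

text \<open>The quadratic form of the cell boundary values is, up to a telescoping term, a square because
  \<open>\<bar>R cos \<omega>\<bar> \<ge> 1\<close> in the closed gaps.\<close>

lemma tail_form:
  fixes a e b :: real
  assumes b: "b > 0" and x: "x = \<bar>a\<bar>" and e: "y = sqrt b * \<bar>e\<bar>"
    and R: "R = (sqrt b + 1 / sqrt b) / 2" "1 \<le> R * \<bar>c\<bar>"
    and s: "s \<noteq> 0" and \<sigma>: "\<sigma> = sgn (s * c)"
  shows "\<sigma> * ((c * (a\<^sup>2 + e\<^sup>2) - 2 * a * e) / s) \<ge>
    1 / (sqrt b * \<bar>s\<bar>) * ((y - x)\<^sup>2 + (b - 1) / (b + 1) * (x\<^sup>2 - y\<^sup>2))"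
proof -
  define r where "r = sqrt b"
  have r: "r > 0" "b = r\<^sup>2" using b by (simp_all add: r_def)
  have e': "\<bar>e\<bar> = y / r" using e r(1) unfolding r_def by (simp add: field_simps)
  have R0: "R = (r\<^sup>2 + 1) / (2 * r)" using r(1) by (simp add: R r_def[symmetric] field_simps power2_eq_square)
  have Rp: "R > 0" using r by (simp add: R0 add_pos_pos)
  \<comment> \<open>The right-hand side is \<open>1 / R\<close>: the gap condition enters here, and
    equality corresponds to a band edge.\<close>
  have c: "\<bar>c\<bar> \<ge> 2 * r / (r\<^sup>2 + 1)"
    using R(2) Rp r by (simp add: R0 field_simps)
  have c0: "c \<noteq> 0" using R(2) by auto
  \<comment> \<open>\<sigma> makes the diagonal coefficient positive; the sign of the mixed term is
    then given away by passing to absolute values.\<close>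
  have sg: "\<bar>\<sigma>\<bar> = 1" "\<sigma> * c / s = \<bar>c\<bar> / \<bar>s\<bar>"
    using s c0 by (auto simp: \<sigma> sgn_if abs_if zero_less_mult_iff mult_less_0_iff)
  have "\<sigma> * ((c * (a\<^sup>2 + e\<^sup>2) - 2 * a * e) / s) = (\<sigma> * c / s) * (a\<^sup>2 + e\<^sup>2) - \<sigma> / s * (2 * a * e)"
    by (simp add: diff_divide_distrib add_divide_distrib algebra_simps)
  also have "\<dots> \<ge> \<bar>c\<bar> / \<bar>s\<bar> * (a\<^sup>2 + e\<^sup>2) - 2 * \<bar>a\<bar> * \<bar>e\<bar> / \<bar>s\<bar>"
  proof -
    have "\<bar>\<sigma> / s * (2 * a * e)\<bar> = 2 * \<bar>a\<bar> * \<bar>e\<bar> / \<bar>s\<bar>" using sg by (simp add: abs_mult)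
    then show ?thesis unfolding sg(2) by linarith
  qed
  also have "\<bar>c\<bar> / \<bar>s\<bar> * (a\<^sup>2 + e\<^sup>2) - 2 * \<bar>a\<bar> * \<bar>e\<bar> / \<bar>s\<bar> \<ge>
      (2 * r / (r\<^sup>2 + 1)) / \<bar>s\<bar> * (a\<^sup>2 + e\<^sup>2) - 2 * \<bar>a\<bar> * \<bar>e\<bar> / \<bar>s\<bar>"
    using c by (intro diff_right_mono mult_right_mono divide_right_mono) auto
  also have "(2 * r / (r\<^sup>2 + 1)) / \<bar>s\<bar> * (a\<^sup>2 + e\<^sup>2) - 2 * \<bar>a\<bar> * \<bar>e\<bar> / \<bar>s\<bar> =
    1 / (r * \<bar>s\<bar>) * (2 * r\<^sup>2 / (r\<^sup>2 + 1) * (x\<^sup>2 + y\<^sup>2 / r\<^sup>2) - 2 * x * y)"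
  proof -
    have "a\<^sup>2 = x\<^sup>2" "e\<^sup>2 = y\<^sup>2 / r\<^sup>2"
      using x e' by (simp_all flip: power2_abs[of e] add: power_divide)
    moreover have "r\<^sup>2 + 1 \<noteq> 0" using r by (metis add_pos_pos less_numeral_extra(1,3) zero_less_power)
    ultimately show ?thesis using r s unfolding e' x[symmetric]
      by (simp add: divide_simps) (simp add: power2_eq_square algebra_simps)
  qed
  \<comment> \<open>The coefficients of \<open>x^2\<close> and \<open>y^2\<close> are
    \<open>2 b / (b + 1)\<close> and \<open>2 / (b + 1)\<close>, that is, 1 plus and minus
    \<open>(b - 1) / (b + 1)\<close>. Since \<open>y\<close> is the modulus just behind the vertex,
    the asymmetric part telescopes along the half-line.\<close>
  also have "2 * r\<^sup>2 / (r\<^sup>2 + 1) * (x\<^sup>2 + y\<^sup>2 / r\<^sup>2) - 2 * x * y = (y - x)\<^sup>2 + (b - 1) / (b + 1) * (x\<^sup>2 - y\<^sup>2)"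
  proof -
    have "r\<^sup>2 + 1 \<noteq> 0" using r by (metis add_pos_pos less_numeral_extra(1,3) zero_less_power)
    then show ?thesis using r
      by (simp add: divide_simps) (simp add: power2_eq_square algebra_simps)
  qed
  finally show ?thesis unfolding r_def .
qed

text \<open>Functions on the half-line are given cell by cell: \<open>u n t\<close> stands for \<open>u(n + t)\<close>. Here
  \<open>f = -u'' + P u - \<beta> u\<close>, and the last two terms are boundary terms of the truncation at \<open>N\<close>.\<close>

definition tail_coercive :: "nat \<Rightarrow> real \<Rightarrow> real \<Rightarrow> real \<Rightarrow> real \<Rightarrow> real \<Rightarrow> real \<Rightarrow> bool"
  where "tail_coercive b \<rho> \<epsilon> K m \<sigma> \<beta> \<longleftrightarrow> (\<forall>P u u1 f N.
     (\<forall>n. cell_ode (u n) (u1 n) (\<lambda>t. (P n t - \<beta>) * u n t - f n t)) \<longrightarrow>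
     (\<forall>n. continuous_on {0..1} (P n)) \<longrightarrow> (\<forall>n. \<forall>t\<in>{0..1}. \<bar>P n t\<bar> \<le> \<epsilon> * \<rho> ^ n) \<longrightarrow>
     (\<forall>n. continuous_on {0..1} (f n)) \<longrightarrow> u (0::nat) 0 = 0 \<longrightarrow>
     (\<forall>n. u (Suc n) 0 = sqrt (real b) * u n 1 \<and> u1 (Suc n) 0 = u1 n 1 / sqrt (real b)) \<longrightarrow>
     \<sigma> * (\<Sum>n<N. integral {0..1} (\<lambda>t. f n t * u n t)) \<ge>
       - K * (\<Sum>n<N. integral {0..1} (\<lambda>t. (f n t)\<^sup>2)) - \<bar>u N 0 * u1 N 0\<bar> - (u N 0)\<^sup>2 / m)"

text \<open>The boundary terms of the cells telescope up to a Dirichlet form of \<open>\<bar>u(n)\<bar>\<close>, which absorbs the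
  contribution of \<open>P\<close> by a discrete Hardy inequality.\<close>

lemma tail_estimate:
  fixes b :: nat and \<rho> m S :: real
  assumes b: "b \<ge> 1" and \<rho>: "0 < \<rho>" "\<rho> < 1" and m: "m > 0" and S: "S \<ge> 1"
  obtains \<epsilon> K where "0 < \<epsilon>" "0 < K"
   "\<And>\<beta> s c. (\<And>t. (s has_real_derivative c t) (at t)) \<Longrightarrow> s 0 = 0 \<Longrightarrow>
     (\<And>t. (c has_real_derivative - \<beta> * s t) (at t)) \<Longrightarrow> c 0 = 1 \<Longrightarrow>
     (\<And>t. t \<in> {0..1} \<Longrightarrow> \<bar>s t\<bar> \<le> S) \<Longrightarrow> (\<And>t. t \<in> {0..1} \<Longrightarrow> \<bar>c t\<bar> \<le> S) \<Longrightarrow>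
     m \<le> \<bar>s 1\<bar> \<Longrightarrow> 1 \<le> tree_R b * \<bar>c 1\<bar> \<Longrightarrow> tail_coercive b \<rho> \<epsilon> K m (sgn (s 1 * c 1)) \<beta>"
proof -
  define K1 where "K1 = 8 * S^4 * (S\<^sup>2 / m\<^sup>2 + 1)"
  define K2 where "K2 = 3 * (4 * S^4 / m\<^sup>2 + S\<^sup>2 / m\<^sup>2 + K1)"
  define K3 where "K3 = (1 + K1) / 2"
  define K4 where "K4 = 2 * K3 + (2 * K3 + 1) * (4 * K2)"
  define K5 where "K5 = (2 * K3 + 1) * (2 * K2)"
  define \<kappa> where "\<kappa> = 1 / (sqrt b * S)"
  define H where "H = (\<Sum>n. \<rho> ^ n * (2 * real n + 1))"
  have K: "K1 \<ge> 0" "K2 \<ge> 0" "K3 > 0" "K4 > 0" "K5 \<ge> 0"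
  proof -
    show K1: "K1 \<ge> 0" by (simp add: K1_def)
    show K2: "K2 \<ge> 0" using K1 by (simp add: K2_def)
    show K3: "K3 > 0" using K1 by (simp add: K3_def)
    show "K4 > 0" unfolding K4_def using K2 K3 by (intro add_pos_nonneg mult_nonneg_nonneg) auto
    show "K5 \<ge> 0" unfolding K5_def using K2 K3 by (intro mult_nonneg_nonneg) auto
  qed
  have \<kappa>: "\<kappa> > 0" using b S by (simp add: \<kappa>_def)
  have sumH: "summable (\<lambda>n. \<rho> ^ n * (2 * real n + 1))"
  proof -
    \<comment> \<open>The differentiated geometric series has coefficients \<open>n + 1\<close>, and
      \<open>2 n + 1 = 2 (n + 1) - 1\<close>.\<close>
    have "summable (\<lambda>n. diffs (\<lambda>_. 1) n * \<rho> ^ n)"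
      by (rule termdiff_converges[where K = 1]) (use \<rho> in \<open>auto intro: summable_geometric\<close>)
    moreover have "summable (\<lambda>n. \<rho> ^ n)" using \<rho> by (intro summable_geometric) auto
    ultimately have "summable (\<lambda>n. 2 * (diffs (\<lambda>_. 1) n * \<rho> ^ n) - \<rho> ^ n)"
      by (intro summable_diff summable_mult)
    then show ?thesis by (simp add: diffs_def algebra_simps)
  qed
  have H: "H \<ge> 0" unfolding H_def using \<rho> by (intro suminf_nonneg sumH) auto
  \<comment> \<open>The first two bounds are the demands of \<open>tail_cell\<close>. The third lets
    the Dirichlet form, whose coefficient is at least \<kappa>, absorb the potential;
    \<open>H\<close> sums the Hardy weights against the decay \<open>\<rho> ^ n\<close>.\<close>
  define \<epsilon> where "\<epsilon> = min 1 (min (1 / (4 * K2 + 1)) (\<kappa> / (K5 * H + 1)))"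
  have pos: "4 * K2 + 1 > 0" "K5 * H + 1 > 0"
    using K H by (auto intro!: add_nonneg_pos)
  have \<epsilon>: "\<epsilon> > 0" "\<epsilon> \<le> 1" using pos \<kappa> by (auto simp: \<epsilon>_def)
  have \<epsilon>2: "4 * K2 * \<epsilon> \<le> 1"
  proof -
    have "\<epsilon> \<le> 1 / (4 * K2 + 1)" by (simp add: \<epsilon>_def)
    then have "\<epsilon> * (4 * K2 + 1) \<le> 1" using pos by (simp add: field_simps)
    then show ?thesis using \<epsilon> by (simp add: algebra_simps)
  qed
  have \<epsilon>3: "K5 * H * \<epsilon> \<le> \<kappa>"
  proof -
    have "\<epsilon> \<le> \<kappa> / (K5 * H + 1)" by (simp add: \<epsilon>_def)
    then have "\<epsilon> * (K5 * H + 1) \<le> \<kappa>" using pos by (simp add: field_simps)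
    then show ?thesis using \<epsilon> by (simp add: algebra_simps)
  qed
  show thesis
  proof (rule that[OF \<epsilon>(1) \<open>K4 > 0\<close>], unfold tail_coercive_def, intro allI impI)
    fix \<beta> :: real and s c :: "real \<Rightarrow> real" and P u u1 f :: "nat \<Rightarrow> real \<Rightarrow> real" and N :: nat
    assume s: "\<And>t. (s has_real_derivative c t) (at t)" "s 0 = 0"
      and c: "\<And>t. (c has_real_derivative - \<beta> * s t) (at t)" "c 0 = 1"
      and bs: "\<And>t. t \<in> {0..1} \<Longrightarrow> \<bar>s t\<bar> \<le> S" "\<And>t. t \<in> {0..1} \<Longrightarrow> \<bar>c t\<bar> \<le> S"
      and s1: "m \<le> \<bar>s 1\<bar>" and c1: "1 \<le> tree_R b * \<bar>c 1\<bar>"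
      and "\<forall>n. cell_ode (u n) (u1 n) (\<lambda>t. (P n t - \<beta>) * u n t - f n t)"
      and "\<forall>n. continuous_on {0..1} (P n)" "\<forall>n. \<forall>t\<in>{0..1}. \<bar>P n t\<bar> \<le> \<epsilon> * \<rho> ^ n"
      and "\<forall>n. continuous_on {0..1} (f n)" and u0: "u 0 0 = 0"
      and "\<forall>n. u (Suc n) 0 = sqrt (real b) * u n 1 \<and> u1 (Suc n) 0 = u1 n 1 / sqrt (real b)"
    then have u: "\<And>n. cell_ode (u n) (u1 n) (\<lambda>t. (P n t - \<beta>) * u n t - f n t)"
      and P: "\<And>n. continuous_on {0..1} (P n)" "\<And>n t. t \<in> {0..1} \<Longrightarrow> \<bar>P n t\<bar> \<le> \<epsilon> * \<rho> ^ n"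
      and f: "\<And>n. continuous_on {0..1} (f n)"
      and ju: "\<And>n. u (Suc n) 0 = sqrt (real b) * u n 1"
      and ju1: "\<And>n. u1 (Suc n) 0 = u1 n 1 / sqrt (real b)"
      by blast+
    define \<sigma> where "\<sigma> = sgn (s 1 * c 1)"
    have sb: "sqrt b > 0" using b by simp
    have s10: "s 1 \<noteq> 0" "c 1 \<noteq> 0" using s1 m c1 by auto
    have \<sigma>1: "\<bar>\<sigma>\<bar> = 1" using s10 by (simp add: \<sigma>_def sgn_if)
    define x where "x n = \<bar>u n 0\<bar>" for n
    define \<Delta> where "\<Delta> n = x (Suc n) - x n" for n
    define D where "D = (\<Sum>n<N. (\<Delta> n)\<^sup>2)"
    define \<kappa>' where "\<kappa>' = 1 / (sqrt b * \<bar>s 1\<bar>)"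
    define g where "g n = u n 0 * u1 n 0" for n
    define \<theta> where "\<theta> = (real b - 1) / (real b + 1)"
    define If where "If n = integral {0..1} (\<lambda>t. (f n t)\<^sup>2)" for n
    have \<kappa>': "\<kappa> \<le> \<kappa>'" "0 \<le> \<kappa>'" "\<kappa>' \<le> 1 / m"
    proof -
      show "\<kappa> \<le> \<kappa>'" unfolding \<kappa>_def \<kappa>'_def
        using bs(1)[of 1] sb s10 by (intro divide_left_mono mult_left_mono mult_pos_pos) auto
      show "0 \<le> \<kappa>'" unfolding \<kappa>'_def by simp
      have "1 * m \<le> sqrt b * \<bar>s 1\<bar>" using b s1 m by (intro mult_mono) auto
      then show "\<kappa>' \<le> 1 / m" unfolding \<kappa>'_def using m by (intro divide_left_mono) auto
    qed
    have D0: "D \<ge> 0" by (simp add: D_def sum_nonneg)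
    \<comment> \<open>\<open>x 0 = 0\<close> makes \<open>x n\<close> a sum of \<open>n\<close>
      increments; by Cauchy-Schwarz its square grows at most linearly, which the decay of the
      potential beats.\<close>
    have hardy: "(x n)\<^sup>2 \<le> real n * D" if "n \<le> N" for n
    proof -
      have "x n = (\<Sum>j<n. \<Delta> j)"
        unfolding \<Delta>_def by (subst sum_lessThan_telescope) (simp add: x_def u0)
      then have "(x n)\<^sup>2 \<le> (\<Sum>j<n. (\<Delta> j)\<^sup>2) * real n"
        using sum_squared_le_sum_of_squares[of \<Delta> "{..<n}"] by simp
      also have "(\<Sum>j<n. (\<Delta> j)\<^sup>2) \<le> D"
        unfolding D_def using that by (intro sum_mono2) auto
      finally show ?thesis by (simp add: mult_right_mono mult.commute[of _ D])
    qed
    have e1: "\<bar>u n 1\<bar> \<le> x (Suc n)" for n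
    proof -
      have "1 * \<bar>u n 1\<bar> \<le> sqrt b * \<bar>u n 1\<bar>" using b by (intro mult_right_mono) auto
      then show ?thesis using ju[of n] sb by (simp add: x_def abs_mult)
    qed
    have cell: "\<sigma> * integral {0..1} (\<lambda>t. f n t * u n t) \<ge>
        \<sigma> * (g n - g (Suc n)) + \<kappa>' * ((\<Delta> n)\<^sup>2 + \<theta> * ((x n)\<^sup>2 - (x (Suc n))\<^sup>2))
        - K4 * If n - K5 * \<epsilon> * (D * (\<rho> ^ n * (2 * real n + 1)))" if n: "n < N" for n
    proof -
      have \<rho>n: "0 \<le> \<rho> ^ n" "\<rho> ^ n \<le> 1" using \<rho> by (auto simp: power_le_one)
      have en: "\<epsilon> * \<rho> ^ n \<le> \<epsilon>" using \<epsilon> \<rho>n by (simp add: mult_left_le)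
      have "\<sigma> * integral {0..1} (\<lambda>t. f n t * u n t) \<ge>
        \<sigma> * ((u n 0 * u1 n 0 - u n 1 * u1 n 1) + (c 1 * ((u n 0)\<^sup>2 + (u n 1)\<^sup>2) - 2 * u n 0 * u n 1) / s 1)
        - K4 * If n - K5 * (\<epsilon> * \<rho> ^ n) * ((u n 0)\<^sup>2 + (u n 1)\<^sup>2)"
        unfolding K4_def K5_def If_def
      proof (rule tail_cell[OF u P f s c bs m s1 \<sigma>1 K1_def K2_def K3_def])
        show "\<epsilon> * \<rho> ^ n \<le> 1" using en \<epsilon> by linarith
        have "4 * K2 * (\<epsilon> * \<rho> ^ n) \<le> 4 * K2 * \<epsilon>" using en K by (intro mult_left_mono) auto
        then show "4 * K2 * (\<epsilon> * \<rho> ^ n) \<le> 1" using \<epsilon>2 by linarith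
      qed
      \<comment> \<open>The factors \<open>sqrt b\<close> and \<open>1 / sqrt b\<close> cancel, so
        \<open>u u1\<close> is continuous across a vertex.\<close>
      moreover have "\<sigma> * (u n 0 * u1 n 0 - u n 1 * u1 n 1) = \<sigma> * (g n - g (Suc n))"
        using sb by (simp add: g_def ju ju1)
      moreover have "\<sigma> * ((c 1 * ((u n 0)\<^sup>2 + (u n 1)\<^sup>2) - 2 * u n 0 * u n 1) / s 1) \<ge>
         \<kappa>' * ((\<Delta> n)\<^sup>2 + \<theta> * ((x n)\<^sup>2 - (x (Suc n))\<^sup>2))"
        unfolding \<kappa>'_def \<Delta>_def \<theta>_def
        by (rule tail_form[OF _ _ _ _ c1 s10(1) \<sigma>_def]) (use b in \<open>auto simp: x_def ju abs_mult tree_R_def\<close>)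
      moreover have "K5 * (\<epsilon> * \<rho> ^ n) * ((u n 0)\<^sup>2 + (u n 1)\<^sup>2) \<le> K5 * (\<epsilon> * \<rho> ^ n) * (D * (2 * real n + 1))"
      proof (intro mult_left_mono)
        have "(u n 1)\<^sup>2 \<le> (x (Suc n))\<^sup>2" using e1[of n] by (subst abs_le_square_iff[symmetric]) (simp add: x_def)
        also have "\<dots> \<le> real (Suc n) * D" using hardy[of "Suc n"] n by simp
        moreover have "(u n 0)\<^sup>2 \<le> real n * D" using hardy[of n] n by (simp add: x_def)
        ultimately show "(u n 0)\<^sup>2 + (u n 1)\<^sup>2 \<le> D * (2 * real n + 1)" by (simp add: algebra_simps)
      qed (use K \<epsilon> \<rho>n in auto)
      moreover have "K5 * (\<epsilon> * \<rho> ^ n) * (D * (2 * real n + 1)) = K5 * \<epsilon> * (D * (\<rho> ^ n * (2 * real n + 1)))"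
        by (simp only: ac_simps)
      ultimately show ?thesis
        unfolding distrib_left[of \<sigma>] by linarith
    qed
    have "(\<Sum>n<N. \<sigma> * integral {0..1} (\<lambda>t. f n t * u n t)) \<ge>
        (\<Sum>n<N. \<sigma> * (g n - g (Suc n)) + \<kappa>' * ((\<Delta> n)\<^sup>2 + \<theta> * ((x n)\<^sup>2 - (x (Suc n))\<^sup>2))
        - K4 * If n - K5 * \<epsilon> * (D * (\<rho> ^ n * (2 * real n + 1))))"
      by (intro sum_mono cell) auto
    also have "(\<Sum>n<N. \<sigma> * (g n - g (Suc n)) + \<kappa>' * ((\<Delta> n)\<^sup>2 + \<theta> * ((x n)\<^sup>2 - (x (Suc n))\<^sup>2))
        - K4 * If n - K5 * \<epsilon> * (D * (\<rho> ^ n * (2 * real n + 1)))) =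
       \<sigma> * (g 0 - g N) + \<kappa>' * (D + \<theta> * ((x 0)\<^sup>2 - (x N)\<^sup>2)) - K4 * (\<Sum>n<N. If n)
        - K5 * \<epsilon> * (D * (\<Sum>n<N. \<rho> ^ n * (2 * real n + 1)))"
      using sum_lessThan_telescope'[of g N] sum_lessThan_telescope'[of "\<lambda>n. (x n)\<^sup>2" N]
      by (simp add: D_def sum.distrib sum_subtractf flip: sum_distrib_left)
    also have "g 0 = 0" by (simp add: g_def u0)
    also have "x 0 = 0" by (simp add: x_def u0)
    finally have *: "\<sigma> * (\<Sum>n<N. integral {0..1} (\<lambda>t. f n t * u n t)) \<ge>
       - (\<sigma> * g N) + \<kappa>' * D - \<kappa>' * \<theta> * (x N)\<^sup>2 - K4 * (\<Sum>n<N. If n)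
        - K5 * \<epsilon> * (D * (\<Sum>n<N. \<rho> ^ n * (2 * real n + 1)))"
      by (simp add: sum_distrib_left algebra_simps)
    have "(\<Sum>n<N. \<rho> ^ n * (2 * real n + 1)) \<le> H"
      unfolding H_def using \<rho> by (intro sum_le_suminf sumH) auto
    then have "K5 * \<epsilon> * (D * (\<Sum>n<N. \<rho> ^ n * (2 * real n + 1))) \<le> K5 * \<epsilon> * (D * H)"
      using K \<epsilon> D0 by (intro mult_left_mono) auto
    also have "\<dots> = (K5 * H * \<epsilon>) * D" by simp
    also have "\<dots> \<le> \<kappa>' * D" using \<epsilon>3 \<kappa>' D0 by (intro mult_right_mono) auto
    finally have 1: "K5 * \<epsilon> * (D * (\<Sum>n<N. \<rho> ^ n * (2 * real n + 1))) \<le> \<kappa>' * D" .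
    \<comment> \<open>The telescoped asymmetric part leaves a negative term at the vertex
      \<open>N\<close>, kept as a truncation error.\<close>
    have 2: "\<kappa>' * \<theta> * (x N)\<^sup>2 \<le> (u N 0)\<^sup>2 / m"
    proof -
      have "0 \<le> \<theta>" "\<theta> \<le> 1" using b by (auto simp: \<theta>_def)
      then have "\<kappa>' * \<theta> * (x N)\<^sup>2 \<le> 1 / m * 1 * (x N)\<^sup>2"
        using \<kappa>' m by (intro mult_right_mono mult_mono) auto
      then show ?thesis by (simp add: x_def)
    qed
    have 3: "\<bar>\<sigma> * g N\<bar> = \<bar>u N 0 * u1 N 0\<bar>" using \<sigma>1 by (simp add: g_def abs_mult)
    show "sgn (s 1 * c 1) * (\<Sum>n<N. integral {0..1} (\<lambda>t. f n t * u n t)) \<ge>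
       - K4 * (\<Sum>n<N. integral {0..1} (\<lambda>t. (f n t)\<^sup>2)) - \<bar>u N 0 * u1 N 0\<bar> - (u N 0)\<^sup>2 / m"
      using * 1 2 3 unfolding If_def[symmetric] \<sigma>_def[symmetric] by linarith
  qed
qed

section \<open>Sums of eigenfunctions\<close>

text \<open>An eigenfunction cut into cells, with \<open>w n 1\<close> and
  \<open>w (Suc n) 0\<close> its limits from the two sides of the vertex \<open>n + 1\<close>.
  Potential, eigenvalue and vertex conditions are real, so real and imaginary parts can be treated
  separately.\<close>

definition eigsol :: "nat \<Rightarrow> (nat \<Rightarrow> real \<Rightarrow> real) \<Rightarrow> real \<Rightarrow> (nat \<Rightarrow> real \<Rightarrow> real) \<Rightarrow> (nat \<Rightarrow> real \<Rightarrow> real) \<Rightarrow> bool"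
  where "eigsol b P lam w w1 \<longleftrightarrow>
    (\<forall>n. cell_ode (w n) (w1 n) (\<lambda>t. (P n t - lam) * w n t)) \<and> w 0 0 = 0 \<and>
    (\<forall>n. w (Suc n) 0 = sqrt (real b) * w n 1 \<and> w1 (Suc n) 0 = w1 n 1 / sqrt (real b)) \<and>
    summable (\<lambda>n. integral {0..1} (\<lambda>t. (w n t)\<^sup>2))"

text \<open>Bounds a boundary value of \<open>w\<close> or \<open>w'\<close> by the \<open>L\<^sup>2\<close> norm of \<open>w\<close> on the cell, for suitable cubic \<open>\<phi>\<close>.\<close>

lemma cell_test_function:
  assumes w: "cell_ode w w1 (\<lambda>t. (P t - lam) * w t)"
    and P: "continuous_on {0..1} P" "\<And>t. t \<in> {0..1} \<Longrightarrow> \<bar>P t\<bar> \<le> M"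
    and \<phi>: "\<And>t. (\<phi> has_real_derivative \<phi>a t) (at t)" "\<And>t. (\<phi>a has_real_derivative \<phi>b t) (at t)"
      "continuous_on {0..1} \<phi>b"
      "\<And>t. t \<in> {0..1} \<Longrightarrow> \<bar>\<phi> t\<bar> \<le> 1" "\<And>t. t \<in> {0..1} \<Longrightarrow> \<bar>\<phi>b t\<bar> \<le> 6"
      "\<phi> 1 = 0" "\<phi>a 1 = 0"
  shows "(w1 0 * \<phi> 0 - w 0 * \<phi>a 0)\<^sup>2 \<le> (M + \<bar>lam\<bar> + 6)\<^sup>2 * integral {0..1} (\<lambda>t. (w t)\<^sup>2)"
proof -
  have cw: "continuous_on {0..1} w" "continuous_on {0..1} w1" using w by (auto simp: cell_ode_def)
  have c\<phi>: "continuous_on A \<phi>" "continuous_on A \<phi>a" for A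
    using \<phi>(1,2) by (meson DERIV_isCont continuous_at_imp_continuous_on)+
  have "((\<lambda>t. w t * ((P t - lam) * \<phi> t - \<phi>b t)) has_integral
      ((w1 1 * \<phi> 1 - w 1 * \<phi>a 1) - (w1 0 * \<phi> 0 - w 0 * \<phi>a 0))) {0..1}"
  proof (rule has_integral_unit_cell)
    show "continuous_on {0..1} (\<lambda>t. w1 t * \<phi> t - w t * \<phi>a t)"
      by (intro continuous_intros cw c\<phi>)
    fix t :: real assume t: "0 < t" "t < 1"
    then have "(w has_real_derivative w1 t) (at t)"
      "(w1 has_real_derivative ((P t - lam) * w t)) (at t)"
      using w by (auto simp: cell_ode_def)
    then show "((\<lambda>t. w1 t * \<phi> t - w t * \<phi>a t) has_real_derivative w t * ((P t - lam) * \<phi> t - \<phi>b t)) (at t)"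
      by (auto intro!: derivative_eq_intros \<phi> simp: algebra_simps)
  qed auto
  then have "(w1 0 * \<phi> 0 - w 0 * \<phi>a 0)\<^sup>2 = (integral {0..1} (\<lambda>t. w t * ((P t - lam) * \<phi> t - \<phi>b t)))\<^sup>2"
    using \<phi> by (auto dest!: integral_unique simp: power2_commute)
  also have "\<dots> \<le> (M + \<bar>lam\<bar> + 6)\<^sup>2 * integral {0..1} (\<lambda>t. (w t)\<^sup>2)"
  proof (rule integral_mult_power2_le)
    fix t :: real assume t: "t \<in> {0..1}"
    have "\<bar>(P t - lam) * \<phi> t - \<phi>b t\<bar> \<le> \<bar>P t - lam\<bar> * \<bar>\<phi> t\<bar> + \<bar>\<phi>b t\<bar>"
      using abs_triangle_ineq4[of "(P t - lam) * \<phi> t" "\<phi>b t"] by (simp add: abs_mult)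
    also have "\<dots> \<le> (M + \<bar>lam\<bar>) * 1 + 6"
      using \<phi>(4,5)[OF t] P(2)[OF t] by (intro add_mono mult_mono) linarith+
    finally show "\<bar>(P t - lam) * \<phi> t - \<phi>b t\<bar> \<le> M + \<bar>lam\<bar> + 6" by simp
  qed (auto intro!: continuous_intros cw P \<phi> c\<phi>)
  finally show ?thesis .
qed

text \<open>The cell norms of a square-summable solution tend to 0, and test functions pass this on
  to the vertex values with a factor that is the same in all cells. This disposes of every boundary
  term created by truncation.\<close>

lemma eigsol_boundary:
  assumes w: "eigsol b P lam w w1"
    and P: "\<And>n. continuous_on {0..1} (P n)" "\<And>n t. t \<in> {0..1} \<Longrightarrow> \<bar>P n t\<bar> \<le> M"
  shows "(\<lambda>n. w n 0) \<longlonglongrightarrow> 0" "(\<lambda>n. w1 n 0) \<longlonglongrightarrow> 0"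
proof -
  let ?C = "(M + \<bar>lam\<bar> + 6)\<^sup>2"
  have sq: "(\<lambda>n. x n) \<longlonglongrightarrow> 0"
    if "\<And>n. (x n)\<^sup>2 \<le> ?C * integral {0..1} (\<lambda>t. (w n t)\<^sup>2)" for x :: "nat \<Rightarrow> real"
  proof -
    have "(\<lambda>n. ?C * integral {0..1} (\<lambda>t. (w n t)\<^sup>2)) \<longlonglongrightarrow> ?C * 0"
      using w by (intro tendsto_intros summable_LIMSEQ_zero) (auto simp: eigsol_def)
    then have "(\<lambda>n. (x n)\<^sup>2) \<longlonglongrightarrow> 0"
      by (intro Lim_null_comparison[of "\<lambda>n. (x n)\<^sup>2"]) (use that in auto)
    from tendsto_real_sqrt[OF this] show ?thesis by (simp add: tendsto_rabs_zero_iff)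
  qed
  have c: "cell_ode (w n) (w1 n) (\<lambda>t. (P n t - lam) * w n t)" for n using w by (simp add: eigsol_def)
  show "(\<lambda>n. w n 0) \<longlonglongrightarrow> 0"
  proof (rule sq)
    fix n
    \<comment> \<open>\<open>t (1 - t)^2\<close> has value 0 and slope 1 at 0, while both vanish at
      1; this isolates \<open>w n 0\<close>.\<close>
    have "(w1 n 0 * (0 * (1 - 0)\<^sup>2) - w n 0 * (1 - 4 * 0 + 3 * 0\<^sup>2))\<^sup>2 \<le> ?C * integral {0..1} (\<lambda>t. (w n t)\<^sup>2)"
    proof (rule cell_test_function[OF c P, where \<phi> = "\<lambda>t. t * (1 - t)\<^sup>2" and \<phi>a = "\<lambda>t. 1 - 4 * t + 3 * t\<^sup>2"
          and \<phi>b = "\<lambda>t. - 4 + 6 * t"])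
      show "((\<lambda>t. t * (1 - t)\<^sup>2) has_real_derivative 1 - 4 * t + 3 * t\<^sup>2) (at t)" for t :: real
        by (auto intro!: derivative_eq_intros simp: power2_eq_square algebra_simps)
      show "\<bar>t * (1 - t)\<^sup>2\<bar> \<le> 1" if "t \<in> {0..1}" for t :: real
        using that by (auto simp: abs_mult power_le_one intro!: mult_le_one)
    qed (auto intro!: derivative_eq_intros continuous_intros)
    then show "(w n 0)\<^sup>2 \<le> ?C * integral {0..1} (\<lambda>t. (w n t)\<^sup>2)" by simp
  qed
  show "(\<lambda>n. w1 n 0) \<longlonglongrightarrow> 0"
  proof (rule sq)
    fix n
    \<comment> \<open>The Hermite cubic with value 1 and slope 0 at 0 isolates
      \<open>w1 n 0\<close>.\<close>
    have "(w1 n 0 * (1 - 3 * 0\<^sup>2 + 2 * 0 ^ 3) - w n 0 * (- 6 * 0 + 6 * 0\<^sup>2))\<^sup>2 \<le> ?C * integral {0..1} (\<lambda>t. (w n t)\<^sup>2)"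
    proof (rule cell_test_function[OF c P, where \<phi> = "\<lambda>t. 1 - 3 * t\<^sup>2 + 2 * t ^ 3" and \<phi>a = "\<lambda>t. - 6 * t + 6 * t\<^sup>2"
          and \<phi>b = "\<lambda>t. - 6 + 12 * t"])
      show "((\<lambda>t. 1 - 3 * t\<^sup>2 + 2 * t ^ 3) has_real_derivative - 6 * t + 6 * t\<^sup>2) (at t)" for t :: real
        by (auto intro!: derivative_eq_intros simp: power2_eq_square algebra_simps)
      show "\<bar>1 - 3 * t\<^sup>2 + 2 * t ^ 3\<bar> \<le> 1" if t: "t \<in> {0..1}" for t :: real
      proof -
        have "1 - 3 * t\<^sup>2 + 2 * t ^ 3 = (1 - t)\<^sup>2 * (1 + 2 * t)"
          "1 - (1 - 3 * t\<^sup>2 + 2 * t ^ 3) = t\<^sup>2 * (3 - 2 * t)"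
          by (simp_all add: power2_eq_square power3_eq_cube algebra_simps)
        moreover have "0 \<le> (1 - t)\<^sup>2 * (1 + 2 * t)" "0 \<le> t\<^sup>2 * (3 - 2 * t)"
          using t by auto
        ultimately show ?thesis by linarith
      qed
    qed (auto intro!: derivative_eq_intros continuous_intros)
    then show "(w1 n 0)\<^sup>2 \<le> ?C * integral {0..1} (\<lambda>t. (w n t)\<^sup>2)" by simp
  qed
qed

text \<open>The Wronskian is continuous across the vertices because the two jump factors are
  reciprocal; it vanishes at 0 and tends to 0 at infinity. Its increment over a cell is the inner
  product there times \<open>lam - mu\<close>.\<close>

lemma eigsol_orthogonal:
  assumes w: "eigsol b P lam w w1" and v: "eigsol b P mu v v1" and ne: "lam \<noteq> mu" and b: "b \<ge> 1"
    and P: "\<And>n. continuous_on {0..1} (P n)" "\<And>n t. t \<in> {0..1} \<Longrightarrow> \<bar>P n t\<bar> \<le> M"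
  shows "(\<lambda>N. \<Sum>n<N. integral {0..1} (\<lambda>t. w n t * v n t)) \<longlonglongrightarrow> 0"
proof -
  define W where "W n = w n 0 * v1 n 0 - w1 n 0 * v n 0" for n
  have sb: "sqrt b > 0" using b by simp
  have cell: "(lam - mu) * integral {0..1} (\<lambda>t. w n t * v n t) = W (Suc n) - W n" for n
  proof -
    have cw: "cell_ode (w n) (w1 n) (\<lambda>t. (P n t - lam) * w n t)"
      and cv: "cell_ode (v n) (v1 n) (\<lambda>t. (P n t - mu) * v n t)"
      using w v by (auto simp: eigsol_def)
    have "((\<lambda>t. (lam - mu) * (w n t * v n t)) has_integral
      ((w n 1 * v1 n 1 - w1 n 1 * v n 1) - (w n 0 * v1 n 0 - w1 n 0 * v n 0))) {0..1}"
    proof (rule has_integral_unit_cell)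
      show "continuous_on {0..1} (\<lambda>t. w n t * v1 n t - w1 n t * v n t)"
        using cw cv by (intro continuous_intros) (auto simp: cell_ode_def)
      fix t :: real assume t: "0 < t" "t < 1"
      then have "(w n has_real_derivative w1 n t) (at t)"
        "(w1 n has_real_derivative ((P n t - lam) * w n t)) (at t)"
        "(v n has_real_derivative v1 n t) (at t)"
        "(v1 n has_real_derivative ((P n t - mu) * v n t)) (at t)"
        using cw cv by (auto simp: cell_ode_def)
      then show "((\<lambda>t. w n t * v1 n t - w1 n t * v n t) has_real_derivative (lam - mu) * (w n t * v n t)) (at t)"
        by (auto intro!: derivative_eq_intros simp: algebra_simps)
    qed auto
    moreover have "w n 1 * v1 n 1 - w1 n 1 * v n 1 = W (Suc n)"
      using w v sb by (simp add: W_def eigsol_def)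
    ultimately show ?thesis
      by (auto dest!: integral_unique simp: W_def)
  qed
  have "W 0 = 0" using w v by (simp add: W_def eigsol_def)
  then have sum: "(lam - mu) * (\<Sum>n<N. integral {0..1} (\<lambda>t. w n t * v n t)) = W N" for N
    by (simp add: sum_distrib_left cell sum_lessThan_telescope)
  have "W \<longlonglongrightarrow> 0 * 0 - 0 * 0"
    unfolding W_def
    by (intro tendsto_intros eigsol_boundary[OF w P] eigsol_boundary[OF v P]) auto
  then have "(\<lambda>N. W N / (lam - mu)) \<longlonglongrightarrow> 0 / (lam - mu)"
    using ne by (intro tendsto_intros) auto
  moreover have "W N / (lam - mu) = (\<Sum>n<N. integral {0..1} (\<lambda>t. w n t * v n t))" for N
    using sum[of N] ne by (simp add: field_simps)
  ultimately show ?thesis by simp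
qed

lemma eigsol_cont: "eigsol b P lam w w1 \<Longrightarrow> continuous_on {0..1} (w n)"
  by (auto simp: eigsol_def cell_ode_def)

text \<open>By orthogonality the sum in \<open>low\<close> tends to \<open>\<Sum> (l - \<alpha>) (l - \<gamma>) \<parallel>w l\<parallel>\<^sup>2\<close>, all of whose coefficients
  are negative.\<close>

lemma eigsol_sum_vanish:
  fixes \<Lambda> :: "real set" and w w1 :: "real \<Rightarrow> nat \<Rightarrow> real \<Rightarrow> real"
  assumes fin: "finite \<Lambda>" and sub: "\<Lambda> \<subseteq> {\<alpha><..<\<gamma>}" and b: "b \<ge> 1"
    and sol: "\<And>l. l \<in> \<Lambda> \<Longrightarrow> eigsol b P l (w l) (w1 l)"
    and P: "\<And>n. continuous_on {0..1} (P n)" "\<And>n t. t \<in> {0..1} \<Longrightarrow> \<bar>P n t\<bar> \<le> M"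
    and low: "\<And>N. N \<ge> T \<Longrightarrow> (\<Sum>n<N. integral {0..1} (\<lambda>t. (\<Sum>l\<in>\<Lambda>. (l - \<alpha>) * w l n t) * (\<Sum>l\<in>\<Lambda>. (l - \<gamma>) * w l n t))) \<ge> - r N"
    and r: "r \<longlonglongrightarrow> 0"
    and l: "l \<in> \<Lambda>" and t: "t \<in> {0..1}"
  shows "w l n t = 0"
proof -
  define G where "G = (\<lambda>l k N. \<Sum>n<N. integral {0..1} (\<lambda>t. w l n t * w k n t))"
  define Z where "Z l = (\<Sum>n. integral {0..1} (\<lambda>t. (w l n t)\<^sup>2))" for l
  have cw: "continuous_on {0..1} (w l n)" if "l \<in> \<Lambda>" for l n
    by (rule eigsol_cont[OF sol[OF that]])
  have sm: "summable (\<lambda>n. integral {0..1} (\<lambda>t. (w l n t)\<^sup>2))" if "l \<in> \<Lambda>" for l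
    using sol[OF that] by (simp add: eigsol_def)
  have nn: "0 \<le> integral {0..1} (\<lambda>t. (w l n t)\<^sup>2)" if "l \<in> \<Lambda>" for l n
    by (intro integral_nonneg integrable_continuous_real continuous_intros cw that) auto
  have G: "G l k \<longlonglongrightarrow> (if l = k then Z l else 0)" if "l \<in> \<Lambda>" "k \<in> \<Lambda>" for l k
  proof (cases "l = k")
    case True
    have "G l l \<longlonglongrightarrow> Z l"
      unfolding G_def Z_def using summable_LIMSEQ[OF sm[OF that(1)]] by (simp add: power2_eq_square)
    then show ?thesis using True by simp
  next
    case False
    then show ?thesis
      using eigsol_orthogonal[OF sol[OF that(1)] sol[OF that(2)] _ b P] by (simp add: G_def)
  qed
  define SN where "SN N = (\<Sum>n<N. integral {0..1} (\<lambda>t. (\<Sum>l\<in>\<Lambda>. (l - \<alpha>) * w l n t) * (\<Sum>l\<in>\<Lambda>. (l - \<gamma>) * w l n t)))" for N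
  have SN: "SN N = (\<Sum>l\<in>\<Lambda>. \<Sum>k\<in>\<Lambda>. (l - \<alpha>) * (k - \<gamma>) * G l k N)" for N
  proof -
    have "integral {0..1} (\<lambda>t. (\<Sum>l\<in>\<Lambda>. (l - \<alpha>) * w l n t) * (\<Sum>l\<in>\<Lambda>. (l - \<gamma>) * w l n t)) =
      (\<Sum>l\<in>\<Lambda>. \<Sum>k\<in>\<Lambda>. (l - \<alpha>) * (k - \<gamma>) * integral {0..1} (\<lambda>t. w l n t * w k n t))" for n
    proof -
      have "integral {0..1} (\<lambda>t. (\<Sum>l\<in>\<Lambda>. (l - \<alpha>) * w l n t) * (\<Sum>l\<in>\<Lambda>. (l - \<gamma>) * w l n t)) =
        integral {0..1} (\<lambda>t. \<Sum>l\<in>\<Lambda>. \<Sum>k\<in>\<Lambda>. (l - \<alpha>) * (k - \<gamma>) * (w l n t * w k n t))"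
        by (simp add: sum_product algebra_simps)
      also have "\<dots> = (\<Sum>l\<in>\<Lambda>. \<Sum>k\<in>\<Lambda>. integral {0..1} (\<lambda>t. (l - \<alpha>) * (k - \<gamma>) * (w l n t * w k n t)))"
        by (subst integral_sum fin, simp add: fin, intro integrable_continuous_real continuous_intros cw, assumption+,
            intro sum.cong refl, subst integral_sum, simp add: fin, intro integrable_continuous_real continuous_intros cw)
           auto
      finally show ?thesis by simp
    qed
    then have "SN N = (\<Sum>n<N. \<Sum>l\<in>\<Lambda>. \<Sum>k\<in>\<Lambda>. (l - \<alpha>) * (k - \<gamma>) * integral {0..1} (\<lambda>t. w l n t * w k n t))"
      unfolding SN_def by simp
    also have "\<dots> = (\<Sum>l\<in>\<Lambda>. \<Sum>n<N. \<Sum>k\<in>\<Lambda>. (l - \<alpha>) * (k - \<gamma>) * integral {0..1} (\<lambda>t. w l n t * w k n t))"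
      by (rule sum.swap)
    also have "\<dots> = (\<Sum>l\<in>\<Lambda>. \<Sum>k\<in>\<Lambda>. \<Sum>n<N. (l - \<alpha>) * (k - \<gamma>) * integral {0..1} (\<lambda>t. w l n t * w k n t))"
      by (intro sum.cong refl sum.swap)
    finally show ?thesis by (simp add: G_def sum_distrib_left)
  qed
  have "SN \<longlonglongrightarrow> (\<Sum>l\<in>\<Lambda>. \<Sum>k\<in>\<Lambda>. (l - \<alpha>) * (k - \<gamma>) * (if l = k then Z l else 0))"
    unfolding SN[abs_def] by (intro tendsto_intros G)
  also have "(\<Sum>l\<in>\<Lambda>. \<Sum>k\<in>\<Lambda>. (l - \<alpha>) * (k - \<gamma>) * (if l = k then Z l else 0)) = (\<Sum>l\<in>\<Lambda>. (l - \<alpha>) * (l - \<gamma>) * Z l)"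
    by (intro sum.cong refl) (simp add: fin if_distrib cong: if_cong)
  finally have lim: "SN \<longlonglongrightarrow> (\<Sum>l\<in>\<Lambda>. (l - \<alpha>) * (l - \<gamma>) * Z l)" .
  have "(\<lambda>N. - r N) \<longlonglongrightarrow> - 0" by (intro tendsto_intros r)
  then have ge: "(\<Sum>l\<in>\<Lambda>. (l - \<alpha>) * (l - \<gamma>) * Z l) \<ge> - 0"
    by (rule tendsto_le[OF sequentially_bot lim])
       (use low in \<open>auto simp: SN_def eventually_sequentially\<close>)
  have Z0: "Z l \<ge> 0" if "l \<in> \<Lambda>" for l
    unfolding Z_def by (intro suminf_nonneg sm nn that)
  have c: "(l - \<alpha>) * (l - \<gamma>) < 0" if "l \<in> \<Lambda>" for l
    using sub that by (auto intro!: mult_pos_neg)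
  have nonneg: "0 \<le> - ((l - \<alpha>) * (l - \<gamma>) * Z l)" if "l \<in> \<Lambda>" for l
    using c[OF that] Z0[OF that] by (simp add: mult_nonpos_nonneg)
  have "(\<Sum>l\<in>\<Lambda>. - ((l - \<alpha>) * (l - \<gamma>) * Z l)) = 0"
  proof -
    have "0 \<le> (\<Sum>l\<in>\<Lambda>. - ((l - \<alpha>) * (l - \<gamma>) * Z l))" by (rule sum_nonneg) (rule nonneg)
    then show ?thesis using ge by (simp add: sum_negf)
  qed
  then have "- ((l - \<alpha>) * (l - \<gamma>) * Z l) = 0"
    using sum_nonneg_0[of \<Lambda> "\<lambda>l. - ((l - \<alpha>) * (l - \<gamma>) * Z l)", OF fin nonneg _ l] by blast
  then have "Z l = 0" using c[OF l] by auto
  then have "integral {0..1} (\<lambda>t. (w l n t)\<^sup>2) = 0"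
    unfolding Z_def using sm[OF l] nn[OF l] by (subst (asm) suminf_eq_zero_iff) auto
  then have "\<forall>t\<in>{0..1}. (w l n t)\<^sup>2 = 0"
    by (subst (asm) integral_eq_0_iff) (auto intro!: continuous_intros cw l)
  then show ?thesis using t by simp
qed

section \<open>Head and tail combined\<close>

lemma cell_ode_sum:
  assumes "finite \<Lambda>" "\<And>l. l \<in> \<Lambda> \<Longrightarrow> cell_ode (w l) (w1 l) (w2 l)"
  shows "cell_ode (\<lambda>t. \<Sum>l\<in>\<Lambda>. w l t) (\<lambda>t. \<Sum>l\<in>\<Lambda>. w1 l t) (\<lambda>t. \<Sum>l\<in>\<Lambda>. w2 l t)"
  using assms unfolding cell_ode_def by (auto intro!: continuous_intros DERIV_sum)

text \<open>With \<open>u\<close> the sum of the family and \<open>f = (A - \<beta>) u\<close>, each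
  cell contributes \<open>||f||^2 + \<sigma> (\<gamma> - \<alpha>) <f, u>\<close>. In the head the
  energy estimate bounds \<open>|<f, u>|\<close> by a multiple of \<open>||f||^2\<close>; in the
  tail coercivity bounds the sum of \<open>\<sigma> <f, u>\<close> from below. The two smallness
  conditions on \<gamma> - \<alpha> let \<open>||f||^2\<close> win in both cases, up to truncation
  terms.\<close>

lemma eigsol_family_vanish:
  fixes \<Lambda> :: "real set" and w w1 :: "real \<Rightarrow> nat \<Rightarrow> real \<Rightarrow> real"
  assumes fin: "finite \<Lambda>" and sub: "\<Lambda> \<subseteq> {\<alpha><..<\<gamma>}" and b: "b \<ge> 1"
    and sol: "\<And>l. l \<in> \<Lambda> \<Longrightarrow> eigsol b P l (w l) (w1 l)"
    and P: "\<And>n. continuous_on {0..1} (P n)" "\<And>n t. t \<in> {0..1} \<Longrightarrow> \<bar>P n t\<bar> \<le> M"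
    and tc: "tail_coercive b \<rho> \<epsilon> K m \<sigma> \<beta>" and \<beta>: "\<sigma> = 1 \<and> \<beta> = \<gamma> \<or> \<sigma> = - 1 \<and> \<beta> = \<alpha>"
    and h: "\<alpha> < \<gamma>" "(\<gamma> - \<alpha>) * K \<le> 1" "(\<gamma> - \<alpha>) * (1 + exp (2 + B + L)) \<le> 2"
    and B: "\<bar>\<beta>\<bar> \<le> B" and L: "0 \<le> L"
    and head: "\<And>n t. n < T \<Longrightarrow> 0 < t \<Longrightarrow> t < 1 \<Longrightarrow> (P n has_real_derivative P' n t) (at t)"
      "\<And>n t. n < T \<Longrightarrow> 0 \<le> t \<Longrightarrow> t \<le> 1 \<Longrightarrow> P n t \<le> 0"
      "\<And>n t. n < T \<Longrightarrow> 0 < t \<Longrightarrow> t < 1 \<Longrightarrow> \<bar>P' n t\<bar> \<le> - L * P n t"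
    and tail: "\<And>n t. t \<in> {0..1} \<Longrightarrow> \<bar>P (T + n) t\<bar> \<le> \<epsilon> * \<rho> ^ n"
    and con: "\<And>n. n < T \<Longrightarrow> (\<Sum>l\<in>\<Lambda>. w l n 0) = 0" "\<And>n. n < T \<Longrightarrow> (\<Sum>l\<in>\<Lambda>. w1 l n 0) = 0"
      "\<And>n. n < T \<Longrightarrow> (\<Sum>l\<in>\<Lambda>. w l (Suc n) 0) = 0"
    and l: "l \<in> \<Lambda>" and t: "t \<in> {0..1}"
  shows "w l n t = 0"
proof -
  define u where "u n t = (\<Sum>l\<in>\<Lambda>. w l n t)" for n t
  define u1 where "u1 n t = (\<Sum>l\<in>\<Lambda>. w1 l n t)" for n t
  define f where "f n t = (\<Sum>l\<in>\<Lambda>. (l - \<beta>) * w l n t)" for n t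
  define h where "h = \<gamma> - \<alpha>"
  define G where "G n = integral {0..1} (\<lambda>t. (\<Sum>l\<in>\<Lambda>. (l - \<alpha>) * w l n t) * (\<Sum>l\<in>\<Lambda>. (l - \<gamma>) * w l n t))" for n
  define If where "If n = integral {0..1} (\<lambda>t. (f n t)\<^sup>2)" for n
  define Ifu where "Ifu n = integral {0..1} (\<lambda>t. f n t * u n t)" for n
  have h0: "h > 0" "h * K \<le> 1" "h * (1 + exp (2 + B + L)) \<le> 2" using h by (simp_all add: h_def)
  have \<sigma>: "\<sigma>\<^sup>2 = 1" using \<beta> by auto
  have cw: "continuous_on {0..1} (w l n)" if "l \<in> \<Lambda>" for l n
    by (rule eigsol_cont[OF sol[OF that]])
  have cu: "continuous_on {0..1} (u n)" for n unfolding u_def by (intro continuous_intros cw)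
  have cf: "continuous_on {0..1} (f n)" for n unfolding f_def by (intro continuous_intros cw)
  have ode: "cell_ode (u n) (u1 n) (\<lambda>t. (P n t - \<beta>) * u n t - f n t)" for n
  proof -
    have "cell_ode (\<lambda>t. \<Sum>l\<in>\<Lambda>. w l n t) (\<lambda>t. \<Sum>l\<in>\<Lambda>. w1 l n t) (\<lambda>t. \<Sum>l\<in>\<Lambda>. (P n t - l) * w l n t)"
      using sol by (intro cell_ode_sum fin) (auto simp: eigsol_def)
    moreover have "(\<Sum>l\<in>\<Lambda>. (P n t - l) * w l n t) = (P n t - \<beta>) * u n t - f n t" for t
      unfolding u_def f_def by (simp add: sum_distrib_left sum_subtractf[symmetric] algebra_simps)
    ultimately show ?thesis by (simp add: u_def[abs_def] u1_def[abs_def])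
  qed
  have ju: "u (Suc n) 0 = sqrt (real b) * u n 1 \<and> u1 (Suc n) 0 = u1 n 1 / sqrt (real b)" for n
    using sol unfolding u_def u1_def
    by (auto simp: eigsol_def sum_distrib_left sum_divide_distrib intro!: sum.cong)
  \<comment> \<open>One of the two factors is \<open>f\<close> itself and the other is
    \<open>f + \<sigma> * h * u\<close>.\<close>
  have G: "G n = If n + \<sigma> * h * Ifu n" for n
  proof -
    have "(\<Sum>l\<in>\<Lambda>. (l - \<alpha>) * w l n t) * (\<Sum>l\<in>\<Lambda>. (l - \<gamma>) * w l n t) = (f n t)\<^sup>2 + (\<sigma> * h) * (f n t * u n t)" for t
      using \<beta>
    proof
      assume *: "\<sigma> = 1 \<and> \<beta> = \<gamma>"
      have "(\<Sum>l\<in>\<Lambda>. (l - \<alpha>) * w l n t) = f n t + h * u n t"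
        using * by (simp add: f_def u_def h_def sum_distrib_left sum.distrib[symmetric] algebra_simps)
      then show ?thesis using * by (simp add: f_def power2_eq_square algebra_simps)
    next
      assume *: "\<sigma> = - 1 \<and> \<beta> = \<alpha>"
      have "(\<Sum>l\<in>\<Lambda>. (l - \<gamma>) * w l n t) = f n t - h * u n t"
        using * by (simp add: f_def u_def h_def sum_distrib_left sum_subtractf[symmetric] algebra_simps)
      moreover have "(\<Sum>l\<in>\<Lambda>. (l - \<alpha>) * w l n t) = f n t" using * by (simp add: f_def)
      ultimately show ?thesis using * by (simp only:) (simp add: power2_eq_square algebra_simps)
    qed
    then have "G n = integral {0..1} (\<lambda>t. (f n t)\<^sup>2 + (\<sigma> * h) * (f n t * u n t))" by (simp add: G_def)
    also have "\<dots> = If n + (\<sigma> * h) * Ifu n"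
      unfolding If_def Ifu_def
      by (subst integral_add) (auto intro!: integrable_continuous_real continuous_intros cf cu)
    finally show ?thesis .
  qed
  have If0: "If n \<ge> 0" for n
    unfolding If_def by (intro integral_nonneg integrable_continuous_real continuous_intros cf) auto
  have head': "G n \<ge> 0" if n: "n < T" for n
  proof -
    define Iu where "Iu = integral {0..1} (\<lambda>t. (u n t)\<^sup>2)"
    have "Iu \<le> exp (2 + B + L) * If n"
      unfolding If_def Iu_def
    proof (rule energy_cell)
      show "cell_ode (u n) (u1 n) (\<lambda>t. (- (- P n t) - \<beta>) * u n t - f n t)" using ode[of n] by simp
      show "((\<lambda>t. - P n t) has_real_derivative - P' n t) (at t)" if "0 < t" "t < 1" for t
        using head(1)[OF n that] by (rule DERIV_minus)
      show "u n 0 = 0" "u1 n 0 = 0" using con n by (auto simp: u_def u1_def)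
      show "0 \<le> - P n t" if "0 \<le> t" "t \<le> 1" for t using head(2)[OF n that] by simp
      show "\<bar>- P' n t\<bar> \<le> L * - P n t" if "0 < t" "t < 1" for t using head(3)[OF n that] by simp
    qed (auto intro!: continuous_intros P cf B L)
    moreover have "\<bar>Ifu n\<bar> \<le> (1/2) * If n + (1/2) * Iu"
    proof -
      have "norm (Ifu n) \<le> integral {0..1} (\<lambda>t. (1/2) * (f n t)\<^sup>2 + (1/2) * (u n t)\<^sup>2)"
        unfolding Ifu_def
      proof (rule integral_norm_bound_integral)
        fix t :: real assume t: "t \<in> {0..1}"
        show "norm (f n t * u n t) \<le> (1/2) * (f n t)\<^sup>2 + (1/2) * (u n t)\<^sup>2"
          using sum_squares_bound[of "\<bar>f n t\<bar>" "\<bar>u n t\<bar>"] by (simp add: abs_mult)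
      qed (intro integrable_continuous_real continuous_intros cf cu)+
      also have "\<dots> = (1/2) * If n + (1/2) * Iu"
        unfolding If_def Iu_def
        by (subst integral_add) (auto intro!: integrable_continuous_real continuous_intros cf cu)
      finally show ?thesis by simp
    qed
    ultimately have "\<bar>Ifu n\<bar> \<le> (1 + exp (2 + B + L)) / 2 * If n" by (simp add: algebra_simps)
    then have "h * \<bar>Ifu n\<bar> \<le> h * ((1 + exp (2 + B + L)) / 2 * If n)"
      using h0 by (intro mult_left_mono) auto
    also have "\<dots> = (h * (1 + exp (2 + B + L))) / 2 * If n" by simp
    also have "\<dots> \<le> 2 / 2 * If n" using h0 If0 by (intro mult_right_mono divide_right_mono) auto
    finally have "h * \<bar>Ifu n\<bar> \<le> If n" by simp
    moreover have "\<bar>\<sigma> * h * Ifu n\<bar> = h * \<bar>Ifu n\<bar>" using h0 \<beta> by (auto simp: abs_mult)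
    ultimately show ?thesis unfolding G by linarith
  qed
  \<comment> \<open>The tail has to start with a zero. For \<open>T = 0\<close> this is the boundary
    condition of the operator; otherwise the third family of conditions, taken at
    \<open>n = T - 1\<close>, supplies it behind the last head cell.\<close>
  have uT: "u T 0 = 0"
  proof (cases T)
    case 0
    have "w l 0 0 = 0" if "l \<in> \<Lambda>" for l using sol[OF that] by (simp add: eigsol_def)
    then show ?thesis using 0 by (simp add: u_def)
  next
    case (Suc n)
    then show ?thesis using con(3)[of n] by (simp add: u_def)
  qed
  define r where "r N = h * (\<bar>u N 0 * u1 N 0\<bar> + (u N 0)\<^sup>2 / m)" for N
  have low: "(\<Sum>n<N. G n) \<ge> - r N" if N: "N \<ge> T" for N
  proof -
    obtain j where j: "N = T + j" using N le_Suc_ex by blast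
    have split: "(\<Sum>n<N. G n) = (\<Sum>n<T. G n) + (\<Sum>n<j. G (T + n))"
      unfolding j by (induction j) auto
    have "\<sigma> * (\<Sum>n<j. integral {0..1} (\<lambda>t. f (T + n) t * u (T + n) t)) \<ge>
       - K * (\<Sum>n<j. integral {0..1} (\<lambda>t. (f (T + n) t)\<^sup>2)) - \<bar>u (T + j) 0 * u1 (T + j) 0\<bar> - (u (T + j) 0)\<^sup>2 / m"
      using tc[unfolded tail_coercive_def, rule_format, of "\<lambda>n. u (T + n)" "\<lambda>n. u1 (T + n)" "\<lambda>n. P (T + n)" "\<lambda>n. f (T + n)"]
        ode P(1) tail cf uT ju by simp
    then have "h * (\<sigma> * (\<Sum>n<j. Ifu (T + n))) \<ge> h * (- K * (\<Sum>n<j. If (T + n)) - \<bar>u N 0 * u1 N 0\<bar> - (u N 0)\<^sup>2 / m)"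
      unfolding If_def Ifu_def j using h0 by (intro mult_left_mono) auto
    also have "h * (- K * (\<Sum>n<j. If (T + n)) - \<bar>u N 0 * u1 N 0\<bar> - (u N 0)\<^sup>2 / m) = - (h * K) * (\<Sum>n<j. If (T + n)) - r N"
      by (simp add: r_def algebra_simps)
    finally have "h * (\<sigma> * (\<Sum>n<j. Ifu (T + n))) \<ge> - (h * K) * (\<Sum>n<j. If (T + n)) - r N" .
    moreover have "(h * K) * (\<Sum>n<j. If (T + n)) \<le> 1 * (\<Sum>n<j. If (T + n))"
      using h0 If0 by (intro mult_right_mono sum_nonneg) auto
    ultimately have "(\<Sum>n<j. If (T + n)) + h * (\<sigma> * (\<Sum>n<j. Ifu (T + n))) \<ge> - r N" by simp
    moreover have "(\<Sum>n<j. G (T + n)) = (\<Sum>n<j. If (T + n)) + h * (\<sigma> * (\<Sum>n<j. Ifu (T + n)))"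
      by (simp add: G sum.distrib sum_distrib_left algebra_simps)
    moreover have "(\<Sum>n<T. G n) \<ge> 0" using head' by (intro sum_nonneg) auto
    ultimately show ?thesis unfolding split by linarith
  qed
  have lims: "(\<lambda>N. u N 0) \<longlonglongrightarrow> 0" "(\<lambda>N. u1 N 0) \<longlonglongrightarrow> 0"
    unfolding u_def u1_def
    using eigsol_boundary[OF sol P] by (auto intro!: tendsto_null_sum)
  have "r \<longlonglongrightarrow> h * (\<bar>0 * 0\<bar> + 0\<^sup>2 / m)"
    unfolding r_def divide_inverse by (intro tendsto_intros lims)
  then have r: "r \<longlonglongrightarrow> 0" by simp
  show ?thesis
    by (rule eigsol_sum_vanish[OF fin sub b sol P _ r l t, where T = T]) (use low in \<open>auto simp: G_def\<close>)
qed

section \<open>From the operator to the cells\<close>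

text \<open>The equation upgrades regularity: \<open>y\<close> extends continuously to the closed
  cell, so \<open>y1\<close> is the integral of a continuous function, and a classical solution with
  end values results.\<close>

lemma H2_cell:
  assumes H2: "H2_on p (p + 1) y y1 y2" and Q: "continuous_on {p..p+1} Q"
    and ae: "AE t in lborel. p < t \<longrightarrow> t < p + 1 \<longrightarrow> y2 t = of_real (Q t) * y t"
  obtains Y Y1 :: "real \<Rightarrow> complex" where "continuous_on {p..p+1} Y" "continuous_on {p..p+1} Y1"
    "\<And>t. t \<in> {p<..<p+1} \<Longrightarrow> Y t = y t" "\<And>t. t \<in> {p<..<p+1} \<Longrightarrow> Y1 t = y1 t"
    "\<And>t. t \<in> {p<..<p+1} \<Longrightarrow> (Y has_vector_derivative Y1 t) (at t)"
    "\<And>t. t \<in> {p<..<p+1} \<Longrightarrow> (Y1 has_vector_derivative of_real (Q t) * Y t) (at t)"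
proof -
  have dy: "(y has_vector_derivative y1 t) (at t)" if "t \<in> {p<..<p+1}" for t
    using H2 that by (simp add: H2_on_def)
  have y1: "y1 t - y1 s = (LINT x:{s..t}|lborel. y2 x)" if "p < s" "s \<le> t" "t < p + 1" for s t
    using H2 that by (simp add: H2_on_def)
  have int: "set_integrable lborel {p<..<p+1} y2"
  proof (rule set_integrable_bound)
    \<comment> \<open>On a bounded interval \<open>|y2| \<le> 1 + |y2|^2\<close> turns square
      integrability into integrability.\<close>
    show "set_integrable lborel {p<..<p+1} (\<lambda>t. 1 + (norm (y2 t))\<^sup>2)"
    proof (rule set_integral_add)
      show "set_integrable lborel {p<..<p+1} (\<lambda>t. 1::real)"
        by (simp add: set_integrable_def)
      show "set_integrable lborel {p<..<p+1} (\<lambda>t. (norm (y2 t))\<^sup>2)"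
        using H2 by (simp add: H2_on_def)
    qed
    show "set_borel_measurable lborel {p<..<p+1} y2" using H2 by (simp add: H2_on_def)
    have "norm (y2 x) \<le> norm (1 + (norm (y2 x))\<^sup>2)" for x
    proof -
      have "2 * norm (y2 x) * 1 \<le> (norm (y2 x))\<^sup>2 + 1\<^sup>2" by (rule sum_squares_bound)
      moreover have "0 \<le> norm (y2 x)" "norm (1 + (norm (y2 x))\<^sup>2) = 1 + (norm (y2 x))\<^sup>2" by simp_all
      ultimately show ?thesis unfolding power_one by linarith
    qed
    then show "AE x in lborel. x \<in> {p<..<p+1} \<longrightarrow> norm (y2 x) \<le> norm (1 + (norm (y2 x))\<^sup>2)" by simp
  qed
  define q where "q = (LINT x:{p<..<p+1}|lborel. norm (y2 x))"
  have y1d: "norm (y1 t - y1 s) \<le> q" if "p < s" "s \<le> t" "t < p + 1" for s t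
  proof -
    have i: "set_integrable lborel {s..t} y2"
      by (rule set_integrable_subset[OF int]) (use that in auto)
    have "norm (LINT x:{s..t}|lborel. y2 x) \<le> (LINT x:{s..t}|lborel. norm (y2 x))"
      using i by (rule set_integral_norm_bound)
    also have "\<dots> \<le> q"
      unfolding q_def set_lebesgue_integral_def
      using set_integrable_norm[OF i] set_integrable_norm[OF int] that
      by (intro integral_mono) (auto simp: set_integrable_def indicator_def)
    finally show ?thesis using y1[OF that] by simp
  qed
  define B where "B = norm (y1 (p + 1/2)) + q"
  have y1b: "norm (y1 t) \<le> B" if "t \<in> {p<..<p+1}" for t
  proof (cases "t \<le> p + 1/2")
    case True
    then have "norm (y1 (p + 1/2) - y1 t) \<le> q" using that by (intro y1d) auto
    then show ?thesis unfolding B_def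
      using norm_triangle_sub[of "y1 t" "y1 (p+1/2)"] by (simp add: norm_minus_commute)
  next
    case False
    then have "norm (y1 t - y1 (p + 1/2)) \<le> q" using that by (intro y1d) auto
    then show ?thesis unfolding B_def
      using norm_triangle_sub[of "y1 t" "y1 (p+1/2)"] by simp
  qed
  \<comment> \<open>A bounded \<open>y1\<close> makes \<open>y\<close> uniformly continuous, which
    provides the extension \<open>Y\<close> to the end points.\<close>
  have "B-lipschitz_on {p<..<p+1} y"
  proof (rule lipschitz_onI)
    have "p + 1/2 \<in> {p<..<p+1}" by simp
    from y1b[OF this] show "0 \<le> B" using norm_ge_zero order_trans by blast
    fix s t assume st: "s \<in> {p<..<p+1}" "t \<in> {p<..<p+1}"
    have "norm (y s - y t) \<le> B * norm (s - t)"
    proof (rule differentiable_bound[of "{p<..<p+1}" y "\<lambda>t x. x *\<^sub>R y1 t"])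
      fix x assume x: "x \<in> {p<..<p+1}"
      then show "(y has_derivative (\<lambda>h. h *\<^sub>R y1 x)) (at x within {p<..<p+1})"
        using dy has_vector_derivative_at_within unfolding has_vector_derivative_def
        by (blast intro: has_derivative_at_withinI)
      have "onorm (\<lambda>h::real. h *\<^sub>R y1 x) \<le> norm (y1 x)"
        by (rule onorm_bound) (auto simp: mult.commute)
      then show "onorm (\<lambda>h::real. h *\<^sub>R y1 x) \<le> B" using y1b[OF x] by linarith
    qed (use st in auto)
    then show "dist (y s) (y t) \<le> B * dist s t" by (simp add: dist_norm)
  qed
  then have "uniformly_continuous_on {p<..<p+1} y" by (rule lipschitz_on_uniformly_continuous)
  then obtain Y where Y: "uniformly_continuous_on (closure {p<..<p+1}) Y"
      "\<And>x. x \<in> {p<..<p+1} \<Longrightarrow> y x = Y x"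
    by (rule uniformly_continuous_on_extension_on_closure) blast
  have cY: "continuous_on {p..p+1} Y"
    using uniformly_continuous_imp_continuous[OF Y(1)] by simp
  define g where "g t = of_real (Q t) * Y t" for t
  have cg: "continuous_on {p..p+1} g" unfolding g_def by (intro continuous_intros Q cY)
  have y1g: "y1 t - y1 s = integral {s..t} g" if st: "p < s" "s \<le> t" "t < p + 1" for s t
  proof -
    have i: "set_integrable lborel {s..t} y2"
      by (rule set_integrable_subset[OF int]) (use that in auto)
    have j: "set_integrable lborel {s..t} g"
      by (rule borel_integrable_atLeastAtMost') (rule continuous_on_subset[OF cg], use that in auto)
    have "(LINT x:{s..t}|lborel. y2 x) = (LINT x:{s..t}|lborel. g x)"
      unfolding set_lebesgue_integral_def
    proof (rule integral_cong_AE)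
      show "AE x in lborel. indicat_real {s..t} x *\<^sub>R y2 x = indicat_real {s..t} x *\<^sub>R g x"
        using ae by eventually_elim (use st Y(2) in \<open>auto simp: indicator_def g_def\<close>)
    qed (use i j in \<open>auto simp: set_integrable_def\<close>)
    then show ?thesis using y1[OF st] set_borel_integral_eq_integral(2)[OF j] by simp
  qed
  \<comment> \<open>Anchored at the midpoint, because the values of \<open>y1\<close> are controlled
    only in the open cell.\<close>
  define Y1 where "Y1 t = y1 (p + 1/2) - integral {p..p+1/2} g + integral {p..t} g" for t
  have ig: "g integrable_on {s..t}" if "p \<le> s" "t \<le> p + 1" for s t
    by (intro integrable_continuous_real continuous_on_subset[OF cg]) (use that in auto)
  have Y1: "Y1 t = y1 t" if t: "t \<in> {p<..<p+1}" for t
  proof (cases "t \<le> p + 1/2")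
    case True
    have "integral {p..t} g + integral {t..p+1/2} g = integral {p..p+1/2} g"
      by (rule Henstock_Kurzweil_Integration.integral_combine) (use t True ig in auto)
    moreover have "y1 (p + 1/2) - y1 t = integral {t..p+1/2} g" using t True by (intro y1g) auto
    ultimately show ?thesis by (simp add: Y1_def algebra_simps)
  next
    case False
    have "integral {p..p+1/2} g + integral {p+1/2..t} g = integral {p..t} g"
      by (rule Henstock_Kurzweil_Integration.integral_combine) (use t False ig in auto)
    moreover have "y1 t - y1 (p + 1/2) = integral {p+1/2..t} g" using t False by (intro y1g) auto
    ultimately show ?thesis by (simp add: Y1_def algebra_simps)
  qed
  have dY1: "(Y1 has_vector_derivative g t) (at t within {p..p+1})" if "t \<in> {p..p+1}" for t
    unfolding Y1_def using integral_has_vector_derivative[OF cg that]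
    by (auto intro!: derivative_eq_intros)
  show thesis
  proof (rule that[OF cY])
    show "continuous_on {p..p+1} Y1"
      using dY1 has_vector_derivative_continuous continuous_on_eq_continuous_within by blast
    show "Y t = y t" if "t \<in> {p<..<p+1}" for t using Y(2)[OF that] by simp
    show "Y1 t = y1 t" if "t \<in> {p<..<p+1}" for t using Y1[OF that] .
    show "(Y has_vector_derivative Y1 t) (at t)" if "t \<in> {p<..<p+1}" for t
      using dy[OF that] unfolding Y1[OF that]
      by (rule has_vector_derivative_transform_within_open[where S = "{p<..<p+1}"]) (use that Y(2) in auto)
    show "(Y1 has_vector_derivative of_real (Q t) * Y t) (at t)" if "t \<in> {p<..<p+1}" for t
    proof -
      have "(Y1 has_vector_derivative g t) (at t within {p<..<p+1})"
        by (rule has_vector_derivative_within_subset[OF dY1]) (use that in auto)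
      moreover have "at t within {p<..<p+1} = at t" using that by (intro at_within_open) auto
      ultimately show ?thesis unfolding g_def by (simp only:)
    qed
  qed
qed

text \<open>The vertex conditions are stated with \<open>Lim\<close>, which is informative only
  where a limit exists. The continuous extensions provide the limits and turn the conditions into
  equations between end values of neighbouring cells.\<close>

lemma A_graph_eigsol:
  assumes A: "A_graph b V y (\<lambda>t. of_real lam * y t)"
    and P: "\<And>n. continuous_on {0..1} (P n)" "\<And>n t. 0 < t \<Longrightarrow> t < 1 \<Longrightarrow> P n t = V (real n + t)"
  obtains W W1 :: "nat \<Rightarrow> real \<Rightarrow> complex" where
    "\<And>n t. 0 < t \<Longrightarrow> t < 1 \<Longrightarrow> W n t = y (real n + t)"
    "eigsol b P lam (\<lambda>n t. Re (W n t)) (\<lambda>n t. Re (W1 n t))"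
    "eigsol b P lam (\<lambda>n t. Im (W n t)) (\<lambda>n t. Im (W1 n t))"
proof -
  obtain y1 y2 where H2: "\<And>n::nat. H2_on (real n) (real n + 1) y y1 y2"
    and fin: "(\<Sum>n::nat. \<integral>\<^sup>+t\<in>{real n<..<real n + 1}. ennreal ((norm (y2 t))\<^sup>2 + (norm (y t))\<^sup>2) \<partial>lborel) < \<infinity>"
    and l0: "Lim (at_right 0) y = 0"
    and jump: "\<And>n::nat. n \<ge> 1 \<Longrightarrow> Lim (at_right (real n)) y = of_real (sqrt (real b)) * Lim (at_left (real n)) y"
      "\<And>n::nat. n \<ge> 1 \<Longrightarrow> Lim (at_right (real n)) y1 = of_real (1 / sqrt (real b)) * Lim (at_left (real n)) y1"
    and ae: "AE t in lborel. 0 < t \<longrightarrow> of_real lam * y t = - y2 t + of_real (V t) * y t"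
    using A unfolding A_graph_def by blast
  \<comment> \<open>One predicate for both extensions, so that a single choice over all cells yields
    them with all their properties.\<close>
  define good where "good n Y Y1 \<longleftrightarrow> continuous_on {real n..real n+1} Y \<and> continuous_on {real n..real n+1} Y1 \<and>
    (\<forall>t\<in>{real n<..<real n+1}. Y t = y t \<and> Y1 t = y1 t \<and> (Y has_vector_derivative Y1 t) (at t) \<and>
      (Y1 has_vector_derivative of_real (P n (t - n) - lam) * Y t) (at t))" for n and Y Y1 :: "real \<Rightarrow> complex"
  have "\<exists>Y Y1. good n Y Y1" for n
  proof -
    have cQ: "continuous_on {real n..real n+1} (\<lambda>t. P n (t - n) - lam)"
      by (intro continuous_intros continuous_on_compose2[OF P(1)]) auto
    have aeQ: "AE t in lborel. real n < t \<longrightarrow> t < real n + 1 \<longrightarrow> y2 t = of_real (P n (t - n) - lam) * y t"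
      using ae
    proof eventually_elim
      case (elim t)
      show ?case
      proof (intro impI)
        assume t: "real n < t" "t < real n + 1"
        then have "P n (t - n) = V t" using P(2)[of "t - n" n] by simp
        then show "y2 t = of_real (P n (t - n) - lam) * y t" using elim t by (simp add: algebra_simps)
      qed
    qed
    show ?thesis
      by (rule H2_cell[OF H2[of n] cQ aeQ]) (unfold good_def, blast)
  qed
  then obtain Y Y1 where "\<And>n. good n (Y n) (Y1 n)" by metis
  then obtain Y Y1 where cY: "\<And>n. continuous_on {real n..real n+1} (Y n)" "\<And>n. continuous_on {real n..real n+1} (Y1 n)"
    and Y: "\<And>n t. t \<in> {real n<..<real n+1} \<Longrightarrow> Y n t = y t" "\<And>n t. t \<in> {real n<..<real n+1} \<Longrightarrow> Y1 n t = y1 t"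
    and dY: "\<And>n t. t \<in> {real n<..<real n+1} \<Longrightarrow> (Y n has_vector_derivative Y1 n t) (at t)"
      "\<And>n t. t \<in> {real n<..<real n+1} \<Longrightarrow> (Y1 n has_vector_derivative of_real (P n (t - n) - lam) * Y n t) (at t)"
    unfolding good_def by blast
  have lim_right: "Lim (at_right (real n)) z = Z (real n)"
    if "continuous_on {real n..real n+1} Z" "\<And>t. t \<in> {real n<..<real n+1} \<Longrightarrow> Z t = z t" for n and z Z :: "real \<Rightarrow> complex"
  proof (rule tendsto_Lim)
    have "(Z \<longlongrightarrow> Z (real n)) (at_right (real n))"
      using that(1) by (rule continuous_on_Icc_at_rightD) simp
    then show "(z \<longlongrightarrow> Z (real n)) (at_right (real n))"
    proof (rule Lim_transform_eventually)
      show "eventually (\<lambda>t. Z t = z t) (at_right (real n))"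
        using eventually_at_right_real[of "real n" "real n + 1"] by (rule eventually_mono[OF _ that(2)]) simp
    qed
  qed simp
  have lim_left: "Lim (at_left (real (Suc n))) z = Z (real n + 1)"
    if "continuous_on {real n..real n+1} Z" "\<And>t. t \<in> {real n<..<real n+1} \<Longrightarrow> Z t = z t" for n and z Z :: "real \<Rightarrow> complex"
  proof (rule tendsto_Lim)
    have "(Z \<longlongrightarrow> Z (real n + 1)) (at_left (real n + 1))"
      using that(1) by (rule continuous_on_Icc_at_leftD) simp
    then have "(z \<longlongrightarrow> Z (real n + 1)) (at_left (real n + 1))"
    proof (rule Lim_transform_eventually)
      show "eventually (\<lambda>t. Z t = z t) (at_left (real n + 1))"
        using eventually_at_left_real[of "real n" "real n + 1"] by (rule eventually_mono[OF _ that(2)]) simp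
    qed
    then show "(z \<longlongrightarrow> Z (real n + 1)) (at_left (real (Suc n)))" by (simp add: add.commute)
  qed simp
  define W where "W n t = Y n (t + real n)" for n t
  define W1 where "W1 n t = Y1 n (t + real n)" for n t
  have cW: "continuous_on {0..1} (W n)" "continuous_on {0..1} (W1 n)" for n
    unfolding W_def W1_def
    by (rule continuous_on_compose2[OF cY(1)] continuous_on_compose2[OF cY(2)];
        (intro continuous_intros | force))+
  have right: "Lim (at_right (real n)) y = W n 0" "Lim (at_right (real n)) y1 = W1 n 0" for n
    using lim_right[where n = n and Z = "Y n" and z = y, OF cY(1) Y(1)]
      lim_right[where n = n and Z = "Y1 n" and z = y1, OF cY(2) Y(2)]
    by (simp_all only: W_def W1_def add_0)
  have left: "Lim (at_left (real (Suc n))) y = W n 1" "Lim (at_left (real (Suc n))) y1 = W1 n 1" for n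
    using lim_left[where n = n and Z = "Y n" and z = y, OF cY(1) Y(1)]
      lim_left[where n = n and Z = "Y1 n" and z = y1, OF cY(2) Y(2)]
    by (simp_all only: W_def W1_def add.commute)
  have W0: "W 0 0 = 0" using right(1)[of 0] l0 by simp
  have WS: "W (Suc n) 0 = of_real (sqrt (real b)) * W n 1" "W1 (Suc n) 0 = of_real (1 / sqrt (real b)) * W1 n 1" for n
    using jump[of "Suc n"] unfolding right left by auto
  \<comment> \<open>\<open>L\<close> stands for \<open>Re\<close> or \<open>Im\<close>. It commutes
    with real factors, hence with the equation and the jumps, and it is dominated by the norm, hence
    square summability passes over.\<close>
  have part: "eigsol b P lam (\<lambda>n t. L (W n t)) (\<lambda>n t. L (W1 n t))"
    if L: "bounded_linear L" "\<And>x z. L (of_real x * z) = x * L z" "\<And>z. \<bar>L z\<bar> \<le> norm z" for L :: "complex \<Rightarrow> real"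
    unfolding eigsol_def
  proof (intro conjI allI)
    interpret bounded_linear L by fact
    show "L (W 0 0) = 0" by (simp add: W0)
    fix n
    have cL: "continuous_on {0..1} (\<lambda>t. L (W n t))" "continuous_on {0..1} (\<lambda>t. L (W1 n t))"
      by (intro continuous_on cW)+
    have dL: "((\<lambda>t. L (W n t)) has_real_derivative L (W1 n t)) (at t)"
      "((\<lambda>t. L (W1 n t)) has_real_derivative (P n t - lam) * L (W n t)) (at t)" if t: "t \<in> {0<..<1}" for t
    proof -
      have t': "t + n \<in> {real n<..<real n + 1}" using t by auto
      have "((\<lambda>t. L (Y n t)) has_real_derivative L (Y1 n (t + n))) (at (t + n))"
        using has_vector_derivative[OF dY(1)[OF t']] by (simp add: has_real_derivative_iff_has_vector_derivative)
      then show "((\<lambda>t. L (W n t)) has_real_derivative L (W1 n t)) (at t)"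
        by (simp add: W_def W1_def DERIV_shift)
      have "((\<lambda>t. L (Y1 n t)) has_real_derivative (P n t - lam) * L (Y n (t + n))) (at (t + n))"
        using has_vector_derivative[OF dY(2)[OF t']] unfolding L(2) by (simp add: has_real_derivative_iff_has_vector_derivative)
      then show "((\<lambda>t. L (W1 n t)) has_real_derivative (P n t - lam) * L (W n t)) (at t)"
        by (simp add: W_def W1_def DERIV_shift)
    qed
    show "cell_ode (\<lambda>t. L (W n t)) (\<lambda>t. L (W1 n t)) (\<lambda>t. (P n t - lam) * L (W n t))"
      unfolding cell_ode_def using cL dL by blast
    show "L (W (Suc n) 0) = sqrt (real b) * L (W n 1)" unfolding WS L(2) ..
    show "L (W1 (Suc n) 0) = L (W1 n 1) / sqrt (real b)" unfolding WS L(2) by simp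
  next
    interpret bounded_linear L by fact
    have nn: "0 \<le> integral {0..1} (\<lambda>t. (L (W n t))\<^sup>2)" for n
      by (intro integral_nonneg integrable_continuous_real continuous_intros continuous_on cW) auto
    have le: "ennreal (integral {0..1} (\<lambda>t. (L (W n t))\<^sup>2)) \<le>
      (\<integral>\<^sup>+t\<in>{real n<..<real n + 1}. ennreal ((norm (y2 t))\<^sup>2 + (norm (y t))\<^sup>2) \<partial>lborel)" for n
    proof -
      have cLY: "continuous_on {real n..real n+1} (\<lambda>t. (L (Y n t))\<^sup>2)"
        by (intro continuous_intros continuous_on cY)
      have "integral {0..1} (\<lambda>t. (L (W n t))\<^sup>2) = integral {real n..real n+1} (\<lambda>t. (L (Y n t))\<^sup>2)"
        using integral_shift_real_ivl[of "real n" "real n" "real n + 1" "\<lambda>t. (L (Y n t))\<^sup>2"] by (simp add: W_def)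
      also have "ennreal \<dots> = (\<integral>\<^sup>+t\<in>{real n..real n + 1}. ennreal ((L (Y n t))\<^sup>2) \<partial>lborel)"
        by (rule nn_integral_has_integral_lebesgue'[symmetric])
           (auto intro!: integrable_integral integrable_continuous_real cLY)
      also have "\<dots> \<le> (\<integral>\<^sup>+t\<in>{real n<..<real n + 1}. ennreal ((norm (y2 t))\<^sup>2 + (norm (y t))\<^sup>2) \<partial>lborel)"
      proof (rule nn_integral_mono_AE)
        \<comment> \<open>\<open>Y n\<close> is known to agree with \<open>y\<close> only inside the
          cell; the two end points form a null set.\<close>
        have "AE t in lborel. t \<noteq> real n \<and> t \<noteq> real n + 1"
          using AE_lborel_singleton[of "real n"] AE_lborel_singleton[of "real n + 1"] by eventually_elim auto
        then show "AE t in lborel. ennreal ((L (Y n t))\<^sup>2) * indicator {real n..real n + 1} t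
          \<le> ennreal ((norm (y2 t))\<^sup>2 + (norm (y t))\<^sup>2) * indicator {real n<..<real n + 1} t"
        proof eventually_elim
          case (elim t)
          show ?case
          proof (cases "t \<in> {real n<..<real n + 1}")
            case True
            have "(L (Y n t))\<^sup>2 \<le> (norm (y t))\<^sup>2"
              using L(3)[of "Y n t"] Y(1)[OF True] by (subst abs_le_square_iff[symmetric]) simp
            then show ?thesis using True by (simp add: ennreal_leI add_increasing)
          next
            case False
            then have "t \<notin> {real n..real n + 1}" using elim by auto
            then show ?thesis by simp
          qed
        qed
      qed
      finally show ?thesis .
    qed
    have "(\<Sum>n. ennreal (integral {0..1} (\<lambda>t. (L (W n t))\<^sup>2))) \<le>
      (\<Sum>n. \<integral>\<^sup>+t\<in>{real n<..<real n + 1}. ennreal ((norm (y2 t))\<^sup>2 + (norm (y t))\<^sup>2) \<partial>lborel)"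
      by (intro suminf_le le) auto
    then have "(\<Sum>n. ennreal (integral {0..1} (\<lambda>t. (L (W n t))\<^sup>2))) \<noteq> top"
      using fin by (auto simp: top_unique)
    then show "summable (\<lambda>n. integral {0..1} (\<lambda>t. (L (W n t))\<^sup>2))"
      by (rule summable_suminf_not_top[OF nn])
  qed
  show thesis
  proof (rule that)
    show "W n t = y (real n + t)" if "0 < t" "t < 1" for n t
      using Y(1)[of "t + n" n] that by (simp add: W_def add.commute)
    show "eigsol b P lam (\<lambda>n t. Re (W n t)) (\<lambda>n t. Re (W1 n t))"
      by (rule part) (auto simp: bounded_linear_Re abs_Re_le_cmod)
    show "eigsol b P lam (\<lambda>n t. Im (W n t)) (\<lambda>n t. Im (W1 n t))"
      by (rule part) (auto simp: bounded_linear_Im abs_Im_le_cmod)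
  qed
qed

section \<open>The gaps\<close>

lemma tree_R_gt_1:
  assumes "b \<ge> 2" shows "tree_R b > 1"
proof -
  define r where "r = sqrt (real b)"
  have r: "r > 1" using assms by (simp add: r_def)
  have "0 < (r - 1)\<^sup>2" using r by simp
  then have "2 * r < r\<^sup>2 + 1" by (simp add: power2_diff)
  then show ?thesis using r unfolding tree_R_def r_def[symmetric] by (simp add: field_simps power2_eq_square)
qed

lemma tree_theta_props:
  assumes "b \<ge> 2"
  shows "cos (tree_theta b) = 1 / tree_R b" "0 < tree_theta b" "tree_theta b < pi / 2"
proof -
  have R: "0 < 1 / tree_R b" "1 / tree_R b < 1" using tree_R_gt_1[OF assms] by auto
  show "cos (tree_theta b) = 1 / tree_R b" unfolding tree_theta_def using R by (intro cos_arccos) linarith+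
  show "0 < tree_theta b" unfolding tree_theta_def using R by (intro arccos_lt_bounded[THEN conjunct1]) linarith+
  show "tree_theta b < pi / 2" using R arccos_less_arccos[of 0 "1 / tree_R b"] by (simp add: tree_theta_def)
qed

lemma trig_solutions:
  assumes "\<omega> > (0::real)"
  shows "((\<lambda>t. sin (\<omega> * t) / \<omega>) has_real_derivative cos (\<omega> * t)) (at t)"
    "((\<lambda>t. cos (\<omega> * t)) has_real_derivative - \<omega>\<^sup>2 * (sin (\<omega> * t) / \<omega>)) (at t)"
    "t \<in> {0..1} \<Longrightarrow> \<bar>sin (\<omega> * t) / \<omega>\<bar> \<le> 1"
proof -
  show "((\<lambda>t. sin (\<omega> * t) / \<omega>) has_real_derivative cos (\<omega> * t)) (at t)"
    using assms by (auto intro!: derivative_eq_intros)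
  show "((\<lambda>t. cos (\<omega> * t)) has_real_derivative - \<omega>\<^sup>2 * (sin (\<omega> * t) / \<omega>)) (at t)"
    using assms by (auto intro!: derivative_eq_intros simp: power2_eq_square)
  assume "t \<in> {0..1}"
  then have "\<bar>sin (\<omega> * t)\<bar> \<le> \<omega> * 1"
  proof -
    have "\<bar>sin (\<omega> * t)\<bar> \<le> \<bar>\<omega> * t\<bar>" by (rule abs_sin_x_le_abs_x)
    also have "\<dots> \<le> \<omega> * 1" using \<open>t \<in> {0..1}\<close> assms by (simp add: abs_mult mult_left_le)
    finally show ?thesis .
  qed
  then show "\<bar>sin (\<omega> * t) / \<omega>\<bar> \<le> 1" using assms by (simp add: abs_divide)
qed

text \<open>In a closed gap \<open>|cos \<omega>| \<ge> 1 / R\<close> for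
  \<open>\<beta> = \<omega>^2\<close>, with \<open>cosh\<close> in place of \<open>cos\<close> for
  negative \<beta>. The work lies in constants uniform over \<open>I\<close>. For
  \<open>l \<ge> 1\<close> the sign \<sigma> is constant because an interval that avoids
  \<open>(\<pi> l)^2\<close> stays on one side of it.\<close>

lemma gap_solutions:
  fixes I :: "real set"
  assumes b: "b \<ge> 2" and I: "compact I" "is_interval I"
    and l0: "l = 0 \<Longrightarrow> I \<subseteq> closure (gap b 0)"
    and l1: "l \<ge> 1 \<Longrightarrow> I \<subseteq> closure (gap b l) - {(pi * real l)\<^sup>2}"
  obtains S m \<sigma> :: real where "S \<ge> 1" "m > 0" "\<sigma> = 1 \<or> \<sigma> = - 1"
    "\<And>\<beta>. \<beta> \<in> I \<Longrightarrow> \<exists>s c. (\<forall>t. (s has_real_derivative c t) (at t)) \<and> s 0 = 0 \<and>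
      (\<forall>t. (c has_real_derivative - \<beta> * s t) (at t)) \<and> c 0 = 1 \<and>
      (\<forall>t\<in>{0..1}. \<bar>s t\<bar> \<le> S) \<and> (\<forall>t\<in>{0..1}. \<bar>c t\<bar> \<le> S) \<and>
      m \<le> \<bar>s 1\<bar> \<and> 1 \<le> tree_R b * \<bar>c 1\<bar> \<and> \<sigma> = sgn (s 1 * c 1)"
proof (cases "l = 0")
  case True
  define R where "R = tree_R b"
  define \<theta> where "\<theta> = tree_theta b"
  have R: "R > 1" using tree_R_gt_1[OF b] by (simp add: R_def)
  have \<theta>: "cos \<theta> = 1 / R" "0 < \<theta>" "\<theta> < pi / 2" using tree_theta_props[OF b] by (auto simp: \<theta>_def R_def)
  have sub: "I \<subseteq> {..\<theta>\<^sup>2}" using l0[OF True] by (simp add: gap_def \<theta>_def)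
  obtain B where B: "B > 0" "\<And>\<beta>. \<beta> \<in> I \<Longrightarrow> \<bar>\<beta>\<bar> \<le> B"
    using compact_imp_bounded[OF I(1)] unfolding bounded_pos by auto
  \<comment> \<open>\<open>I\<close> may extend far below 0, where the solutions are hyperbolic; the
    bound \<open>B\<close> for \<open>I\<close> limits their growth on a cell.\<close>
  define S where "S = cosh (sqrt B)"
  have S: "S \<ge> 1" using cosh_real_ge_1 by (simp add: S_def)
  show thesis
  proof (rule that[of S "1 / R" 1])
    fix \<beta> assume \<beta>: "\<beta> \<in> I"
    show "\<exists>s c. (\<forall>t. (s has_real_derivative c t) (at t)) \<and> s 0 = 0 \<and>
      (\<forall>t. (c has_real_derivative - \<beta> * s t) (at t)) \<and> c 0 = 1 \<and>
      (\<forall>t\<in>{0..1}. \<bar>s t\<bar> \<le> S) \<and> (\<forall>t\<in>{0..1}. \<bar>c t\<bar> \<le> S) \<and>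
      1 / R \<le> \<bar>s 1\<bar> \<and> 1 \<le> tree_R b * \<bar>c 1\<bar> \<and> 1 = sgn (s 1 * c 1)"
    proof (cases \<beta> "0::real" rule: linorder_cases)
      case greater
      define \<omega> where "\<omega> = sqrt \<beta>"
      have \<omega>: "\<omega> > 0" "\<omega>\<^sup>2 = \<beta>" using greater by (auto simp: \<omega>_def)
      have "\<omega> \<le> \<theta>" unfolding \<omega>_def using sub \<beta> \<theta> greater by (intro real_le_lsqrt) auto
      then have cos\<omega>: "cos \<omega> \<ge> 1 / R" using \<omega> \<theta> cos_monotone_0_pi_le[of \<omega> \<theta>] by simp
      \<comment> \<open>By the mean value theorem \<open>sin \<omega> / \<omega>\<close> is a cosine
        at a point below \<open>\<omega> \<le> \<theta>\<close>, so it inherits the lower bound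
        \<open>1 / R\<close>.\<close>
      obtain \<xi> where \<xi>: "0 < \<xi>" "\<xi> < \<omega>" "sin \<omega> - sin 0 = (\<omega> - 0) * cos \<xi>"
        using MVT2[of 0 \<omega> sin cos] \<omega> DERIV_sin by blast
      have "cos \<xi> \<ge> cos \<omega>" using \<xi> \<open>\<omega> \<le> \<theta>\<close> \<theta> by (intro cos_monotone_0_pi_le) auto
      then have s1: "sin \<omega> / \<omega> \<ge> 1 / R" using \<xi> \<omega> cos\<omega> by simp
      have pos: "sin \<omega> / \<omega> > 0" "cos \<omega> > 0" using s1 cos\<omega> R by (auto intro: less_le_trans[of 0 "1 / R"])
      show ?thesis
      proof (rule exI[of _ "\<lambda>t. sin (\<omega> * t) / \<omega>"], rule exI[of _ "\<lambda>t. cos (\<omega> * t)"], intro conjI allI ballI)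
        fix t :: real assume t: "t \<in> {0..1}"
        show "\<bar>sin (\<omega> * t) / \<omega>\<bar> \<le> S" using trig_solutions(3)[OF \<omega>(1) t] S by linarith
        show "\<bar>cos (\<omega> * t)\<bar> \<le> S" using abs_cos_le_one[of "\<omega> * t"] S by linarith
      next
        have "1 \<le> R * cos \<omega>" using cos\<omega> R by (simp add: field_simps)
        then show "1 \<le> tree_R b * \<bar>cos (\<omega> * 1)\<bar>" using pos by (simp add: R_def)
        show "1 = sgn (sin (\<omega> * 1) / \<omega> * cos (\<omega> * 1))" using mult_pos_pos[OF pos] by (simp only: mult_1_right sgn_pos)
        show "1 / R \<le> \<bar>sin (\<omega> * 1) / \<omega>\<bar>"
          unfolding mult_1_right using s1 abs_ge_self[of "sin \<omega> / \<omega>"] by linarith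
      qed (use trig_solutions[OF \<omega>(1)] \<omega> in auto)
    next
      case equal
      then show ?thesis
        using S R by - (rule exI[of _ "\<lambda>t. t"], rule exI[of _ "\<lambda>t. 1"],
          auto simp: R_def[symmetric] intro!: derivative_eq_intros)
    next
      case less
      define k where "k = sqrt (- \<beta>)"
      have k: "k > 0" "k\<^sup>2 = - \<beta>" using less by (auto simp: k_def)
      have "k \<le> sqrt B" unfolding k_def using B(2)[OF \<beta>] by simp
      then have ck: "cosh k \<le> S" unfolding S_def using k B by (subst cosh_real_nonneg_le_iff) auto
      have sinh: "x * 1 \<le> sinh x \<and> sinh x \<le> x * cosh k" if x: "0 < x" "x \<le> k" for x
      proof -
        have "(sinh has_real_derivative cosh y) (at y)" for y :: real
          by (auto intro!: derivative_eq_intros)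
        then obtain \<xi> where \<xi>: "0 < \<xi>" "\<xi> < x" "sinh x - sinh 0 = (x - 0) * cosh \<xi>"
          using MVT2[of 0 x sinh cosh] x by blast
        have "1 \<le> cosh \<xi>" by (rule cosh_real_ge_1)
        moreover have "cosh \<xi> \<le> cosh k" using \<xi> x k by (subst cosh_real_nonneg_le_iff) auto
        ultimately show ?thesis using \<xi> x by (auto intro!: mult_left_mono)
      qed
      have s1: "sinh k / k \<ge> 1" using sinh[of k] k by simp
      show ?thesis
      proof (rule exI[of _ "\<lambda>t. sinh (k * t) / k"], rule exI[of _ "\<lambda>t. cosh (k * t)"], intro conjI allI ballI)
        fix t
        show "((\<lambda>t. sinh (k * t) / k) has_real_derivative cosh (k * t)) (at t)"
          using k by (auto intro!: derivative_eq_intros)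
        have "\<beta> = - k\<^sup>2" using k by simp
        then show "((\<lambda>t. cosh (k * t)) has_real_derivative - \<beta> * (sinh (k * t) / k)) (at t)"
          using k by (auto intro!: derivative_eq_intros simp: power2_eq_square)
      next
        fix t :: real assume t: "t \<in> {0..1}"
        have kt: "0 \<le> k * t" "k * t \<le> k" using t k by (auto simp: mult_left_le)
        have "cosh (k * t) \<le> cosh k" using kt k by (subst cosh_real_nonneg_le_iff) auto
        then show "\<bar>cosh (k * t)\<bar> \<le> S" using ck cosh_real_ge_1[of "k * t"] by simp
        have "0 \<le> sinh (k * t) \<and> sinh (k * t) \<le> k * S"
        proof (cases "t = 0")
          case True
          then show ?thesis using k S by simp
        next
          case False
          then have "0 < k * t" using t k by simp
          then have "k * t * 1 \<le> sinh (k * t)" "sinh (k * t) \<le> (k * t) * cosh k" using sinh[of "k * t"] kt by auto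
          moreover have "(k * t) * cosh k \<le> k * S"
            using kt k ck cosh_real_ge_1[of k] by (intro mult_mono) auto
          ultimately show ?thesis using kt by linarith
        qed
        then show "\<bar>sinh (k * t) / k\<bar> \<le> S" using k by (simp add: field_simps)
      next
        have "1 / R \<le> 1" using R by simp
        then show "1 / R \<le> \<bar>sinh (k * 1) / k\<bar>"
          unfolding mult_1_right using s1 abs_ge_self[of "sinh k / k"] by linarith
        have "1 * 1 \<le> R * cosh k" using R cosh_real_ge_1[of k] by (intro mult_mono) auto
        then show "1 \<le> tree_R b * \<bar>cosh (k * 1)\<bar>" by (simp add: R_def)
        have "0 < sinh k / k * cosh k" using s1 cosh_real_ge_1[of k] by (intro mult_pos_pos) linarith+
        then show "1 = sgn (sinh (k * 1) / k * cosh (k * 1))" by (simp only: mult_1_right sgn_pos)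
      qed auto
    qed
  qed (use S R in auto)
next
  case False
  then have l: "l \<ge> 1" by simp
  define R where "R = tree_R b"
  define \<theta> where "\<theta> = tree_theta b"
  have R: "R > 1" using tree_R_gt_1[OF b] by (simp add: R_def)
  have \<theta>: "cos \<theta> = 1 / R" "0 < \<theta>" "\<theta> < pi / 2" using tree_theta_props[OF b] by (auto simp: \<theta>_def R_def)
  have pl: "pi * 1 \<le> pi * real l" using l by (intro mult_left_mono) auto
  then have A: "0 < pi * real l - \<theta>" using \<theta> pi_gt_zero by linarith
  have "closure (gap b l) \<subseteq> {(pi * real l - \<theta>)\<^sup>2..(pi * real l + \<theta>)\<^sup>2}"
    using l by (intro closure_minimal) (auto simp: gap_def \<theta>_def)
  then have sub: "I \<subseteq> {(pi * real l - \<theta>)\<^sup>2..(pi * real l + \<theta>)\<^sup>2}" and ne: "(pi * real l)\<^sup>2 \<notin> I"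
    using l1[OF l] by auto
  have pos: "\<beta> > 0" if "\<beta> \<in> I" for \<beta>
  proof -
    have "0 < (pi * real l - \<theta>)\<^sup>2" using A by simp
    also have "\<dots> \<le> \<beta>" using sub that by auto
    finally show ?thesis .
  qed
  \<comment> \<open>The offset from \<pi> l on the scale of \<open>sqrt \<beta>\<close>. On
    \<open>I\<close> it lies in \<open>[- \<theta>, \<theta>]\<close> and avoids 0; the factors
    \<open>(- 1) ^ l\<close> that the shift splits off from sine and cosine cancel in their
    product.\<close>
  define \<delta> where "\<delta> \<beta> = sqrt \<beta> - pi * real l" for \<beta>
  have \<delta>: "\<bar>\<delta> \<beta>\<bar> \<le> \<theta>" "\<delta> \<beta> \<noteq> 0" if \<beta>: "\<beta> \<in> I" for \<beta>
  proof -
    have "pi * real l - \<theta> \<le> sqrt \<beta>" using sub \<beta> A by (intro real_le_rsqrt) auto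
    moreover have "sqrt \<beta> \<le> pi * real l + \<theta>" using sub \<beta> A \<theta> pos[OF \<beta>] by (intro real_le_lsqrt) auto
    ultimately show "\<bar>\<delta> \<beta>\<bar> \<le> \<theta>" by (simp add: \<delta>_def abs_le_iff)
    show "\<delta> \<beta> \<noteq> 0"
    proof
      assume "\<delta> \<beta> = 0"
      then have "sqrt \<beta> = pi * real l" by (simp add: \<delta>_def)
      then have "\<beta> = (pi * real l)\<^sup>2" using pos[OF \<beta>] by (metis less_imp_le real_sqrt_pow2)
      then show False using ne \<beta> by simp
    qed
  qed
  have trig: "sin (sqrt \<beta>) = (- 1) ^ l * sin (\<delta> \<beta>)" "cos (sqrt \<beta>) = (- 1) ^ l * cos (\<delta> \<beta>)" for \<beta>
  proof -
    have "sqrt \<beta> = \<delta> \<beta> + real l * pi" by (simp add: \<delta>_def)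
    then show "sin (sqrt \<beta>) = (- 1) ^ l * sin (\<delta> \<beta>)" "cos (sqrt \<beta>) = (- 1) ^ l * cos (\<delta> \<beta>)"
      by (simp_all add: sin_add cos_add)
  qed
  have cos\<delta>: "1 / R \<le> cos (\<delta> \<beta>)" if "\<beta> \<in> I" for \<beta>
    using cos_monotone_0_pi_le[of "\<bar>\<delta> \<beta>\<bar>" \<theta>] \<delta>(1)[OF that] \<theta> by simp
  have sin\<delta>: "sgn (sin (\<delta> \<beta>)) = sgn (\<delta> \<beta>)" if "\<beta> \<in> I" for \<beta>
  proof (cases "\<delta> \<beta> > 0")
    case True
    then have "sin (\<delta> \<beta>) > 0" using \<delta>(1)[OF that] \<theta> by (intro sin_gt_zero) auto
    then show ?thesis using True by simp
  next
    case False
    then have "sin (- \<delta> \<beta>) > 0" using \<delta>[OF that] \<theta> by (intro sin_gt_zero) auto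
    then show ?thesis using False \<delta>(2)[OF that] by simp
  qed
  obtain \<sigma> :: real where \<sigma>: "\<sigma> = 1 \<or> \<sigma> = - 1" "\<And>\<beta>. \<beta> \<in> I \<Longrightarrow> sgn (\<delta> \<beta>) = \<sigma>"
  proof -
    have sg: "sgn (\<delta> \<beta>) = (if (pi * real l)\<^sup>2 < \<beta> then 1 else - 1)" if \<beta>: "\<beta> \<in> I" for \<beta>
    proof -
      have "(pi * real l)\<^sup>2 < \<beta> \<longleftrightarrow> \<delta> \<beta> > 0"
        using pl pi_gt_zero real_sqrt_less_iff[of "(pi * real l)\<^sup>2" \<beta>] by (simp add: \<delta>_def)
      then show ?thesis using \<delta>(2)[OF \<beta>] by (simp add: sgn_if)
    qed
    show ?thesis
    proof (cases "\<exists>\<beta>\<in>I. (pi * real l)\<^sup>2 < \<beta>")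
      case True
      then obtain \<beta>0 where \<beta>0: "\<beta>0 \<in> I" "(pi * real l)\<^sup>2 < \<beta>0" by blast
      have "(pi * real l)\<^sup>2 < \<beta>" if "\<beta> \<in> I" for \<beta>
      proof (rule ccontr)
        assume "\<not> (pi * real l)\<^sup>2 < \<beta>"
        then have "(pi * real l)\<^sup>2 \<in> I" using mem_is_interval_1_I[OF I(2) that \<beta>0(1)] \<beta>0(2) by simp
        then show False using ne by simp
      qed
      then show ?thesis using that[of 1] sg by simp
    next
      case False
      then show ?thesis using that[of "-1"] sg by simp
    qed
  qed
  \<comment> \<open>A continuous positive function attains its minimum on the compact set
    \<open>I\<close>; for empty \<open>I\<close> any positive number serves.\<close>
  obtain m where m: "m > 0" "\<And>\<beta>. \<beta> \<in> I \<Longrightarrow> m \<le> \<bar>sin (sqrt \<beta>) / sqrt \<beta>\<bar>"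
  proof (cases "I = {}")
    case False
    have "continuous_on I (\<lambda>\<beta>. \<bar>sin (sqrt \<beta>) / sqrt \<beta>\<bar>)"
      using pos by (intro continuous_intros) auto
    then obtain \<beta>0 where \<beta>0: "\<beta>0 \<in> I" "\<And>\<beta>. \<beta> \<in> I \<Longrightarrow> \<bar>sin (sqrt \<beta>0) / sqrt \<beta>0\<bar> \<le> \<bar>sin (sqrt \<beta>) / sqrt \<beta>\<bar>"
      using continuous_attains_inf[OF I(1) False] by blast
    have "sin (sqrt \<beta>0) \<noteq> 0"
      using sin\<delta>[OF \<beta>0(1)] \<delta>(2)[OF \<beta>0(1)] unfolding trig by (auto simp: sgn_if split: if_splits)
    then have "\<bar>sin (sqrt \<beta>0) / sqrt \<beta>0\<bar> > 0" using pos[OF \<beta>0(1)] by simp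
    then show ?thesis using that \<beta>0(2) by blast
  qed (use that[of 1] in auto)
  show thesis
  proof (rule that[of 1 m \<sigma>])
    fix \<beta> assume \<beta>: "\<beta> \<in> I"
    define \<omega> where "\<omega> = sqrt \<beta>"
    have \<omega>: "\<omega> > 0" "\<omega>\<^sup>2 = \<beta>" using pos[OF \<beta>] by (auto simp: \<omega>_def)
    have one: "(- 1) ^ l * ((- 1) ^ l) = (1::real)" by (simp flip: power_mult_distrib)
    have c0: "cos (\<delta> \<beta>) > 0" using cos\<delta>[OF \<beta>] R by (auto intro: less_le_trans[of 0 "1 / R"])
    show "\<exists>s c. (\<forall>t. (s has_real_derivative c t) (at t)) \<and> s 0 = 0 \<and>
      (\<forall>t. (c has_real_derivative - \<beta> * s t) (at t)) \<and> c 0 = 1 \<and>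
      (\<forall>t\<in>{0..1}. \<bar>s t\<bar> \<le> 1) \<and> (\<forall>t\<in>{0..1}. \<bar>c t\<bar> \<le> 1) \<and>
      m \<le> \<bar>s 1\<bar> \<and> 1 \<le> tree_R b * \<bar>c 1\<bar> \<and> \<sigma> = sgn (s 1 * c 1)"
    proof (rule exI[of _ "\<lambda>t. sin (\<omega> * t) / \<omega>"], rule exI[of _ "\<lambda>t. cos (\<omega> * t)"], intro conjI allI ballI)
      show "m \<le> \<bar>sin (\<omega> * 1) / \<omega>\<bar>" using m(2)[OF \<beta>] by (simp add: \<omega>_def)
      show "1 \<le> tree_R b * \<bar>cos (\<omega> * 1)\<bar>"
        using cos\<delta>[OF \<beta>] R c0 by (simp add: \<omega>_def trig abs_mult R_def[symmetric] field_simps)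
      have "sgn (sin (\<omega> * 1) / \<omega> * cos (\<omega> * 1)) = sgn ((((- 1) ^ l * ((- 1) ^ l)) * sin (\<delta> \<beta>) * cos (\<delta> \<beta>)) / \<omega>)"
        unfolding \<omega>_def mult_1_right trig by (simp only: times_divide_eq_left times_divide_eq_right ac_simps)
      also have "\<dots> = sgn (sin (\<delta> \<beta>) * cos (\<delta> \<beta>) / \<omega>)" unfolding one by simp
      also have "\<dots> = \<sigma>"
        using \<omega> c0 by (simp add: sgn_mult sgn_divide sin\<delta>[OF \<beta>] \<sigma>(2)[OF \<beta>])
      finally show "\<sigma> = sgn (sin (\<omega> * 1) / \<omega> * cos (\<omega> * 1))" by simp
    qed (use trig_solutions[OF \<omega>(1)] \<omega> in auto)
  qed (use m \<sigma> in auto)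
qed

lemma gap_tail_coercive:
  fixes I :: "real set"
  assumes b: "b \<ge> 2" and I: "compact I" "is_interval I"
    and l0: "l = 0 \<Longrightarrow> I \<subseteq> closure (gap b 0)"
    and l1: "l \<ge> 1 \<Longrightarrow> I \<subseteq> closure (gap b l) - {(pi * real l)\<^sup>2}"
    and \<rho>: "0 < \<rho>" "\<rho> < 1"
  obtains \<sigma> \<epsilon> K m where "\<sigma> = 1 \<or> \<sigma> = - 1" "0 < \<epsilon>" "0 < K" "\<And>\<beta>. \<beta> \<in> I \<Longrightarrow> tail_coercive b \<rho> \<epsilon> K m \<sigma> \<beta>"
proof -
  obtain S m \<sigma> :: real where S: "S \<ge> 1" "m > 0" "\<sigma> = 1 \<or> \<sigma> = - 1"
    and sol: "\<And>\<beta>. \<beta> \<in> I \<Longrightarrow> \<exists>s c. (\<forall>t. (s has_real_derivative c t) (at t)) \<and> s 0 = 0 \<and>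
      (\<forall>t. (c has_real_derivative - \<beta> * s t) (at t)) \<and> c 0 = 1 \<and>
      (\<forall>t\<in>{0..1}. \<bar>s t\<bar> \<le> S) \<and> (\<forall>t\<in>{0..1}. \<bar>c t\<bar> \<le> S) \<and>
      m \<le> \<bar>s 1\<bar> \<and> 1 \<le> tree_R b * \<bar>c 1\<bar> \<and> \<sigma> = sgn (s 1 * c 1)"
    by (rule gap_solutions[OF b I l0 l1]) blast+
  have b1: "b \<ge> 1" using b by simp
  show thesis
  proof (rule tail_estimate[OF b1 \<rho> S(2,1)])
    fix \<epsilon> K :: real
    assume \<epsilon>: "0 < \<epsilon>" "0 < K"
      and est: "\<And>\<beta> s c. (\<And>t. (s has_real_derivative c t) (at t)) \<Longrightarrow> s 0 = 0 \<Longrightarrow>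
     (\<And>t. (c has_real_derivative - \<beta> * s t) (at t)) \<Longrightarrow> c 0 = 1 \<Longrightarrow>
     (\<And>t. t \<in> {0..1} \<Longrightarrow> \<bar>s t\<bar> \<le> S) \<Longrightarrow> (\<And>t. t \<in> {0..1} \<Longrightarrow> \<bar>c t\<bar> \<le> S) \<Longrightarrow>
     m \<le> \<bar>s 1\<bar> \<Longrightarrow> 1 \<le> tree_R b * \<bar>c 1\<bar> \<Longrightarrow> tail_coercive b \<rho> \<epsilon> K m (sgn (s 1 * c 1)) \<beta>"
    show thesis
    proof (rule that[OF S(3) \<epsilon>])
      fix \<beta> assume "\<beta> \<in> I"
      then obtain s c where sc: "\<forall>t. (s has_real_derivative c t) (at t)" "s 0 = 0"
        "\<forall>t. (c has_real_derivative - \<beta> * s t) (at t)" "c 0 = 1"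
        "\<forall>t\<in>{0..1}. \<bar>s t\<bar> \<le> S" "\<forall>t\<in>{0..1}. \<bar>c t\<bar> \<le> S"
        "m \<le> \<bar>s 1\<bar>" "1 \<le> tree_R b * \<bar>c 1\<bar>" and \<sigma>: "\<sigma> = sgn (s 1 * c 1)"
        using sol by blast
      show "tail_coercive b \<rho> \<epsilon> K m \<sigma> \<beta>"
        unfolding \<sigma> by (rule est) (use sc in auto)
    qed
  qed
qed

section \<open>Counting eigenvalues\<close>

text \<open>Gaussian elimination: a pivot \<open>k\<close> in row \<open>i\<close> removes one
  unknown along with one equation, which preserves the strict inequality of cardinalities; a zero
  row is dropped.\<close>

lemma homogeneous_system_solution:
  fixes a :: "'i \<Rightarrow> 'j \<Rightarrow> 'k::field"
  assumes "finite I" "finite J" "card I < card J"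
  shows "\<exists>c. (\<exists>j\<in>J. c j \<noteq> 0) \<and> (\<forall>i\<in>I. (\<Sum>j\<in>J. a i j * c j) = 0)"
  using assms
proof (induction I arbitrary: J a rule: finite_induct)
  case empty
  then have "J \<noteq> {}" by auto
  then show ?case by (intro exI[of _ "\<lambda>_. 1"]) auto
next
  case (insert i I)
  show ?case
  proof (cases "\<forall>j\<in>J. a i j = 0")
    case True
    have "card I < card J" using insert by simp
    from insert.IH[OF insert.prems(1) this, of a] obtain c
      where "\<exists>j\<in>J. c j \<noteq> 0" "\<forall>i\<in>I. (\<Sum>j\<in>J. a i j * c j) = 0" by blast
    then show ?thesis using True by (intro exI[of _ c]) auto
  next
    case False
    then obtain k where k: "k \<in> J" "a i k \<noteq> 0" by blast
    define a' where "a' r j = a r j - a r k * a i j / a i k" for r j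
    have "card I < card (J - {k})" using insert k by (simp add: card_Diff_singleton)
    from insert.IH[OF _ this, of a'] insert.prems obtain c
      where c: "\<exists>j\<in>J - {k}. c j \<noteq> 0" "\<forall>r\<in>I. (\<Sum>j\<in>J - {k}. a' r j * c j) = 0" by auto
    define s where "s = (\<Sum>j\<in>J - {k}. a i j * c j)"
    define d where "d = c(k := - s / a i k)"
    have sum: "(\<Sum>j\<in>J. a r j * d j) = a r k * (- s / a i k) + (\<Sum>j\<in>J - {k}. a r j * c j)" for r
      using k insert.prems by (subst sum.remove[of J k]) (auto simp: d_def intro!: sum.cong)
    have "(\<Sum>j\<in>J. a r j * d j) = 0" if "r \<in> I" for r
    proof -
      have "0 = (\<Sum>j\<in>J - {k}. a' r j * c j)" using c that by simp
      also have "\<dots> = (\<Sum>j\<in>J - {k}. a r j * c j) - a r k / a i k * s"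
        unfolding s_def a'_def by (simp add: sum_distrib_left sum_subtractf algebra_simps)
      finally show ?thesis unfolding sum by (simp add: algebra_simps)
    qed
    moreover have "(\<Sum>j\<in>J. a i j * d j) = 0"
      unfolding sum using k by (simp add: s_def)
    moreover have "\<exists>j\<in>J. d j \<noteq> 0" using c(1) by (auto simp: d_def)
    ultimately show ?thesis by (intro exI[of _ d]) auto
  qed
qed

section \<open>Linear combinations of eigensolutions\<close>

lemma eigsol_zero: "eigsol b P lam (\<lambda>n t. 0) (\<lambda>n t. 0)"
  by (simp add: eigsol_def cell_ode_def)

lemma eigsol_scale:
  assumes "eigsol b P lam w w1"
  shows "eigsol b P lam (\<lambda>n t. x * w n t) (\<lambda>n t. x * w1 n t)"
  unfolding eigsol_def
proof (intro conjI allI)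
  show "cell_ode (\<lambda>t. x * w n t) (\<lambda>t. x * w1 n t) (\<lambda>t. (P n t - lam) * (x * w n t))" for n
  proof -
    have "cell_ode (w n) (w1 n) (\<lambda>t. (P n t - lam) * w n t)" using assms by (simp add: eigsol_def)
    then show ?thesis unfolding cell_ode_def
      by (auto intro!: continuous_intros derivative_eq_intros)
  qed
  have "summable (\<lambda>n. x\<^sup>2 * integral {0..1} (\<lambda>t. (w n t)\<^sup>2))"
    using assms by (intro summable_mult) (simp add: eigsol_def)
  then show "summable (\<lambda>n. integral {0..1} (\<lambda>t. (x * w n t)\<^sup>2))" by (simp add: power_mult_distrib)
qed (use assms in \<open>auto simp: eigsol_def\<close>)

lemma eigsol_add:
  assumes w: "eigsol b P lam w w1" and v: "eigsol b P lam v v1"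
  shows "eigsol b P lam (\<lambda>n t. w n t + v n t) (\<lambda>n t. w1 n t + v1 n t)"
  unfolding eigsol_def
proof (intro conjI allI)
  show "cell_ode (\<lambda>t. w n t + v n t) (\<lambda>t. w1 n t + v1 n t) (\<lambda>t. (P n t - lam) * (w n t + v n t))" for n
  proof -
    have "cell_ode (w n) (w1 n) (\<lambda>t. (P n t - lam) * w n t)" "cell_ode (v n) (v1 n) (\<lambda>t. (P n t - lam) * v n t)"
      using w v by (simp_all add: eigsol_def)
    then show ?thesis unfolding cell_ode_def distrib_left
      by (auto intro!: continuous_intros DERIV_add)
  qed
  note c = eigsol_cont[OF w] eigsol_cont[OF v]
  show "summable (\<lambda>n. integral {0..1} (\<lambda>t. (w n t + v n t)\<^sup>2))"
  proof (rule summable_comparison_test'[where N = 0])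
    show "summable (\<lambda>n. 2 * integral {0..1} (\<lambda>t. (w n t)\<^sup>2) + 2 * integral {0..1} (\<lambda>t. (v n t)\<^sup>2))"
      using w v by (intro summable_add summable_mult) (auto simp: eigsol_def)
    fix n
    have "integral {0..1} (\<lambda>t. (w n t + v n t)\<^sup>2) \<le> integral {0..1} (\<lambda>t. 2 * (w n t)\<^sup>2 + 2 * (v n t)\<^sup>2)"
    proof (rule integral_mono_continuous)
      show "(w n t + v n t)\<^sup>2 \<le> 2 * (w n t)\<^sup>2 + 2 * (v n t)\<^sup>2" for t
        using sum_squares_bound[of "w n t" "v n t"] by (simp add: power2_sum)
    qed (intro continuous_intros c)+
    also have "\<dots> = 2 * integral {0..1} (\<lambda>t. (w n t)\<^sup>2) + 2 * integral {0..1} (\<lambda>t. (v n t)\<^sup>2)"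
      by (subst integral_add) (auto intro!: integrable_continuous_real continuous_intros c)
    finally show "norm (integral {0..1} (\<lambda>t. (w n t + v n t)\<^sup>2)) \<le> 2 * integral {0..1} (\<lambda>t. (w n t)\<^sup>2) + 2 * integral {0..1} (\<lambda>t. (v n t)\<^sup>2)"
      using integral_nonneg[of "\<lambda>t. (w n t + v n t)\<^sup>2" "{0..1}"]
      by (simp add: integrable_continuous_real continuous_intros c)
  qed
qed (use w v in \<open>auto simp: eigsol_def distrib_left add_divide_distrib\<close>)

lemma eigsol_sum:
  assumes "finite J" "\<And>j. j \<in> J \<Longrightarrow> eigsol b P lam (w j) (w1 j)"
  shows "eigsol b P lam (\<lambda>n t. \<Sum>j\<in>J. w j n t) (\<lambda>n t. \<Sum>j\<in>J. w1 j n t)"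
  using assms by (induction J rule: finite_induct) (simp_all add: eigsol_zero eigsol_add)

text \<open>The real and imaginary parts of \<open>W * c\<close> are real combinations of those of
  \<open>W\<close>, so complex coefficients can be handled although \<open>eigsol\<close> is about
  real functions.\<close>

lemma eigsol_complex_combination:
  fixes W W1 :: "'j \<Rightarrow> nat \<Rightarrow> real \<Rightarrow> complex"
  assumes J: "finite J"
    and re: "\<And>j. j \<in> J \<Longrightarrow> eigsol b P lam (\<lambda>n t. Re (W j n t)) (\<lambda>n t. Re (W1 j n t))"
    and im: "\<And>j. j \<in> J \<Longrightarrow> eigsol b P lam (\<lambda>n t. Im (W j n t)) (\<lambda>n t. Im (W1 j n t))"
  shows "eigsol b P lam (\<lambda>n t. Re (\<Sum>j\<in>J. W j n t * c j)) (\<lambda>n t. Re (\<Sum>j\<in>J. W1 j n t * c j))"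
    and "eigsol b P lam (\<lambda>n t. Im (\<Sum>j\<in>J. W j n t * c j)) (\<lambda>n t. Im (\<Sum>j\<in>J. W1 j n t * c j))"
proof -
  have "eigsol b P lam (\<lambda>n t. \<Sum>j\<in>J. Re (c j) * Re (W j n t) + (- Im (c j)) * Im (W j n t))
     (\<lambda>n t. \<Sum>j\<in>J. Re (c j) * Re (W1 j n t) + (- Im (c j)) * Im (W1 j n t))"
    by (intro eigsol_sum J eigsol_add eigsol_scale re im)
  then show "eigsol b P lam (\<lambda>n t. Re (\<Sum>j\<in>J. W j n t * c j)) (\<lambda>n t. Re (\<Sum>j\<in>J. W1 j n t * c j))"
    by (simp add: algebra_simps)
  have "eigsol b P lam (\<lambda>n t. \<Sum>j\<in>J. Re (c j) * Im (W j n t) + Im (c j) * Re (W j n t))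
     (\<lambda>n t. \<Sum>j\<in>J. Re (c j) * Im (W1 j n t) + Im (c j) * Re (W1 j n t))"
    by (intro eigsol_sum J eigsol_add eigsol_scale re im)
  then show "eigsol b P lam (\<lambda>n t. Im (\<Sum>j\<in>J. W j n t * c j)) (\<lambda>n t. Im (\<Sum>j\<in>J. W1 j n t * c j))"
    by (simp add: algebra_simps)
qed

section \<open>From dimension counts to multiplicities\<close>

text \<open>More than \<open>3 * T\<close> eigenfunctions admit a nontrivial complex combination
  that meets all conditions. Its real and imaginary parts meet them too, so the component in each
  eigenspace vanishes, against independence.\<close>

lemma multiplicity_sum_bound:
  fixes \<Lambda> :: "real set" and U :: "real \<Rightarrow> nat \<Rightarrow> real \<Rightarrow> complex" and \<mu> :: "real \<Rightarrow> nat"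
  assumes fin: "finite \<Lambda>" and sub: "\<Lambda> \<subseteq> {\<alpha><..<\<gamma>}"
    and PV: "\<And>n t. 0 < t \<Longrightarrow> t < 1 \<Longrightarrow> P n t = V (real n + t)" and P: "\<And>n. continuous_on {0..1} (P n)"
    and eig: "\<And>l i. l \<in> \<Lambda> \<Longrightarrow> i < \<mu> l \<Longrightarrow> A_graph b V (U l i) (\<lambda>t. of_real l * U l i t)"
    and ind: "\<And>l c. l \<in> \<Lambda> \<Longrightarrow> AE t in lborel. 0 < t \<longrightarrow> (\<Sum>i<\<mu> l. c i * U l i t) = 0 \<Longrightarrow> \<forall>i<\<mu> l. c i = 0"
    and vanish: "\<And>w w1 l n t. (\<And>l. l \<in> \<Lambda> \<Longrightarrow> eigsol b P l (w l) (w1 l)) \<Longrightarrow>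
      (\<And>n. n < T \<Longrightarrow> (\<Sum>l\<in>\<Lambda>. w l n 0) = 0) \<Longrightarrow> (\<And>n. n < T \<Longrightarrow> (\<Sum>l\<in>\<Lambda>. w1 l n 0) = 0) \<Longrightarrow>
      (\<And>n. n < T \<Longrightarrow> (\<Sum>l\<in>\<Lambda>. w l (Suc n) 0) = 0) \<Longrightarrow> l \<in> \<Lambda> \<Longrightarrow> t \<in> {0..1} \<Longrightarrow> w l n t = (0::real)"
  shows "(\<Sum>l\<in>\<Lambda>. \<mu> l) \<le> 3 * T"
proof (rule ccontr)
  assume neg: "\<not> ?thesis"
  define J where "J = Sigma \<Lambda> (\<lambda>l. {..<\<mu> l})"
  have finJ: "finite J" using fin by (simp add: J_def)
  have "card ({..<T} \<times> {..<3::nat}) < card J"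
    using neg fin by (simp add: J_def card_SigmaI)
  have "\<forall>j\<in>J. \<exists>W W1. (\<forall>n t. 0 < t \<longrightarrow> t < 1 \<longrightarrow> W n t = U (fst j) (snd j) (real n + t)) \<and>
    eigsol b P (fst j) (\<lambda>n t. Re (W n t)) (\<lambda>n t. Re (W1 n t)) \<and>
    eigsol b P (fst j) (\<lambda>n t. Im (W n t)) (\<lambda>n t. Im (W1 n t))"
  proof
    fix j assume "j \<in> J"
    then have "A_graph b V (U (fst j) (snd j)) (\<lambda>t. of_real (fst j) * U (fst j) (snd j) t)"
      using eig by (auto simp: J_def)
    then show "\<exists>W W1. (\<forall>n t. 0 < t \<longrightarrow> t < 1 \<longrightarrow> W n t = U (fst j) (snd j) (real n + t)) \<and>
      eigsol b P (fst j) (\<lambda>n t. Re (W n t)) (\<lambda>n t. Re (W1 n t)) \<and>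
      eigsol b P (fst j) (\<lambda>n t. Im (W n t)) (\<lambda>n t. Im (W1 n t))"
      by (rule A_graph_eigsol[OF _ P PV]) blast+
  qed
  then obtain W W1 where W: "\<And>j n t. j \<in> J \<Longrightarrow> 0 < t \<Longrightarrow> t < 1 \<Longrightarrow> W j n t = U (fst j) (snd j) (real n + t)"
    and re: "\<And>j. j \<in> J \<Longrightarrow> eigsol b P (fst j) (\<lambda>n t. Re (W j n t)) (\<lambda>n t. Re (W1 j n t))"
    and im: "\<And>j. j \<in> J \<Longrightarrow> eigsol b P (fst j) (\<lambda>n t. Im (W j n t)) (\<lambda>n t. Im (W1 j n t))"
    by metis
  \<comment> \<open>The second index selects the kind of condition: 0 for the value and 1 for the
    derivative at the left end of the cell, 2 for the value just behind its right end.\<close>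
  define a where "a r j = (if snd r = 0 then W j (fst r) 0 else if snd r = 1 then W1 j (fst r) 0 else W j (Suc (fst r)) 0)"
    for r :: "nat \<times> nat" and j
  obtain c where c: "\<exists>j\<in>J. c j \<noteq> 0" "\<And>r. r \<in> {..<T} \<times> {..<3::nat} \<Longrightarrow> (\<Sum>j\<in>J. a r j * c j) = 0"
    using homogeneous_system_solution[OF _ finJ \<open>card _ < card J\<close>, of a] by auto
  define v where "v l n t = (\<Sum>i<\<mu> l. W (l, i) n t * c (l, i))" for l n t
  define v1 where "v1 l n t = (\<Sum>i<\<mu> l. W1 (l, i) n t * c (l, i))" for l n t
  have sv: "(\<Sum>l\<in>\<Lambda>. v l n t) = (\<Sum>j\<in>J. W j n t * c j)" "(\<Sum>l\<in>\<Lambda>. v1 l n t) = (\<Sum>j\<in>J. W1 j n t * c j)" for n t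
    unfolding v_def v1_def J_def using fin by (simp_all add: sum.Sigma split_def)
  have con: "(\<Sum>l\<in>\<Lambda>. v l n 0) = 0" "(\<Sum>l\<in>\<Lambda>. v1 l n 0) = 0" "(\<Sum>l\<in>\<Lambda>. v l (Suc n) 0) = 0" if "n < T" for n
    using that c(2)[of "(n, 0)"] c(2)[of "(n, 1)"] c(2)[of "(n, 2)"] unfolding sv by (simp_all add: a_def)
  have sol: "eigsol b P l (\<lambda>n t. Re (v l n t)) (\<lambda>n t. Re (v1 l n t))"
    "eigsol b P l (\<lambda>n t. Im (v l n t)) (\<lambda>n t. Im (v1 l n t))" if l: "l \<in> \<Lambda>" for l
    unfolding v_def v1_def
    by (rule eigsol_complex_combination; use re[of "(l, _)"] im[of "(l, _)"] l in \<open>force simp: J_def\<close>)+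
  have v0: "v l n t = 0" if "l \<in> \<Lambda>" "t \<in> {0..1}" for l n t
  proof (rule complex_eqI)
    show "Re (v l n t) = Re 0"
      using vanish[of "\<lambda>l n t. Re (v l n t)" "\<lambda>l n t. Re (v1 l n t)" l t n] sol(1) con that
      by (simp flip: Re_sum)
    show "Im (v l n t) = Im 0"
      using vanish[of "\<lambda>l n t. Im (v l n t)" "\<lambda>l n t. Im (v1 l n t)" l t n] sol(2) con that
      by (simp flip: Im_sum)
  qed
  have "c (l, i) = 0" if l: "l \<in> \<Lambda>" and i: "i < \<mu> l" for l i
  proof -
    \<comment> \<open>\<open>W\<close> reproduces the eigenfunctions off the vertices; these form a
      null set, and independence is modulo null functions.\<close>
    have "AE t in lborel. t \<notin> (\<int> :: real set)"
      by (intro AE_not_in countable_imp_null_set_lborel countable_int)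
    then have "AE t in lborel. 0 < t \<longrightarrow> (\<Sum>i<\<mu> l. c (l, i) * U l i t) = 0"
    proof eventually_elim
      case (elim t)
      show ?case
      proof
        assume t: "0 < t"
        define n where "n = nat \<lfloor>t\<rfloor>"
        have n: "real n = of_int \<lfloor>t\<rfloor>" using t by (simp add: n_def)
        have "real n \<noteq> t" using elim Ints_of_nat[of n, where 'a = real] by metis
        then have nt: "0 < t - n" "t - n < 1" using n by linarith+
        have "(\<Sum>i<\<mu> l. c (l, i) * U l i t) = v l n (t - n)"
          unfolding v_def using W[OF _ nt] l by (intro sum.cong) (auto simp: J_def)
        then show "(\<Sum>i<\<mu> l. c (l, i) * U l i t) = 0" using v0[OF l] nt by simp
      qed
    qed
    from ind[OF l this] i show ?thesis by simp
  qed
  then show False using c(1) by (auto simp: J_def)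
qed

text \<open>A supremum of multiplicities might be infinite or not attained. The bound for singletons
  makes it a maximum; extremal families for all of \<Lambda> together then give the sum. This is why
  the hypothesis ranges over subsets of \<Lambda>.\<close>

lemma eigen_mult_sum_bound:
  fixes \<Lambda> :: "real set"
  assumes fin: "finite \<Lambda>"
    and bound: "\<And>\<Lambda>' U \<mu>. \<Lambda>' \<subseteq> \<Lambda> \<Longrightarrow>
      (\<And>l i. l \<in> \<Lambda>' \<Longrightarrow> i < \<mu> l \<Longrightarrow> A_graph b V (U l i) (\<lambda>t. of_real l * U l i t)) \<Longrightarrow>
      (\<And>l c. l \<in> \<Lambda>' \<Longrightarrow> AE t in lborel. 0 < t \<longrightarrow> (\<Sum>i<\<mu> l. c i * U l i t) = 0 \<Longrightarrow> \<forall>i<\<mu> l. c i = 0) \<Longrightarrow>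
      (\<Sum>l\<in>\<Lambda>'. \<mu> l) \<le> D"
  shows "(\<Sum>l\<in>\<Lambda>. eigen_mult b V l) \<le> of_nat D"
proof -
  define M where "M l = {m::nat. \<exists>u::nat \<Rightarrow> real \<Rightarrow> complex.
        (\<forall>i<m. A_graph b V (u i) (\<lambda>t. of_real l * u i t)) \<and>
        (\<forall>c::nat \<Rightarrow> complex.
          (AE t in lborel. 0 < t \<longrightarrow> (\<Sum>i<m. c i * u i t) = 0) \<longrightarrow> (\<forall>i<m. c i = 0))}" for l
  have Mb: "m \<le> D" if l: "l \<in> \<Lambda>" and m: "m \<in> M l" for l m
  proof -
    obtain u where "\<forall>i<m. A_graph b V (u i) (\<lambda>t. of_real l * u i t)"
      "\<forall>c::nat \<Rightarrow> complex. (AE t in lborel. 0 < t \<longrightarrow> (\<Sum>i<m. c i * u i t) = 0) \<longrightarrow> (\<forall>i<m. c i = 0)"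
      using m unfolding M_def by blast
    then have "(\<Sum>l\<in>{l}. m) \<le> D"
      using l by (intro bound[of "{l}" "\<lambda>_. m" "\<lambda>_. u"]) auto
    then show ?thesis by simp
  qed
  \<comment> \<open>The empty family always qualifies, so \<open>Max\<close> is taken over a
    nonempty set.\<close>
  have M0: "0 \<in> M l" for l by (simp add: M_def)
  have Mfin: "finite (M l)" if "l \<in> \<Lambda>" for l
    by (rule finite_subset[of _ "{..D}"]) (use Mb[OF that] in auto)
  define \<mu> where "\<mu> l = Max (M l)" for l
  have \<mu>: "\<mu> l \<in> M l" "eigen_mult b V l = of_nat (\<mu> l)" if l: "l \<in> \<Lambda>" for l
  proof -
    show mem: "\<mu> l \<in> M l" unfolding \<mu>_def by (rule Max_in) (use Mfin[OF l] M0 in auto)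
    show "eigen_mult b V l = of_nat (\<mu> l)"
      unfolding eigen_mult_def M_def[symmetric]
    proof (rule antisym)
      show "(SUP m\<in>M l. of_nat m) \<le> (of_nat (\<mu> l) :: ennreal)"
        by (rule SUP_least) (use Mfin[OF l] in \<open>auto simp: \<mu>_def intro: Max_ge\<close>)
      show "(of_nat (\<mu> l) :: ennreal) \<le> (SUP m\<in>M l. of_nat m)"
        by (rule SUP_upper[OF mem])
    qed
  qed
  have "\<forall>l\<in>\<Lambda>. \<exists>u::nat \<Rightarrow> real \<Rightarrow> complex. (\<forall>i<\<mu> l. A_graph b V (u i) (\<lambda>t. of_real l * u i t)) \<and>
        (\<forall>c::nat \<Rightarrow> complex.
          (AE t in lborel. 0 < t \<longrightarrow> (\<Sum>i<\<mu> l. c i * u i t) = 0) \<longrightarrow> (\<forall>i<\<mu> l. c i = 0))"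
    using \<mu>(1) unfolding M_def by blast
  then obtain U :: "real \<Rightarrow> nat \<Rightarrow> real \<Rightarrow> complex" where
    U: "\<forall>l\<in>\<Lambda>. (\<forall>i<\<mu> l. A_graph b V (U l i) (\<lambda>t. of_real l * U l i t)) \<and>
        (\<forall>c::nat \<Rightarrow> complex.
          (AE t in lborel. 0 < t \<longrightarrow> (\<Sum>i<\<mu> l. c i * U l i t) = 0) \<longrightarrow> (\<forall>i<\<mu> l. c i = 0))"
    by (rule bchoice[THEN exE])
  have "(\<Sum>l\<in>\<Lambda>. \<mu> l) \<le> D"
    by (rule bound[of \<Lambda> \<mu> U]) (use U in auto)
  then have "(of_nat (\<Sum>l\<in>\<Lambda>. \<mu> l) :: ennreal) \<le> of_nat D" by (rule of_nat_mono)
  moreover have "(\<Sum>l\<in>\<Lambda>. eigen_mult b V l) = (\<Sum>l\<in>\<Lambda>. of_nat (\<mu> l))"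
    using \<mu>(2) by (intro sum.cong) auto
  ultimately show ?thesis by simp
qed

lemma sum_UNION_le_ennreal:
  fixes f :: "'a \<Rightarrow> ennreal"
  assumes "finite I" "\<And>i. i \<in> I \<Longrightarrow> finite (A i)"
  shows "sum f (\<Union>i\<in>I. A i) \<le> (\<Sum>i\<in>I. sum f (A i))"
  using assms
proof (induction I rule: finite_induct)
  case (insert i I)
  have "sum f (A i \<union> (\<Union>i\<in>I. A i)) \<le> sum f (A i \<union> (\<Union>i\<in>I. A i)) + sum f (A i \<inter> (\<Union>i\<in>I. A i))"
    by simp
  also have "\<dots> = sum f (A i) + sum f (\<Union>i\<in>I. A i)"
    using insert by (intro sum.union_inter) auto
  also have "\<dots> \<le> sum f (A i) + (\<Sum>i\<in>I. sum f (A i))"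
    using insert by (intro add_left_mono) auto
  finally show ?case using insert by simp
qed simp

text \<open>An unordered sum in \<open>ennreal\<close> is the supremum of its finite partial sums,
  so finite sets of eigenvalues suffice. They are distributed over intervals of length at most
  \<open>h\<close> that start at steps of \<open>h / 2\<close>.\<close>

lemma eigen_count_covering:
  assumes h: "h > 0" and l12: "l1 < l2" and N: "2 * (l2 - l1) / h \<le> real N"
    and piece: "\<And>\<alpha> \<gamma> \<Lambda>. l1 \<le> \<alpha> \<Longrightarrow> \<alpha> < \<gamma> \<Longrightarrow> \<gamma> \<le> l2 \<Longrightarrow> \<gamma> - \<alpha> \<le> h \<Longrightarrow> finite \<Lambda> \<Longrightarrow> \<Lambda> \<subseteq> {\<alpha><..<\<gamma>} \<Longrightarrow>
      (\<Sum>l\<in>\<Lambda>. eigen_mult b V l) \<le> of_nat D"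
  shows "eigen_count b V l1 l2 \<le> of_nat (N * D)"
proof -
  have "eigen_count b V l1 l2 = (SUP F\<in>{F. finite F \<and> F \<subseteq> {l1<..<l2}}. sum (eigen_mult b V) F)"
    unfolding eigen_count_def by (rule nonneg_infsum_complete) simp
  also have "\<dots> \<le> of_nat (N * D)"
  proof (rule SUP_least)
    fix F assume "F \<in> {F. finite F \<and> F \<subseteq> {l1<..<l2}}"
    then have F: "finite F" "F \<subseteq> {l1<..<l2}" by auto
    \<comment> \<open>The intervals overlap: a partition would miss eigenvalues at its division points.\<close>
    define A where "A i = F \<inter> {l1 + real i * (h / 2)<..<min (l1 + real i * (h / 2) + h) l2}" for i
    have "F \<subseteq> (\<Union>i\<in>{..<N}. A i)"
    proof
      fix x assume x: "x \<in> F"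
      then have x': "l1 < x" "x < l2" using F by auto
      define y where "y = (x - l1) / (h / 2)"
      have y: "0 < y" using x' h by (simp add: y_def)
      \<comment> \<open>With the ceiling minus 1, in place of the floor, \<open>x\<close> lies
        strictly to the right of the left end even if \<open>y\<close> is an integer.\<close>
      define i where "i = nat (\<lceil>y\<rceil> - 1)"
      have i: "real i < y" "y \<le> real i + 1" using y unfolding i_def by linarith+
      have "y * (h / 2) = x - l1" using h by (simp add: y_def)
      then have xy: "x = l1 + y * (h / 2)" by linarith
      have "y < 2 * (l2 - l1) / h" using x' h by (simp add: y_def field_simps)
      then have "i < N" using i N by linarith
      moreover have "l1 + real i * (h / 2) < x" unfolding xy using i h by simp
      moreover have "x < l1 + real i * (h / 2) + h"
      proof -
        have "y * (h / 2) \<le> (real i + 1) * (h / 2)" using i h by (intro mult_right_mono) auto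
        then show ?thesis unfolding xy using h by (simp add: distrib_right)
      qed
      ultimately show "x \<in> (\<Union>i\<in>{..<N}. A i)" using x x' by (auto simp: A_def)
    qed
    then have "F = (\<Union>i\<in>{..<N}. A i)" by (auto simp: A_def)
    then have "sum (eigen_mult b V) F = sum (eigen_mult b V) (\<Union>i\<in>{..<N}. A i)" by simp
    also have "\<dots> \<le> (\<Sum>i<N. sum (eigen_mult b V) (A i))"
      by (rule sum_UNION_le_ennreal) (use F in \<open>auto simp: A_def\<close>)
    also have "\<dots> \<le> (\<Sum>i<N. of_nat D)"
    proof (rule sum_mono)
      fix i
      show "sum (eigen_mult b V) (A i) \<le> of_nat D"
      \<comment> \<open>An interval that starts at or beyond \<open>l2\<close> is degenerate and
        outside the scope of \<open>piece\<close>, but it contains nothing.\<close>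
      proof (cases "A i = {}")
        case False
        then obtain x where "x \<in> A i" by blast
        then have "l1 + real i * (h / 2) < min (l1 + real i * (h / 2) + h) l2" by (auto simp: A_def)
        then show ?thesis
          using h F by (intro piece[of "l1 + real i * (h / 2)" "min (l1 + real i * (h / 2) + h) l2"])
            (auto simp: A_def min_def)
      qed simp
    qed
    finally show "sum (eigen_mult b V) F \<le> of_nat (N * D)" by simp
  qed
  finally show ?thesis .
qed

section \<open>The potential up to the root\<close>

text \<open>The hypotheses on \<open>q\<close> concern \<open>t > 0\<close>, whereas the cell
  estimates work on closed cells, the first of which may begin at 0. A bounded derivative makes
  \<open>q\<close> Lipschitz, hence extendable.\<close>

lemma continuous_extension_at_0:
  fixes q q' :: "real \<Rightarrow> real"
  assumes dq: "\<And>t. t > 0 \<Longrightarrow> (q has_real_derivative q' t) (at t)"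
    and B: "\<And>t. t > 0 \<Longrightarrow> \<bar>q' t\<bar> \<le> B"
  obtains r where "continuous_on {0..} r" "\<And>t. t > 0 \<Longrightarrow> r t = q t"
proof -
  have B0: "B \<ge> 0" using B[of 1] by simp
  have "B-lipschitz_on {0<..} q"
  proof (rule lipschitz_onI[OF _ B0])
    fix x y :: real assume xy: "x \<in> {0<..}" "y \<in> {0<..}"
    have "norm (q x - q y) \<le> B * norm (x - y)"
    proof (rule field_differentiable_bound[of "{0<..}" q q' B])
      show "(q has_field_derivative q' z) (at z within {0<..})" if "z \<in> {0<..}" for z
        using dq[of z] that by (auto intro: has_field_derivative_at_within)
    qed (use B xy in auto)
    then show "dist (q x) (q y) \<le> B * dist x y" by (simp add: dist_norm)
  qed
  then have "uniformly_continuous_on {0<..} q" by (rule lipschitz_on_uniformly_continuous)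
  then obtain r where r: "uniformly_continuous_on (closure {0<..}) r" "\<And>x. x \<in> {0<..} \<Longrightarrow> q x = r x"
    by (rule uniformly_continuous_on_extension_on_closure) blast
  show thesis
    by (rule that[of r]) (use uniformly_continuous_imp_continuous[OF r(1)] r(2) in auto)
qed

lemma nonneg_on_closed_halfline:
  fixes r :: "real \<Rightarrow> real"
  assumes "continuous_on {0..} r" "\<And>t. t > 0 \<Longrightarrow> 0 \<le> r t" "t \<ge> 0"
  shows "0 \<le> r t"
  using continuous_ge_on_closure[of "{0<..}" r t 0] assms by auto

text \<open>Truncated subtraction makes the terms with \<open>k \<ge> m\<close> vanish, so the
  series is a finite sum.\<close>

lemma suminf_of_nat_diff_le:
  "(\<Sum>k. of_nat (A * (m - k)) :: ennreal) \<le> of_nat (A * m * m)"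
proof -
  have "(\<Sum>k. of_nat (A * (m - k)) :: ennreal) = (\<Sum>k\<in>{..<m}. of_nat (A * (m - k)))"
    by (rule suminf_finite) auto
  also have "\<dots> \<le> (\<Sum>k\<in>{..<m}. of_nat (A * m))"
    by (intro sum_mono of_nat_mono mult_left_mono) auto
  also have "\<dots> = of_nat (A * m * m)" by (simp add: mult.commute)
  finally show ?thesis .
qed

theorem theorem5p11:
  fixes b l :: nat and \<kappa> c C g0 :: real and q q' :: "real \<Rightarrow> real" and I :: "real set"
  assumes "b \<ge> 2"
    and "\<kappa> > 0" and "c > 0" and "C > 0"
    and "\<And>t. t > 0 \<Longrightarrow> (q has_real_derivative q' t) (at t)"
    and "continuous_on {0<..} q'"
    and "\<And>t. t > 0 \<Longrightarrow> c * exp (- 2 * \<kappa> * t) \<le> q t"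
    and "\<And>t. t > 0 \<Longrightarrow> q t \<le> C * exp (- 2 * \<kappa> * t)"
    and "\<And>t. t > 0 \<Longrightarrow> \<bar>q' t\<bar> \<le> C * exp (- 2 * \<kappa> * t)"
    and "compact I" and "is_interval I"
    and "l = 0 \<Longrightarrow> I \<subseteq> closure (gap b 0)"
    and "l \<ge> 1 \<Longrightarrow> I \<subseteq> closure (gap b l) - {(pi * real l)\<^sup>2}"
    and "g0 > exp 1"
  shows "\<exists>C'::real. \<forall>l1\<in>I. \<forall>l2\<in>I. l1 < l2 \<longrightarrow>
    (\<forall>g\<ge>g0. tree_count b (\<lambda>t. - g * q t) l1 l2 \<le> ennreal (C' * (ln g)\<^sup>2))"
proof -
  note b = assms(1) and \<kappa> = assms(2) and c = assms(3) and C = assms(4) and dq = assms(5)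
    and qlow = assms(7) and qup = assms(8) and q'b = assms(9) and I = assms(10,11) and g0 = assms(14)
  \<comment> \<open>The factor by which the bound on the potential decays from one cell to the
    next.\<close>
  define \<rho> where "\<rho> = exp (- 2 * \<kappa>)"
  have \<rho>: "0 < \<rho>" "\<rho> < 1" using \<kappa> by (auto simp: \<rho>_def)
  have exp_le: "exp (- 2 * \<kappa> * t) \<le> 1" if "t \<ge> 0" for t using \<kappa> that by simp
  obtain \<sigma> \<epsilon> K m where \<sigma>: "\<sigma> = 1 \<or> \<sigma> = - 1" and \<epsilon>: "0 < \<epsilon>" and K: "0 < K"
    and tc: "\<And>\<beta>. \<beta> \<in> I \<Longrightarrow> tail_coercive b \<rho> \<epsilon> K m \<sigma> \<beta>"
    using gap_tail_coercive[OF b I assms(12,13) \<rho>] by blast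
  obtain B where B: "B > 0" "\<And>\<beta>. \<beta> \<in> I \<Longrightarrow> \<bar>\<beta>\<bar> \<le> B"
    using compact_imp_bounded[OF I(1)] unfolding bounded_pos by auto
  have "\<bar>q' t\<bar> \<le> C" if "t > 0" for t
  proof -
    have "C * exp (- 2 * \<kappa> * t) \<le> C * 1" using C exp_le[of t] that by (intro mult_left_mono) auto
    then show ?thesis using q'b[OF that] by linarith
  qed
  then obtain r where r: "continuous_on {0..} r" "\<And>t. t > 0 \<Longrightarrow> r t = q t"
    using continuous_extension_at_0[OF dq] by blast
  have r0: "0 \<le> r t" if "t \<ge> 0" for t
  proof (rule nonneg_on_closed_halfline[OF r(1) _ that])
    fix s :: real assume s: "s > 0"
    have "0 \<le> c * exp (- 2 * \<kappa> * s)" using c by simp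
    then show "0 \<le> r s" using r(2)[OF s] qlow[OF s] by linarith
  qed
  have rC: "r t \<le> C * exp (- 2 * \<kappa> * t)" if "t \<ge> 0" for t
  proof -
    have "0 \<le> C * exp (- 2 * \<kappa> * t) - r t"
      by (rule nonneg_on_closed_halfline[OF _ _ that]) (use r qup in \<open>auto intro!: continuous_intros\<close>)
    then show ?thesis by simp
  qed
  \<comment> \<open>Bounds the logarithmic derivative of \<open>q\<close>; multiplying
    \<open>q\<close> by \<open>g\<close> does not change it, which keeps \<open>h\<close>
    independent of \<open>g\<close>.\<close>
  define L where "L = C / c"
  have L: "L > 0" using C c by (simp add: L_def)
  have q'L: "\<bar>q' t\<bar> \<le> L * r t" if t: "t > 0" for t
  proof -
    have "C * exp (- 2 * \<kappa> * t) = L * (c * exp (- 2 * \<kappa> * t))" using c by (simp add: L_def)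
    also have "\<dots> \<le> L * q t" using qlow[OF t] L by (intro mult_left_mono) auto
    finally show ?thesis using q'b[OF t] r(2)[OF t] by simp
  qed
  \<comment> \<open>The two terms are the smallness conditions of
    \<open>eigsol_family_vanish\<close> for the tail and for the head. Together with
    \<open>l2 - l1 \<le> 2 * B\<close> on \<open>I\<close> they give a number \<open>N\<close> of
    intervals that is uniform in \<open>l1\<close>, \<open>l2\<close> and \<open>g\<close>.\<close>
  define h where "h = min (1 / K) (2 / (1 + exp (2 + B + L)))"
  have eL: "0 < 1 + exp (2 + B + L)" by (simp add: add_pos_pos)
  have h: "h > 0" using K eL by (simp add: h_def)
  define N where "N = nat \<lceil>2 * (2 * B) / h\<rceil>"
  \<comment> \<open>Chosen so that \<open>M \<le> A * ln g\<close>: as \<open>ln g \<ge> 1\<close>,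
    constant terms become multiples of \<open>ln g\<close>, and the last summand pays for rounding
    up.\<close>
  define A where "A = (1 + \<bar>ln (C / \<epsilon>)\<bar>) / (2 * \<kappa>) + 1"
  show ?thesis
  proof (intro exI ballI impI allI)
    fix l1 l2 g assume l12: "l1 \<in> I" "l2 \<in> I" "l1 < l2" and g: "g \<ge> g0"
    have g1: "g > exp 1" using g g0 by linarith
    have gpos: "g > 0" using g1 by (metis exp_gt_zero less_trans)
    have lng: "ln g \<ge> 1" using g1 gpos by (simp add: ln_ge_iff)
    have subI: "{l1..l2} \<subseteq> I" using mem_is_interval_1_I[OF I(2) l12(1,2)] by auto
    \<comment> \<open>From the vertex \<open>M\<close> on, \<open>g * q\<close> is at most
      \<epsilon>; if the logarithm is negative, \<open>nat\<close> gives 0 and there is no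
      head.\<close>
    define M where "M = nat \<lceil>ln (g * C / \<epsilon>) / (2 * \<kappa>)\<rceil>"
    have Mle: "g * C * exp (- 2 * \<kappa> * real j) \<le> \<epsilon>" if "M \<le> j" for j
    proof -
      have "ln (g * C / \<epsilon>) / (2 * \<kappa>) \<le> real M" unfolding M_def by linarith
      also have "\<dots> \<le> real j" using that by simp
      finally have "ln (g * C / \<epsilon>) \<le> 2 * \<kappa> * real j" using \<kappa> by (simp add: field_simps)
      then have "exp (ln (g * C / \<epsilon>)) \<le> exp (2 * \<kappa> * real j)" by simp
      then have "g * C / \<epsilon> \<le> exp (2 * \<kappa> * real j)" using gpos C \<epsilon> by simp
      then show ?thesis using \<epsilon> by (simp add: exp_minus field_simps)
    qed
    \<comment> \<open>The shift by \<open>k\<close> cuts off \<open>k\<close> cells of the head and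
      leaves \<open>M - k\<close>. For \<open>k \<ge> M\<close> the whole half-line is tail, no
      condition is imposed and there are no eigenvalues, so only finitely many \<open>k\<close>
      contribute.\<close>
    have piece: "(\<Sum>l\<in>\<Lambda>. eigen_mult b (\<lambda>t. - g * q (t + real k)) l) \<le> of_nat (3 * (M - k))"
      if \<alpha>\<gamma>: "l1 \<le> \<alpha>" "\<alpha> < \<gamma>" "\<gamma> \<le> l2" "\<gamma> - \<alpha> \<le> h" and \<Lambda>: "finite \<Lambda>" "\<Lambda> \<subseteq> {\<alpha><..<\<gamma>}" for \<alpha> \<gamma> \<Lambda> k
    proof (rule eigen_mult_sum_bound[OF \<Lambda>(1)])
      fix \<Lambda>' :: "real set" and U :: "real \<Rightarrow> nat \<Rightarrow> real \<Rightarrow> complex" and \<mu> :: "real \<Rightarrow> nat"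
      assume \<Lambda>': "\<Lambda>' \<subseteq> \<Lambda>"
        and eig: "\<And>l i. l \<in> \<Lambda>' \<Longrightarrow> i < \<mu> l \<Longrightarrow> A_graph b (\<lambda>t. - g * q (t + real k)) (U l i) (\<lambda>t. of_real l * U l i t)"
        and ind: "\<And>l c. l \<in> \<Lambda>' \<Longrightarrow> AE t in lborel. 0 < t \<longrightarrow> (\<Sum>i<\<mu> l. c i * U l i t) = 0 \<Longrightarrow> \<forall>i<\<mu> l. c i = 0"
      define P where "P n t = - g * r (real k + real n + t)" for n :: nat and t
      define P' where "P' n t = - g * q' (real k + real n + t)" for n :: nat and t
      define T where "T = M - k"
      have fin': "finite \<Lambda>'" "\<Lambda>' \<subseteq> {\<alpha><..<\<gamma>}" using \<Lambda> \<Lambda>' by (auto intro: finite_subset)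
      have cP: "continuous_on {0..1} (P n)" for n
        unfolding P_def by (intro continuous_intros continuous_on_compose2[OF r(1)]) auto
      have Pb: "\<bar>P n t\<bar> \<le> g * C * exp (- 2 * \<kappa> * (real k + real n))" if t: "t \<ge> 0" for n t
      proof -
        have "\<bar>P n t\<bar> = g * r (real k + real n + t)" using gpos r0[of "real k + real n + t"] t by (simp add: P_def abs_mult)
        also have "\<dots> \<le> g * (C * exp (- 2 * \<kappa> * (real k + real n + t)))"
          using rC[of "real k + real n + t"] t gpos by (intro mult_left_mono) auto
        also have "\<dots> \<le> g * (C * exp (- 2 * \<kappa> * (real k + real n)))"
          using gpos C \<kappa> t by (intro mult_left_mono) auto
        finally show ?thesis by simp
      qed
      show "(\<Sum>l\<in>\<Lambda>'. \<mu> l) \<le> 3 * (M - k)"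
        unfolding T_def[symmetric]
      proof (rule multiplicity_sum_bound[OF fin' _ cP eig ind])
        show "P n t = - g * q (real n + t + real k)" if "0 < t" "t < 1" for n t
          using r(2)[of "real k + real n + t"] that by (simp add: P_def add.commute add.left_commute)
      next
        fix w w1 :: "real \<Rightarrow> nat \<Rightarrow> real \<Rightarrow> real" and l t :: real and n :: nat
        assume w: "\<And>l. l \<in> \<Lambda>' \<Longrightarrow> eigsol b P l (w l) (w1 l)"
          and con: "\<And>n. n < T \<Longrightarrow> (\<Sum>l\<in>\<Lambda>'. w l n 0) = 0" "\<And>n. n < T \<Longrightarrow> (\<Sum>l\<in>\<Lambda>'. w1 l n 0) = 0"
            "\<And>n. n < T \<Longrightarrow> (\<Sum>l\<in>\<Lambda>'. w l (Suc n) 0) = 0"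
          and lt: "l \<in> \<Lambda>'" "t \<in> {0..1}"
        define \<beta> where "\<beta> = (if \<sigma> = 1 then \<gamma> else \<alpha>)"
        have \<beta>I: "\<beta> \<in> I" using subI \<alpha>\<gamma> by (auto simp: \<beta>_def)
        have b1: "b \<ge> 1" using b by simp
        show "w l n t = 0"
        proof (rule eigsol_family_vanish[OF fin' b1 w cP _ tc[OF \<beta>I] _ \<alpha>\<gamma>(2) _ _ B(2)[OF \<beta>I] less_imp_le[OF L]
              _ _ _ _ con lt, where P' = P' and M = "g * C"])
          fix n :: nat and t :: real assume "t \<in> {0..1}"
          then have "\<bar>P n t\<bar> \<le> g * C * exp (- 2 * \<kappa> * (real k + real n))" by (intro Pb) auto
          also have "\<dots> \<le> g * C * 1" using gpos C exp_le[of "real k + real n"] by (intro mult_left_mono) auto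
          finally show "\<bar>P n t\<bar> \<le> g * C" by simp
        next
          show "\<sigma> = 1 \<and> \<beta> = \<gamma> \<or> \<sigma> = - 1 \<and> \<beta> = \<alpha>" using \<sigma> by (auto simp: \<beta>_def)
          have "\<gamma> - \<alpha> \<le> 1 / K" using \<alpha>\<gamma> by (simp add: h_def)
          then show "(\<gamma> - \<alpha>) * K \<le> 1" using K by (simp add: field_simps)
          have "\<gamma> - \<alpha> \<le> 2 / (1 + exp (2 + B + L))" using \<alpha>\<gamma> by (simp add: h_def)
          then show "(\<gamma> - \<alpha>) * (1 + exp (2 + B + L)) \<le> 2" using eL by (simp add: pos_le_divide_eq)
        next
          fix n :: nat and t :: real assume n: "n < T" and t: "0 < t" "t < 1"
          have pos: "real k + real n + t > 0" using t by simp
          \<comment> \<open>\<open>P\<close> is built from the extension \<open>r\<close>, while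
            differentiability is known for \<open>q\<close>; they agree at positive
            arguments.\<close>
          have "((\<lambda>x. - g * q (real k + real n + x)) has_real_derivative P' n t) (at t)"
            unfolding P'_def using dq[OF pos]
            by (intro DERIV_cmult) (simp add: DERIV_shift add.commute)
          then show "(P n has_real_derivative P' n t) (at t)"
            by (rule has_field_derivative_transform_within_open[where S = "{0<..}"])
               (use t r(2) in \<open>auto simp: P_def\<close>)
          have "\<bar>P' n t\<bar> = g * \<bar>q' (real k + real n + t)\<bar>" using gpos by (simp add: P'_def abs_mult)
          also have "\<dots> \<le> g * (L * r (real k + real n + t))"
            using q'L[OF pos] gpos by (intro mult_left_mono) auto
          finally show "\<bar>P' n t\<bar> \<le> - L * P n t" by (simp add: P_def mult.left_commute)
        next
          fix n :: nat and t :: real assume "0 \<le> t"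
          then show "P n t \<le> 0" unfolding P_def using r0[of "real k + real n + t"] gpos by simp
        next
          fix n :: nat and t :: real assume t: "t \<in> {0..1}"
          \<comment> \<open>Only an inequality, because the subtraction in \<open>T\<close> may be
            truncated.\<close>
          have "M \<le> k + T" by (simp add: T_def)
          have "\<bar>P (T + n) t\<bar> \<le> g * C * exp (- 2 * \<kappa> * (real k + real (T + n)))" using t by (intro Pb) auto
          also have "\<dots> = (g * C * exp (- 2 * \<kappa> * real (k + T))) * \<rho> ^ n"
            by (simp add: \<rho>_def algebra_simps flip: exp_add exp_of_nat_mult)
          also have "\<dots> \<le> \<epsilon> * \<rho> ^ n"
            using Mle[OF \<open>M \<le> k + T\<close>] \<rho> by (intro mult_right_mono) auto
          finally show "\<bar>P (T + n) t\<bar> \<le> \<epsilon> * \<rho> ^ n" .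
        qed
      qed
    qed
    have "2 * (l2 - l1) / h \<le> 2 * (2 * B) / h"
      using B(2)[OF l12(1)] B(2)[OF l12(2)] h by (intro divide_right_mono) auto
    also have "\<dots> \<le> real N" unfolding N_def by linarith
    finally have Nh: "2 * (l2 - l1) / h \<le> real N" .
    have cnt: "eigen_count b (\<lambda>t. - g * q (t + real k)) l1 l2 \<le> of_nat ((3 * N) * (M - k))" for k
    proof -
      have "eigen_count b (\<lambda>t. - g * q (t + real k)) l1 l2 \<le> of_nat (N * (3 * (M - k)))"
        by (rule eigen_count_covering[OF h l12(3) Nh]) (rule piece)
      then show ?thesis by (simp add: algebra_simps)
    qed
    have "tree_count b (\<lambda>t. - g * q t) l1 l2 \<le> (\<Sum>k. of_nat ((3 * N) * (M - k)))"
      unfolding tree_count_def by (intro suminf_le cnt) auto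
    also have "\<dots> \<le> of_nat (3 * N * M * M)" by (rule suminf_of_nat_diff_le)
    also have "\<dots> = ennreal (real (3 * N * M * M))" by (simp add: ennreal_of_nat_eq_real_of_nat)
    also have "\<dots> \<le> ennreal (3 * real N * A\<^sup>2 * (ln g)\<^sup>2)"
    proof (rule ennreal_leI)
      have "ln (g * C / \<epsilon>) = ln g + ln (C / \<epsilon>)" using gpos C \<epsilon> by (simp add: ln_mult ln_div)
      also have "\<dots> \<le> ln g + \<bar>ln (C / \<epsilon>)\<bar> * ln g"
        using mult_left_mono[OF lng, of "\<bar>ln (C / \<epsilon>)\<bar>"] by simp
      finally have "ln (g * C / \<epsilon>) / (2 * \<kappa>) \<le> (1 + \<bar>ln (C / \<epsilon>)\<bar>) * ln g / (2 * \<kappa>)"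
        using \<kappa> by (intro divide_right_mono) (auto simp: algebra_simps)
      moreover have "0 \<le> (1 + \<bar>ln (C / \<epsilon>)\<bar>) * ln g / (2 * \<kappa>)" using \<kappa> lng by simp
      ultimately have "real M \<le> (1 + \<bar>ln (C / \<epsilon>)\<bar>) * ln g / (2 * \<kappa>) + 1" unfolding M_def by linarith
      also have "\<dots> \<le> A * ln g" using lng by (simp add: A_def distrib_right)
      finally have MA: "real M \<le> A * ln g" .
      have "real (3 * N * M * M) = 3 * real N * (real M * real M)" by simp
      also have "\<dots> \<le> 3 * real N * ((A * ln g) * (A * ln g))"
        using MA by (intro mult_left_mono mult_mono) auto
      finally show "real (3 * N * M * M) \<le> 3 * real N * A\<^sup>2 * (ln g)\<^sup>2"
        by (simp add: power2_eq_square algebra_simps)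
    qed
    finally show "tree_count b (\<lambda>t. - g * q t) l1 l2 \<le> ennreal (3 * real N * A\<^sup>2 * (ln g)\<^sup>2)" .
  qed
qed

end
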